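(* Let $\mathcal{C}$ be a finite tensor category and let $\mathcal{B}$ be a central tensor subcategory of $\mathcal{C}$. For any tensor subcategories $\mathcal{D}_1,\mathcal{D}_2\subseteq\mathcal{C}$ with $\mathcal{D}_1\subseteq\mathcal{D}_2$, we have $$\mathcal{D}_1\vee(\mathcal{B}\wedge\mathcal{D}_2)=(\mathcal{D}_1\vee\mathcal{B})\wedge\mathcal{D}_2 .$$
   Context: The base field $\Bbbk$ is algebraically closed. A finite tensor category is a rigid monoidal, finite $\Bbbk$-linear abelian category with bilinear tensor product and simple unit object. A tensor functor is an exact $\Bbbk$-linear strong monoidal functor. A tensor subcategory of $\mathcal{C}$ is a full subcategory containing the unit and closed under subobjects, quotients, finite direct sums, tensor products and duals. For tensor subcategories, $\mathcal{D}_1\wedge\mathcal{D}_2=\mathcal{D}_1\cap\mathcal{D}_2$ is the full subcategory of objects in both, and $\mathcal{D}_1\vee\mathcal{D}_2$ is the smallest tensor subcategory of $\mathcal{C}$ containing both. A monoidal functor $F:\mathcal{B}\to\mathcal{C}$ from a braided monoidal category is central if there is a braided monoidal functor $\widetilde F:\mathcal{B}\to\mathcal{Z}(\mathcal{C})$ to the Drinfeld center whose composite with the forgetful functor $\mathcal{Z}(\mathcal{C})\to\mathcal{C}$ is $F$. A braided finite tensor category $\mathcal{B}$ is called a central tensor subcategory of $\mathcal{C}$ if it comes with a fully faithful tensor functor $F:\mathcal{B}\to\mathcal{C}$ which is central; $\mathcal{B}$ is then identified with its essential image $F(\mathcal{B})\subseteq\mathcal{C}$, which is a tensor subcategory. 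*)

theory Defs
  imports "HOL-Computational_Algebra.Polynomial" "HOL-Library.FuncSet"
begin

section \<open>Categories\<close>

text \<open>
  Objects and morphisms are carriers inside arbitrary types.  Composition \<open>g \<cdot> f\<close> is in the
  usual order: first \<open>f\<close>, then \<open>g\<close>.
\<close>

record ('o, 'm) cat =
  obj :: "'o set"
  mor :: "'m set"
  src :: "'m \<Rightarrow> 'o"
  tgt :: "'m \<Rightarrow> 'o"
  ident :: "'o \<Rightarrow> 'm"
  cmp :: "'m \<Rightarrow> 'm \<Rightarrow> 'm" (infixl "\<cdot>\<index>" 70)

definition hom :: "('o, 'm, 'z) cat_scheme \<Rightarrow> 'o \<Rightarrow> 'o \<Rightarrow> 'm set" where
  "hom C X Y = {f \<in> mor C. src C f = X \<and> tgt C f = Y}"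

locale category =
  fixes C :: "('o, 'm, 'z) cat_scheme" (structure)
  assumes src_obj: "f \<in> mor C \<Longrightarrow> src C f \<in> obj C"
    and tgt_obj: "f \<in> mor C \<Longrightarrow> tgt C f \<in> obj C"
    and ident_hom: "X \<in> obj C \<Longrightarrow> ident C X \<in> hom C X X"
    and cmp_hom: "f \<in> hom C X Y \<Longrightarrow> g \<in> hom C Y Z \<Longrightarrow> g \<cdot> f \<in> hom C X Z"
    and cmp_ident_left: "f \<in> hom C X Y \<Longrightarrow> ident C Y \<cdot> f = f"
    and cmp_ident_right: "f \<in> hom C X Y \<Longrightarrow> f \<cdot> ident C X = f"
    and cmp_assoc: "f \<in> hom C W X \<Longrightarrow> g \<in> hom C X Y \<Longrightarrow> h \<in> hom C Y Z \<Longrightarrow>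
      h \<cdot> (g \<cdot> f) = (h \<cdot> g) \<cdot> f"

definition inverse_of :: "('o, 'm, 'z) cat_scheme \<Rightarrow> 'm \<Rightarrow> 'm \<Rightarrow> bool" where
  "inverse_of C f g \<longleftrightarrow> f \<in> mor C \<and> g \<in> hom C (tgt C f) (src C f) \<and>
     g \<cdot>\<^bsub>C\<^esub> f = ident C (src C f) \<and> f \<cdot>\<^bsub>C\<^esub> g = ident C (tgt C f)"

definition is_iso :: "('o, 'm, 'z) cat_scheme \<Rightarrow> 'm \<Rightarrow> bool" where
  "is_iso C f \<longleftrightarrow> (\<exists>g. inverse_of C f g)"

definition inverse_mor :: "('o, 'm, 'z) cat_scheme \<Rightarrow> 'm \<Rightarrow> 'm" where
  "inverse_mor C f = (THE g. inverse_of C f g)"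

definition isomorphic :: "('o, 'm, 'z) cat_scheme \<Rightarrow> 'o \<Rightarrow> 'o \<Rightarrow> bool" where
  "isomorphic C X Y \<longleftrightarrow> (\<exists>f \<in> hom C X Y. is_iso C f)"

definition is_mono :: "('o, 'm, 'z) cat_scheme \<Rightarrow> 'm \<Rightarrow> bool" where
  "is_mono C f \<longleftrightarrow> f \<in> mor C \<and>
     (\<forall>W. \<forall>g \<in> hom C W (src C f). \<forall>h \<in> hom C W (src C f). f \<cdot>\<^bsub>C\<^esub> g = f \<cdot>\<^bsub>C\<^esub> h \<longrightarrow> g = h)"

definition is_epi :: "('o, 'm, 'z) cat_scheme \<Rightarrow> 'm \<Rightarrow> bool" where
  "is_epi C f \<longleftrightarrow> f \<in> mor C \<and>
     (\<forall>W. \<forall>g \<in> hom C (tgt C f) W. \<forall>h \<in> hom C (tgt C f) W. g \<cdot>\<^bsub>C\<^esub> f = h \<cdot>\<^bsub>C\<^esub> f \<longrightarrow> g = h)"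

definition is_zero :: "('o, 'm, 'z) cat_scheme \<Rightarrow> 'o \<Rightarrow> bool" where
  "is_zero C Z \<longleftrightarrow> Z \<in> obj C \<and> (\<forall>X \<in> obj C. (\<exists>!f. f \<in> hom C X Z) \<and> (\<exists>!f. f \<in> hom C Z X))"

definition projective :: "('o, 'm, 'z) cat_scheme \<Rightarrow> 'o \<Rightarrow> bool" where
  "projective C P \<longleftrightarrow> P \<in> obj C \<and>
     (\<forall>e f. is_epi C e \<and> f \<in> hom C P (tgt C e) \<longrightarrow> (\<exists>g \<in> hom C P (src C e). e \<cdot>\<^bsub>C\<^esub> g = f))"

definition simple_object :: "('o, 'm, 'z) cat_scheme \<Rightarrow> 'o \<Rightarrow> bool" where
  "simple_object C X \<longleftrightarrow> X \<in> obj C \<and> \<not> is_zero C X \<and>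
     (\<forall>i. is_mono C i \<and> tgt C i = X \<longrightarrow> is_zero C (src C i) \<or> is_iso C i)"


section \<open>Monoidal and braided categories\<close>

text \<open>
  The tensor product is \<open>\<otimes>\<close> on objects and \<open>\<odot>\<close> on morphisms.  The associator goes
  \<open>(X \<otimes> Y) \<otimes> Z \<rightarrow> X \<otimes> (Y \<otimes> Z)\<close>.
\<close>

record ('o, 'm) mon_cat = "('o, 'm) cat" +
  tensO :: "'o \<Rightarrow> 'o \<Rightarrow> 'o" (infixl "\<otimes>\<index>" 75)
  tensM :: "'m \<Rightarrow> 'm \<Rightarrow> 'm" (infixl "\<odot>\<index>" 75)
  unit_obj :: 'o ("\<one>\<index>")
  assoc :: "'o \<Rightarrow> 'o \<Rightarrow> 'o \<Rightarrow> 'm"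
  lunit :: "'o \<Rightarrow> 'm"
  runit :: "'o \<Rightarrow> 'm"

locale monoidal_category = category C
  for C :: "('o, 'm, 'z) mon_cat_scheme" (structure) +
  assumes tensO_obj: "X \<in> obj C \<Longrightarrow> Y \<in> obj C \<Longrightarrow> X \<otimes> Y \<in> obj C"
    and tensM_hom: "f \<in> hom C X X' \<Longrightarrow> g \<in> hom C Y Y' \<Longrightarrow> f \<odot> g \<in> hom C (X \<otimes> Y) (X' \<otimes> Y')"
    and tensM_ident: "X \<in> obj C \<Longrightarrow> Y \<in> obj C \<Longrightarrow> ident C X \<odot> ident C Y = ident C (X \<otimes> Y)"
    and interchange: "f \<in> hom C X X' \<Longrightarrow> f' \<in> hom C X' X'' \<Longrightarrow> g \<in> hom C Y Y' \<Longrightarrow> g' \<in> hom C Y' Y'' \<Longrightarrow>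
      (f' \<cdot> f) \<odot> (g' \<cdot> g) = (f' \<odot> g') \<cdot> (f \<odot> g)"
    and unit_obj: "\<one> \<in> obj C"
    and assoc_hom: "X \<in> obj C \<Longrightarrow> Y \<in> obj C \<Longrightarrow> Z \<in> obj C \<Longrightarrow>
      assoc C X Y Z \<in> hom C (X \<otimes> Y \<otimes> Z) (X \<otimes> (Y \<otimes> Z))"
    and assoc_iso: "X \<in> obj C \<Longrightarrow> Y \<in> obj C \<Longrightarrow> Z \<in> obj C \<Longrightarrow> is_iso C (assoc C X Y Z)"
    and assoc_natural: "f \<in> hom C X X' \<Longrightarrow> g \<in> hom C Y Y' \<Longrightarrow> h \<in> hom C Z Z' \<Longrightarrow>
      assoc C X' Y' Z' \<cdot> (f \<odot> g \<odot> h) = (f \<odot> (g \<odot> h)) \<cdot> assoc C X Y Z"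
    and lunit_hom: "X \<in> obj C \<Longrightarrow> lunit C X \<in> hom C (\<one> \<otimes> X) X"
    and lunit_iso: "X \<in> obj C \<Longrightarrow> is_iso C (lunit C X)"
    and lunit_natural: "f \<in> hom C X X' \<Longrightarrow> lunit C X' \<cdot> (ident C \<one> \<odot> f) = f \<cdot> lunit C X"
    and runit_hom: "X \<in> obj C \<Longrightarrow> runit C X \<in> hom C (X \<otimes> \<one>) X"
    and runit_iso: "X \<in> obj C \<Longrightarrow> is_iso C (runit C X)"
    and runit_natural: "f \<in> hom C X X' \<Longrightarrow> runit C X' \<cdot> (f \<odot> ident C \<one>) = f \<cdot> runit C X"
    and triangle: "X \<in> obj C \<Longrightarrow> Y \<in> obj C \<Longrightarrow>
      (ident C X \<odot> lunit C Y) \<cdot> assoc C X \<one> Y = runit C X \<odot> ident C Y"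
    and pentagon: "W \<in> obj C \<Longrightarrow> X \<in> obj C \<Longrightarrow> Y \<in> obj C \<Longrightarrow> Z \<in> obj C \<Longrightarrow>
      assoc C W X (Y \<otimes> Z) \<cdot> assoc C (W \<otimes> X) Y Z =
      (ident C W \<odot> assoc C X Y Z) \<cdot> assoc C W (X \<otimes> Y) Z \<cdot> (assoc C W X Y \<odot> ident C Z)"

text \<open>\<open>dual_pair C Y X\<close>: \<open>Y\<close> is a left dual of \<open>X\<close>; equivalently, \<open>X\<close> is a right dual of \<open>Y\<close>.\<close>

definition dual_pair :: "('o, 'm, 'z) mon_cat_scheme \<Rightarrow> 'o \<Rightarrow> 'o \<Rightarrow> bool" where
  "dual_pair C Y X \<longleftrightarrow> X \<in> obj C \<and> Y \<in> obj C \<and>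
     (\<exists>ev \<in> hom C (Y \<otimes>\<^bsub>C\<^esub> X) \<one>\<^bsub>C\<^esub>. \<exists>coev \<in> hom C \<one>\<^bsub>C\<^esub> (X \<otimes>\<^bsub>C\<^esub> Y).
        runit C X \<cdot>\<^bsub>C\<^esub> (ident C X \<odot>\<^bsub>C\<^esub> ev) \<cdot>\<^bsub>C\<^esub> assoc C X Y X \<cdot>\<^bsub>C\<^esub>
          (coev \<odot>\<^bsub>C\<^esub> ident C X) \<cdot>\<^bsub>C\<^esub> inverse_mor C (lunit C X) = ident C X \<and>
        lunit C Y \<cdot>\<^bsub>C\<^esub> (ev \<odot>\<^bsub>C\<^esub> ident C Y) \<cdot>\<^bsub>C\<^esub> inverse_mor C (assoc C Y X Y) \<cdot>\<^bsub>C\<^esub>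
          (ident C Y \<odot>\<^bsub>C\<^esub> coev) \<cdot>\<^bsub>C\<^esub> inverse_mor C (runit C Y) = ident C Y)"

locale rigid_monoidal_category = monoidal_category C
  for C :: "('o, 'm, 'z) mon_cat_scheme" (structure) +
  assumes left_dual: "X \<in> obj C \<Longrightarrow> \<exists>Y. dual_pair C Y X"
    and right_dual: "X \<in> obj C \<Longrightarrow> \<exists>Y. dual_pair C X Y"

locale braided_category = monoidal_category B
  for B :: "('o, 'm, 'z) mon_cat_scheme" (structure) +
  fixes \<beta> :: "'o \<Rightarrow> 'o \<Rightarrow> 'm"
  assumes braid_hom: "X \<in> obj B \<Longrightarrow> Y \<in> obj B \<Longrightarrow> \<beta> X Y \<in> hom B (X \<otimes> Y) (Y \<otimes> X)"
    and braid_iso: "X \<in> obj B \<Longrightarrow> Y \<in> obj B \<Longrightarrow> is_iso B (\<beta> X Y)"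
    and braid_natural: "f \<in> hom B X X' \<Longrightarrow> g \<in> hom B Y Y' \<Longrightarrow>
      \<beta> X' Y' \<cdot> (f \<odot> g) = (g \<odot> f) \<cdot> \<beta> X Y"
    and hexagon1: "X \<in> obj B \<Longrightarrow> Y \<in> obj B \<Longrightarrow> Z \<in> obj B \<Longrightarrow>
      assoc B Y Z X \<cdot> \<beta> X (Y \<otimes> Z) \<cdot> assoc B X Y Z =
      (ident B Y \<odot> \<beta> X Z) \<cdot> assoc B Y X Z \<cdot> (\<beta> X Y \<odot> ident B Z)"
    and hexagon2: "X \<in> obj B \<Longrightarrow> Y \<in> obj B \<Longrightarrow> Z \<in> obj B \<Longrightarrow>
      inverse_mor B (assoc B Z X Y) \<cdot> \<beta> (X \<otimes> Y) Z \<cdot> inverse_mor B (assoc B X Y Z) =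
      (\<beta> X Z \<odot> ident B Y) \<cdot> inverse_mor B (assoc B X Z Y) \<cdot> (ident B X \<odot> \<beta> Y Z)"


section \<open>Linear abelian categories\<close>

record ('o, 'm, 'k) lin_mon_cat = "('o, 'm) mon_cat" +
  add :: "'m \<Rightarrow> 'm \<Rightarrow> 'm" (infixl "\<oplus>\<index>" 65)
  zero_mor :: "'o \<Rightarrow> 'o \<Rightarrow> 'm"
  scale :: "'k \<Rightarrow> 'm \<Rightarrow> 'm" (infixr "\<star>\<index>" 80)

locale linear_category = category C
  for C :: "('o, 'm, 'k::field, 'z) lin_mon_cat_scheme" (structure) +
  assumes add_hom: "f \<in> hom C X Y \<Longrightarrow> g \<in> hom C X Y \<Longrightarrow> f \<oplus> g \<in> hom C X Y"
    and add_assoc: "f \<in> hom C X Y \<Longrightarrow> g \<in> hom C X Y \<Longrightarrow> h \<in> hom C X Y \<Longrightarrow> f \<oplus> g \<oplus> h = f \<oplus> (g \<oplus> h)"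
    and add_commute: "f \<in> hom C X Y \<Longrightarrow> g \<in> hom C X Y \<Longrightarrow> f \<oplus> g = g \<oplus> f"
    and zero_hom: "X \<in> obj C \<Longrightarrow> Y \<in> obj C \<Longrightarrow> zero_mor C X Y \<in> hom C X Y"
    and add_zero: "f \<in> hom C X Y \<Longrightarrow> f \<oplus> zero_mor C X Y = f"
    and add_inverse: "f \<in> hom C X Y \<Longrightarrow> \<exists>g \<in> hom C X Y. f \<oplus> g = zero_mor C X Y"
    and scale_hom: "f \<in> hom C X Y \<Longrightarrow> a \<star> f \<in> hom C X Y"
    and scale_add_right: "f \<in> hom C X Y \<Longrightarrow> g \<in> hom C X Y \<Longrightarrow> a \<star> (f \<oplus> g) = a \<star> f \<oplus> a \<star> g"
    and scale_add_left: "f \<in> hom C X Y \<Longrightarrow> (a + b) \<star> f = a \<star> f \<oplus> b \<star> f"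
    and scale_scale: "f \<in> hom C X Y \<Longrightarrow> a \<star> b \<star> f = (a * b) \<star> f"
    and scale_one: "f \<in> hom C X Y \<Longrightarrow> 1 \<star> f = f"
    and cmp_add_left: "f \<in> hom C X Y \<Longrightarrow> g \<in> hom C Y Z \<Longrightarrow> h \<in> hom C Y Z \<Longrightarrow>
      (g \<oplus> h) \<cdot> f = g \<cdot> f \<oplus> h \<cdot> f"
    and cmp_add_right: "f \<in> hom C X Y \<Longrightarrow> g \<in> hom C X Y \<Longrightarrow> h \<in> hom C Y Z \<Longrightarrow>
      h \<cdot> (f \<oplus> g) = h \<cdot> f \<oplus> h \<cdot> g"
    and cmp_scale_left: "f \<in> hom C X Y \<Longrightarrow> g \<in> hom C Y Z \<Longrightarrow> (a \<star> g) \<cdot> f = a \<star> (g \<cdot> f)"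
    and cmp_scale_right: "f \<in> hom C X Y \<Longrightarrow> g \<in> hom C Y Z \<Longrightarrow> g \<cdot> (a \<star> f) = a \<star> (g \<cdot> f)"

definition is_kernel :: "('o, 'm, 'k, 'z) lin_mon_cat_scheme \<Rightarrow> 'm \<Rightarrow> 'm \<Rightarrow> bool" where
  "is_kernel C f k \<longleftrightarrow> f \<in> mor C \<and> k \<in> mor C \<and> tgt C k = src C f \<and>
     f \<cdot>\<^bsub>C\<^esub> k = zero_mor C (src C k) (tgt C f) \<and>
     (\<forall>W. \<forall>h \<in> hom C W (src C f). f \<cdot>\<^bsub>C\<^esub> h = zero_mor C W (tgt C f) \<longrightarrow>
        (\<exists>!u. u \<in> hom C W (src C k) \<and> k \<cdot>\<^bsub>C\<^esub> u = h))"

definition is_cokernel :: "('o, 'm, 'k, 'z) lin_mon_cat_scheme \<Rightarrow> 'm \<Rightarrow> 'm \<Rightarrow> bool" where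
  "is_cokernel C f q \<longleftrightarrow> f \<in> mor C \<and> q \<in> mor C \<and> src C q = tgt C f \<and>
     q \<cdot>\<^bsub>C\<^esub> f = zero_mor C (src C f) (tgt C q) \<and>
     (\<forall>W. \<forall>h \<in> hom C (tgt C f) W. h \<cdot>\<^bsub>C\<^esub> f = zero_mor C (src C f) W \<longrightarrow>
        (\<exists>!u. u \<in> hom C (tgt C q) W \<and> u \<cdot>\<^bsub>C\<^esub> q = h))"

definition is_direct_sum :: "('o, 'm, 'k, 'z) lin_mon_cat_scheme \<Rightarrow> 'o \<Rightarrow> 'o \<Rightarrow> 'o \<Rightarrow> bool" where
  "is_direct_sum C X Y S \<longleftrightarrow> X \<in> obj C \<and> Y \<in> obj C \<and> S \<in> obj C \<and>
     (\<exists>i \<in> hom C X S. \<exists>j \<in> hom C Y S. \<exists>p \<in> hom C S X. \<exists>q \<in> hom C S Y.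
        p \<cdot>\<^bsub>C\<^esub> i = ident C X \<and> q \<cdot>\<^bsub>C\<^esub> j = ident C Y \<and>
        p \<cdot>\<^bsub>C\<^esub> j = zero_mor C Y X \<and> q \<cdot>\<^bsub>C\<^esub> i = zero_mor C X Y \<and>
        (i \<cdot>\<^bsub>C\<^esub> p) \<oplus>\<^bsub>C\<^esub> (j \<cdot>\<^bsub>C\<^esub> q) = ident C S)"

definition short_exact :: "('o, 'm, 'k, 'z) lin_mon_cat_scheme \<Rightarrow> 'm \<Rightarrow> 'm \<Rightarrow> bool" where
  "short_exact C f g \<longleftrightarrow> is_kernel C g f \<and> is_cokernel C f g"

locale abelian_category = linear_category C
  for C :: "('o, 'm, 'k::field, 'z) lin_mon_cat_scheme" (structure) +
  assumes zero_object: "\<exists>Z. is_zero C Z"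
    and direct_sum: "X \<in> obj C \<Longrightarrow> Y \<in> obj C \<Longrightarrow> \<exists>S. is_direct_sum C X Y S"
    and kernel: "f \<in> mor C \<Longrightarrow> \<exists>k. is_kernel C f k"
    and cokernel: "f \<in> mor C \<Longrightarrow> \<exists>q. is_cokernel C f q"
    and mono_kernel: "is_mono C k \<Longrightarrow> \<exists>f. is_kernel C f k"
    and epi_cokernel: "is_epi C q \<Longrightarrow> \<exists>f. is_cokernel C f q"

inductive_set hom_span :: "('o, 'm, 'k, 'z) lin_mon_cat_scheme \<Rightarrow> 'o \<Rightarrow> 'o \<Rightarrow> 'm set \<Rightarrow> 'm set"
  for C X Y S where
  span_zero: "zero_mor C X Y \<in> hom_span C X Y S"
| span_step: "f \<in> S \<Longrightarrow> g \<in> hom_span C X Y S \<Longrightarrow> (a \<star>\<^bsub>C\<^esub> f) \<oplus>\<^bsub>C\<^esub> g \<in> hom_span C X Y S"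

inductive finite_length :: "('o, 'm, 'k, 'z) lin_mon_cat_scheme \<Rightarrow> 'o \<Rightarrow> bool" for C where
  length_zero: "is_zero C X \<Longrightarrow> finite_length C X"
| length_step: "short_exact C f g \<Longrightarrow> simple_object C (src C f) \<Longrightarrow> finite_length C (tgt C g) \<Longrightarrow>
    finite_length C (tgt C f)"

text \<open>Finite in the sense of Etingof and Ostrik (Finite tensor categories, Section 2.1).\<close>

locale finite_abelian_category = abelian_category C
  for C :: "('o, 'm, 'k::field, 'z) lin_mon_cat_scheme" (structure) +
  assumes hom_finite_dim: "X \<in> obj C \<Longrightarrow> Y \<in> obj C \<Longrightarrow>
      \<exists>S. finite S \<and> S \<subseteq> hom C X Y \<and> hom C X Y = hom_span C X Y S"
    and finite_length: "X \<in> obj C \<Longrightarrow> finite_length C X"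
    and enough_projectives: "X \<in> obj C \<Longrightarrow> \<exists>e. is_epi C e \<and> tgt C e = X \<and> projective C (src C e)"
    and finitely_many_simples: "\<exists>S. finite S \<and> (\<forall>X. simple_object C X \<longrightarrow> (\<exists>Y \<in> S. isomorphic C X Y))"

locale finite_tensor_category = finite_abelian_category C + rigid_monoidal_category C
  for C :: "('o, 'm, 'k::field, 'z) lin_mon_cat_scheme" (structure) +
  assumes tensM_add_left: "f \<in> hom C X X' \<Longrightarrow> f' \<in> hom C X X' \<Longrightarrow> g \<in> hom C Y Y' \<Longrightarrow>
      (f \<oplus> f') \<odot> g = f \<odot> g \<oplus> f' \<odot> g"
    and tensM_add_right: "f \<in> hom C X X' \<Longrightarrow> g \<in> hom C Y Y' \<Longrightarrow> g' \<in> hom C Y Y' \<Longrightarrow>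
      f \<odot> (g \<oplus> g') = f \<odot> g \<oplus> f \<odot> g'"
    and tensM_scale_left: "f \<in> hom C X X' \<Longrightarrow> g \<in> hom C Y Y' \<Longrightarrow> (a \<star> f) \<odot> g = a \<star> (f \<odot> g)"
    and tensM_scale_right: "f \<in> hom C X X' \<Longrightarrow> g \<in> hom C Y Y' \<Longrightarrow> f \<odot> (a \<star> g) = a \<star> (f \<odot> g)"
    and unit_simple: "simple_object C \<one>"


section \<open>Functors\<close>

text \<open>
  A monoidal functor \<open>F\<close> carries \<open>fmult F X Y : F X \<otimes> F Y \<rightarrow> F (X \<otimes> Y)\<close> and
  \<open>funit F : \<one> \<rightarrow> F \<one>\<close>.
\<close>

record ('o, 'm, 'p, 'n) mon_functor =
  fobj :: "'o \<Rightarrow> 'p"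
  fmor :: "'m \<Rightarrow> 'n"
  fmult :: "'o \<Rightarrow> 'o \<Rightarrow> 'n"
  funit :: "'n"

definition is_functor :: "('o, 'm, 'y) cat_scheme \<Rightarrow> ('p, 'n, 'z) cat_scheme \<Rightarrow>
    ('o, 'm, 'p, 'n, 'w) mon_functor_scheme \<Rightarrow> bool" where
  "is_functor C D F \<longleftrightarrow>
     (\<forall>X \<in> obj C. fobj F X \<in> obj D) \<and>
     (\<forall>X Y. \<forall>f \<in> hom C X Y. fmor F f \<in> hom D (fobj F X) (fobj F Y)) \<and>
     (\<forall>X \<in> obj C. fmor F (ident C X) = ident D (fobj F X)) \<and>
     (\<forall>X Y Z. \<forall>f \<in> hom C X Y. \<forall>g \<in> hom C Y Z. fmor F (g \<cdot>\<^bsub>C\<^esub> f) = fmor F g \<cdot>\<^bsub>D\<^esub> fmor F f)"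

definition strong_monoidal_functor :: "('o, 'm, 'y) mon_cat_scheme \<Rightarrow> ('p, 'n, 'z) mon_cat_scheme \<Rightarrow>
    ('o, 'm, 'p, 'n, 'w) mon_functor_scheme \<Rightarrow> bool" where
  "strong_monoidal_functor C D F \<longleftrightarrow> is_functor C D F \<and>
     (\<forall>X \<in> obj C. \<forall>Y \<in> obj C.
        fmult F X Y \<in> hom D (fobj F X \<otimes>\<^bsub>D\<^esub> fobj F Y) (fobj F (X \<otimes>\<^bsub>C\<^esub> Y)) \<and> is_iso D (fmult F X Y)) \<and>
     (\<forall>X X' Y Y'. \<forall>f \<in> hom C X X'. \<forall>g \<in> hom C Y Y'.
        fmult F X' Y' \<cdot>\<^bsub>D\<^esub> (fmor F f \<odot>\<^bsub>D\<^esub> fmor F g) = fmor F (f \<odot>\<^bsub>C\<^esub> g) \<cdot>\<^bsub>D\<^esub> fmult F X Y) \<and>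
     funit F \<in> hom D \<one>\<^bsub>D\<^esub> (fobj F \<one>\<^bsub>C\<^esub>) \<and> is_iso D (funit F) \<and>
     (\<forall>X \<in> obj C. \<forall>Y \<in> obj C. \<forall>Z \<in> obj C.
        fmor F (assoc C X Y Z) \<cdot>\<^bsub>D\<^esub> fmult F (X \<otimes>\<^bsub>C\<^esub> Y) Z \<cdot>\<^bsub>D\<^esub>
          (fmult F X Y \<odot>\<^bsub>D\<^esub> ident D (fobj F Z)) =
        fmult F X (Y \<otimes>\<^bsub>C\<^esub> Z) \<cdot>\<^bsub>D\<^esub> (ident D (fobj F X) \<odot>\<^bsub>D\<^esub> fmult F Y Z) \<cdot>\<^bsub>D\<^esub>
          assoc D (fobj F X) (fobj F Y) (fobj F Z)) \<and>
     (\<forall>X \<in> obj C.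
        fmor F (lunit C X) \<cdot>\<^bsub>D\<^esub> fmult F \<one>\<^bsub>C\<^esub> X \<cdot>\<^bsub>D\<^esub> (funit F \<odot>\<^bsub>D\<^esub> ident D (fobj F X)) =
          lunit D (fobj F X) \<and>
        fmor F (runit C X) \<cdot>\<^bsub>D\<^esub> fmult F X \<one>\<^bsub>C\<^esub> \<cdot>\<^bsub>D\<^esub> (ident D (fobj F X) \<odot>\<^bsub>D\<^esub> funit F) =
          runit D (fobj F X))"

definition braided_monoidal_functor :: "('o, 'm, 'y) mon_cat_scheme \<Rightarrow> ('o \<Rightarrow> 'o \<Rightarrow> 'm) \<Rightarrow>
    ('p, 'n, 'z) mon_cat_scheme \<Rightarrow> ('p \<Rightarrow> 'p \<Rightarrow> 'n) \<Rightarrow> ('o, 'm, 'p, 'n, 'w) mon_functor_scheme \<Rightarrow> bool" where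
  "braided_monoidal_functor C \<beta> D \<beta>' F \<longleftrightarrow> strong_monoidal_functor C D F \<and>
     (\<forall>X \<in> obj C. \<forall>Y \<in> obj C.
        fmor F (\<beta> X Y) \<cdot>\<^bsub>D\<^esub> fmult F X Y = fmult F Y X \<cdot>\<^bsub>D\<^esub> \<beta>' (fobj F X) (fobj F Y))"

definition linear_functor :: "('o, 'm, 'k, 'y) lin_mon_cat_scheme \<Rightarrow> ('p, 'n, 'k, 'z) lin_mon_cat_scheme \<Rightarrow>
    ('o, 'm, 'p, 'n, 'w) mon_functor_scheme \<Rightarrow> bool" where
  "linear_functor C D F \<longleftrightarrow> is_functor C D F \<and>
     (\<forall>X Y. \<forall>f \<in> hom C X Y. \<forall>g \<in> hom C X Y. fmor F (f \<oplus>\<^bsub>C\<^esub> g) = fmor F f \<oplus>\<^bsub>D\<^esub> fmor F g) \<and>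
     (\<forall>a. \<forall>f \<in> mor C. fmor F (a \<star>\<^bsub>C\<^esub> f) = a \<star>\<^bsub>D\<^esub> fmor F f)"

definition exact_functor :: "('o, 'm, 'k, 'y) lin_mon_cat_scheme \<Rightarrow> ('p, 'n, 'k, 'z) lin_mon_cat_scheme \<Rightarrow>
    ('o, 'm, 'p, 'n, 'w) mon_functor_scheme \<Rightarrow> bool" where
  "exact_functor C D F \<longleftrightarrow> is_functor C D F \<and>
     (\<forall>f g. short_exact C f g \<longrightarrow> short_exact D (fmor F f) (fmor F g))"

definition tensor_functor :: "('o, 'm, 'k, 'y) lin_mon_cat_scheme \<Rightarrow> ('p, 'n, 'k, 'z) lin_mon_cat_scheme \<Rightarrow>
    ('o, 'm, 'p, 'n, 'w) mon_functor_scheme \<Rightarrow> bool" where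
  "tensor_functor C D F \<longleftrightarrow> exact_functor C D F \<and> linear_functor C D F \<and> strong_monoidal_functor C D F"

definition fully_faithful :: "('o, 'm, 'y) cat_scheme \<Rightarrow> ('p, 'n, 'z) cat_scheme \<Rightarrow>
    ('o, 'm, 'p, 'n, 'w) mon_functor_scheme \<Rightarrow> bool" where
  "fully_faithful C D F \<longleftrightarrow>
     (\<forall>X \<in> obj C. \<forall>Y \<in> obj C. bij_betw (fmor F) (hom C X Y) (hom D (fobj F X) (fobj F Y)))"

definition essential_image :: "('o, 'm, 'y) cat_scheme \<Rightarrow> ('p, 'n, 'z) cat_scheme \<Rightarrow>
    ('o, 'm, 'p, 'n, 'w) mon_functor_scheme \<Rightarrow> 'p set" where
  "essential_image C D F = {Y \<in> obj D. \<exists>X \<in> obj C. isomorphic D (fobj F X) Y}"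

definition mon_functor_comp :: "('r, 's, 'z) cat_scheme \<Rightarrow> ('p, 'n, 'r, 's) mon_functor \<Rightarrow>
    ('o, 'm, 'p, 'n) mon_functor \<Rightarrow> ('o, 'm, 'r, 's) mon_functor" where
  "mon_functor_comp E G F =
     \<lparr>fobj = (\<lambda>X. fobj G (fobj F X)),
      fmor = (\<lambda>f. fmor G (fmor F f)),
      fmult = (\<lambda>X Y. fmor G (fmult F X Y) \<cdot>\<^bsub>E\<^esub> fmult G (fobj F X) (fobj F Y)),
      funit = fmor G (funit F) \<cdot>\<^bsub>E\<^esub> funit G\<rparr>"

text \<open>Values off the carrier of the source category are irrelevant.\<close>

definition mon_functor_eq :: "('o, 'm, 'z) cat_scheme \<Rightarrow> ('o, 'm, 'p, 'n) mon_functor \<Rightarrow>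
    ('o, 'm, 'p, 'n) mon_functor \<Rightarrow> bool" where
  "mon_functor_eq C F G \<longleftrightarrow>
     (\<forall>X \<in> obj C. fobj F X = fobj G X) \<and> (\<forall>f \<in> mor C. fmor F f = fmor G f) \<and>
     (\<forall>X \<in> obj C. \<forall>Y \<in> obj C. fmult F X Y = fmult G X Y) \<and> funit F = funit G"


section \<open>The Drinfeld center\<close>

text \<open>
  A half-braiding on \<open>Z\<close> is a natural isomorphism \<open>\<gamma> X : X \<otimes> Z \<rightarrow> Z \<otimes> X\<close> compatible with tensor
  products in \<open>X\<close>.  It is extensional, so that equal half-braidings are equal as functions.
\<close>

definition half_braiding :: "('o, 'm, 'z) mon_cat_scheme \<Rightarrow> 'o \<Rightarrow> ('o \<Rightarrow> 'm) \<Rightarrow> bool" where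
  "half_braiding C Z \<gamma> \<longleftrightarrow> Z \<in> obj C \<and> \<gamma> \<in> extensional (obj C) \<and>
     (\<forall>X \<in> obj C. \<gamma> X \<in> hom C (X \<otimes>\<^bsub>C\<^esub> Z) (Z \<otimes>\<^bsub>C\<^esub> X) \<and> is_iso C (\<gamma> X)) \<and>
     (\<forall>X Y. \<forall>f \<in> hom C X Y. \<gamma> Y \<cdot>\<^bsub>C\<^esub> (f \<odot>\<^bsub>C\<^esub> ident C Z) = (ident C Z \<odot>\<^bsub>C\<^esub> f) \<cdot>\<^bsub>C\<^esub> \<gamma> X) \<and>
     (\<forall>X \<in> obj C. \<forall>Y \<in> obj C. \<gamma> (X \<otimes>\<^bsub>C\<^esub> Y) =
        assoc C Z X Y \<cdot>\<^bsub>C\<^esub> (\<gamma> X \<odot>\<^bsub>C\<^esub> ident C Y) \<cdot>\<^bsub>C\<^esub> inverse_mor C (assoc C X Z Y) \<cdot>\<^bsub>C\<^esub>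
          (ident C X \<odot>\<^bsub>C\<^esub> \<gamma> Y) \<cdot>\<^bsub>C\<^esub> assoc C X Y Z)"

definition half_braiding_tensor :: "('o, 'm, 'z) mon_cat_scheme \<Rightarrow>
    'o \<times> ('o \<Rightarrow> 'm) \<Rightarrow> 'o \<times> ('o \<Rightarrow> 'm) \<Rightarrow> 'o \<Rightarrow> 'm" where
  "half_braiding_tensor C P Q = (case P of (Z, \<gamma>) \<Rightarrow> case Q of (Z', \<gamma>') \<Rightarrow>
     (\<lambda>X \<in> obj C. inverse_mor C (assoc C Z Z' X) \<cdot>\<^bsub>C\<^esub> (ident C Z \<odot>\<^bsub>C\<^esub> \<gamma>' X) \<cdot>\<^bsub>C\<^esub> assoc C Z X Z' \<cdot>\<^bsub>C\<^esub>
        (\<gamma> X \<odot>\<^bsub>C\<^esub> ident C Z') \<cdot>\<^bsub>C\<^esub> inverse_mor C (assoc C X Z Z')))"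

definition half_braiding_unit :: "('o, 'm, 'z) mon_cat_scheme \<Rightarrow> 'o \<Rightarrow> 'm" where
  "half_braiding_unit C = (\<lambda>X \<in> obj C. inverse_mor C (lunit C X) \<cdot>\<^bsub>C\<^esub> runit C X)"

text \<open>
  Morphisms of the center are triples (source, target, underlying morphism), since a morphism of
  \<open>C\<close> does not determine the half-braidings on its source and target.
\<close>

type_synonym ('o, 'm) center_obj = "'o \<times> ('o \<Rightarrow> 'm)"
type_synonym ('o, 'm) center_mor = "('o, 'm) center_obj \<times> ('o, 'm) center_obj \<times> 'm"

definition center_tensO :: "('o, 'm, 'z) mon_cat_scheme \<Rightarrow>
    ('o, 'm) center_obj \<Rightarrow> ('o, 'm) center_obj \<Rightarrow> ('o, 'm) center_obj" where
  "center_tensO C P Q = (fst P \<otimes>\<^bsub>C\<^esub> fst Q, half_braiding_tensor C P Q)"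

definition center_unit :: "('o, 'm, 'z) mon_cat_scheme \<Rightarrow> ('o, 'm) center_obj" where
  "center_unit C = (\<one>\<^bsub>C\<^esub>, half_braiding_unit C)"

definition drinfeld_center :: "('o, 'm, 'z) mon_cat_scheme \<Rightarrow>
    (('o, 'm) center_obj, ('o, 'm) center_mor) mon_cat" where
  "drinfeld_center C =
     \<lparr>obj = {(Z, \<gamma>). half_braiding C Z \<gamma>},
      mor = {((Z, \<gamma>), (Z', \<gamma>'), f). half_braiding C Z \<gamma> \<and> half_braiding C Z' \<gamma>' \<and> f \<in> hom C Z Z' \<and>
               (\<forall>X \<in> obj C. \<gamma>' X \<cdot>\<^bsub>C\<^esub> (ident C X \<odot>\<^bsub>C\<^esub> f) = (f \<odot>\<^bsub>C\<^esub> ident C X) \<cdot>\<^bsub>C\<^esub> \<gamma> X)},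
      src = (\<lambda>(P, Q, f). P),
      tgt = (\<lambda>(P, Q, f). Q),
      ident = (\<lambda>P. (P, P, ident C (fst P))),
      cmp = (\<lambda>(P', Q', g) (P, Q, f). (P, Q', g \<cdot>\<^bsub>C\<^esub> f)),
      tensO = center_tensO C,
      tensM = (\<lambda>(P, Q, f) (P', Q', f'). (center_tensO C P P', center_tensO C Q Q', f \<odot>\<^bsub>C\<^esub> f')),
      unit_obj = center_unit C,
      assoc = (\<lambda>P Q R. (center_tensO C (center_tensO C P Q) R, center_tensO C P (center_tensO C Q R),
                 assoc C (fst P) (fst Q) (fst R))),
      lunit = (\<lambda>P. (center_tensO C (center_unit C) P, P, lunit C (fst P))),
      runit = (\<lambda>P. (center_tensO C P (center_unit C), P, runit C (fst P)))\<rparr>"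

definition center_braiding :: "('o, 'm, 'z) mon_cat_scheme \<Rightarrow>
    ('o, 'm) center_obj \<Rightarrow> ('o, 'm) center_obj \<Rightarrow> ('o, 'm) center_mor" where
  "center_braiding C P Q = (center_tensO C P Q, center_tensO C Q P, snd Q (fst P))"

definition center_forget :: "('o, 'm, 'z) mon_cat_scheme \<Rightarrow>
    (('o, 'm) center_obj, ('o, 'm) center_mor, 'o, 'm) mon_functor" where
  "center_forget C =
     \<lparr>fobj = fst,
      fmor = (\<lambda>(P, Q, f). f),
      fmult = (\<lambda>P Q. ident C (fst P \<otimes>\<^bsub>C\<^esub> fst Q)),
      funit = ident C \<one>\<^bsub>C\<^esub>\<rparr>"


section \<open>Central tensor subcategories and the lattice of tensor subcategories\<close>

definition central_functor :: "('p, 'n, 'y) mon_cat_scheme \<Rightarrow> ('p \<Rightarrow> 'p \<Rightarrow> 'n) \<Rightarrow>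
    ('o, 'm, 'z) mon_cat_scheme \<Rightarrow> ('p, 'n, 'o, 'm) mon_functor \<Rightarrow> bool" where
  "central_functor B \<beta> C F \<longleftrightarrow>
     (\<exists>F' :: ('p, 'n, ('o, 'm) center_obj, ('o, 'm) center_mor) mon_functor.
        braided_monoidal_functor B \<beta> (drinfeld_center C) (center_braiding C) F' \<and>
        mon_functor_eq B (mon_functor_comp C (center_forget C) F') F)"

text \<open>
  \<open>B\<close> is identified with \<open>essential_image B C F\<close>.  That this is a tensor subcategory is a
  consequence of the hypotheses, not part of the definition.
\<close>

definition central_tensor_subcategory :: "('o, 'm, 'k::field, 'z) lin_mon_cat_scheme \<Rightarrow>
    ('p, 'n, 'k, 'y) lin_mon_cat_scheme \<Rightarrow> ('p \<Rightarrow> 'p \<Rightarrow> 'n) \<Rightarrow> ('p, 'n, 'o, 'm) mon_functor \<Rightarrow> bool" where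
  "central_tensor_subcategory C B \<beta> F \<longleftrightarrow>
     finite_tensor_category B \<and> braided_category B \<beta> \<and>
     tensor_functor B C F \<and> fully_faithful B C F \<and> central_functor B \<beta> C F"

text \<open>
  A full subcategory is given by its set of objects.  Closure under subobjects makes a tensor
  subcategory closed under isomorphism, so two of them are equal iff their sets of objects are.
\<close>

locale tensor_subcategory =
  fixes C :: "('o, 'm, 'k::field, 'z) lin_mon_cat_scheme" (structure) and D :: "'o set"
  assumes subset: "D \<subseteq> obj C"
    and unit: "\<one> \<in> D"
    and subobject: "is_mono C f \<Longrightarrow> tgt C f \<in> D \<Longrightarrow> src C f \<in> D"
    and quotient: "is_epi C f \<Longrightarrow> src C f \<in> D \<Longrightarrow> tgt C f \<in> D"
    and zero: "is_zero C X \<Longrightarrow> X \<in> D"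
    and direct_sum: "X \<in> D \<Longrightarrow> Y \<in> D \<Longrightarrow> is_direct_sum C X Y S \<Longrightarrow> S \<in> D"
    and tensor: "X \<in> D \<Longrightarrow> Y \<in> D \<Longrightarrow> X \<otimes> Y \<in> D"
    and left_dual: "X \<in> D \<Longrightarrow> dual_pair C Y X \<Longrightarrow> Y \<in> D"
    and right_dual: "X \<in> D \<Longrightarrow> dual_pair C X Y \<Longrightarrow> Y \<in> D"

definition tsub_meet :: "'o set \<Rightarrow> 'o set \<Rightarrow> 'o set" (infixl "\<^bold>\<and>" 70) where
  "D\<^sub>1 \<^bold>\<and> D\<^sub>2 = D\<^sub>1 \<inter> D\<^sub>2"

definition tsub_join :: "('o, 'm, 'k::field, 'z) lin_mon_cat_scheme \<Rightarrow> 'o set \<Rightarrow> 'o set \<Rightarrow> 'o set"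
    (infixl "\<^bold>\<or>\<index>" 65) where
  "D\<^sub>1 \<^bold>\<or>\<^bsub>C\<^esub> D\<^sub>2 = \<Inter>{E. tensor_subcategory C E \<and> D\<^sub>1 \<subseteq> E \<and> D\<^sub>2 \<subseteq> E}"

lemma tensor_subcategory_Inter:
  assumes "\<E> \<noteq> {}" "\<And>E. E \<in> \<E> \<Longrightarrow> tensor_subcategory C E"
  shows "tensor_subcategory C (\<Inter>\<E>)"
proof -
  obtain E\<^sub>0 where E0: "E\<^sub>0 \<in> \<E>" using assms(1) by blast
  note sub = assms(2)
  show ?thesis
  proof
    show "\<Inter>\<E> \<subseteq> obj C"
      using tensor_subcategory.subset[OF sub[OF E0]] E0 by blast
    show "\<one>\<^bsub>C\<^esub> \<in> \<Inter>\<E>"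
      using tensor_subcategory.unit[OF sub] by blast
    show "src C f \<in> \<Inter>\<E>" if "is_mono C f" "tgt C f \<in> \<Inter>\<E>" for f
      using tensor_subcategory.subobject[OF sub] that by blast
    show "tgt C f \<in> \<Inter>\<E>" if "is_epi C f" "src C f \<in> \<Inter>\<E>" for f
      using tensor_subcategory.quotient[OF sub] that by blast
    show "X \<in> \<Inter>\<E>" if "is_zero C X" for X
      using tensor_subcategory.zero[OF sub] that by blast
    show "S \<in> \<Inter>\<E>" if "X \<in> \<Inter>\<E>" "Y \<in> \<Inter>\<E>" "is_direct_sum C X Y S" for X Y S
      using tensor_subcategory.direct_sum[OF sub] that by blast
    show "X \<otimes>\<^bsub>C\<^esub> Y \<in> \<Inter>\<E>" if "X \<in> \<Inter>\<E>" "Y \<in> \<Inter>\<E>" for X Y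
      using tensor_subcategory.tensor[OF sub] that by blast
    show "Y \<in> \<Inter>\<E>" if "X \<in> \<Inter>\<E>" "dual_pair C Y X" for X Y
      using tensor_subcategory.left_dual[OF sub] that by blast
    show "Y \<in> \<Inter>\<E>" if "X \<in> \<Inter>\<E>" "dual_pair C X Y" for X Y
      using tensor_subcategory.right_dual[OF sub] that by blast
  qed
qed

lemma (in finite_tensor_category) tensor_subcategory_obj: "tensor_subcategory C (obj C)"
  by unfold_locales
    (auto simp: unit_obj tensO_obj src_obj tgt_obj is_mono_def is_epi_def is_zero_def
      is_direct_sum_def dual_pair_def)

lemma (in finite_tensor_category) tsub_join_least:
  assumes "D\<^sub>1 \<subseteq> obj C" "D\<^sub>2 \<subseteq> obj C"
  shows "tensor_subcategory C (D\<^sub>1 \<^bold>\<or> D\<^sub>2)" "D\<^sub>1 \<subseteq> D\<^sub>1 \<^bold>\<or> D\<^sub>2" "D\<^sub>2 \<subseteq> D\<^sub>1 \<^bold>\<or> D\<^sub>2"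
    "tensor_subcategory C E \<Longrightarrow> D\<^sub>1 \<subseteq> E \<Longrightarrow> D\<^sub>2 \<subseteq> E \<Longrightarrow> D\<^sub>1 \<^bold>\<or> D\<^sub>2 \<subseteq> E"
proof -
  show "tensor_subcategory C (D\<^sub>1 \<^bold>\<or> D\<^sub>2)"
    unfolding tsub_join_def using assms tensor_subcategory_obj
    by (intro tensor_subcategory_Inter) auto
qed (auto simp: tsub_join_def)

end

theory Submission
  imports Defs
begin

text \<open>
  Write \<open>E\<close> for the essential image of \<open>\<B>\<close>.  Half-braidings give \<open>d \<otimes> b \<cong> b \<otimes> d\<close>, so every object of
  \<open>D\<^sub>1 \<or> E\<close> is a subquotient of some \<open>d \<otimes> b\<close> with \<open>d \<in> D\<^sub>1\<close>, \<open>b \<in> E\<close>.  In a tensor subcategory there are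
  enough relative projectives, and these are relatively injective: if \<open>P\<close> is projective, then
  \<open>U \<otimes> P \<rightarrow> V \<otimes> P\<close> splits for every subobject \<open>U\<close> of \<open>V\<close>, so \<open>P\<^sup>*\<close> is injective, and \<open>P\<close> is a retract
  of \<open>P \<otimes> P\<^sup>* \<otimes> P\<close>.  Hence a projective that is a subquotient of \<open>d \<otimes> b\<close> is a direct summand of it,
  and every object \<open>X\<close> of \<open>D\<^sub>1 \<or> E\<close> is even a quotient of some \<open>d \<otimes> b\<close>.  If moreover \<open>X \<in> D\<^sub>2\<close>, let
  \<open>b'\<close> be the image of the transpose \<open>b \<rightarrow> d\<^sup>* \<otimes> X\<close>.  It lies in \<open>E \<and> D\<^sub>2\<close>, and \<open>X\<close> is a quotient of
  \<open>d \<otimes> b'\<close>.  The same argument shows that \<open>E\<close> is closed under subquotients.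
\<close>

section \<open>Categories and adjunctions\<close>

text \<open>The obstacle is the gap between subquotients and quotients. A subquotient of
  \<open>d \<otimes> b\<close> is a quotient of some subobject \<open>W\<close>, and a morphism from
  \<open>W\<close> has no transpose along \<open>d \<otimes> -\<close>; only a morphism on all of
  \<open>d \<otimes> b\<close> can be cut down to an image on the side of \<open>b\<close>. Likewise
  fullness speaks of morphisms between objects \<open>F b\<close>, not of their subobjects. A
  projective of the whole category may lie outside the subcategory. It is replaced by its largest
  quotient inside, which exists by induction on length: a simple subobject is either killed by every
  morphism into the subcategory or embedded by one of them. Duals are known only to exist, without a
  choice or a functor. They are compared as adjoints: a natural mono between right adjoints has an
  epi mate between the left ones, and a natural epi between left adjoints has a mono mate between
  the right ones.\<close>

context category
begin

lemma homD: "f \<in> hom C X Y \<Longrightarrow> f \<in> mor C" "f \<in> hom C X Y \<Longrightarrow> src C f = X" "f \<in> hom C X Y \<Longrightarrow> tgt C f = Y"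
  by (auto simp: hom_def)

lemma homI: "f \<in> mor C \<Longrightarrow> src C f = X \<Longrightarrow> tgt C f = Y \<Longrightarrow> f \<in> hom C X Y"
  by (auto simp: hom_def)

lemma hom_obj: "f \<in> hom C X Y \<Longrightarrow> X \<in> obj C" "f \<in> hom C X Y \<Longrightarrow> Y \<in> obj C"
  using src_obj tgt_obj by (auto simp: hom_def)

text \<open>Typing is restated through \<open>mor\<close>, \<open>src\<close> and
  \<open>tgt\<close>: in this form the simplifier can compute the type of a composite and discharge
  the side conditions of associativity, which then nests every composite to the right.\<close>

lemma cmp_mor [simp]:
  assumes "f \<in> mor C" "g \<in> mor C" "tgt C f = src C g"
  shows "g \<cdot> f \<in> mor C" "src C (g \<cdot> f) = src C f" "tgt C (g \<cdot> f) = tgt C g"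
  using cmp_hom[of f "src C f" "tgt C f" g "tgt C g"] assms by (auto simp: hom_def)

lemma ident_mor [simp]:
  assumes "X \<in> obj C"
  shows "ident C X \<in> mor C" "src C (ident C X) = X" "tgt C (ident C X) = X"
  using ident_hom[OF assms] by (auto simp: hom_def)

lemma cmp_assoc_mor [simp]:
  "f \<in> mor C \<Longrightarrow> g \<in> mor C \<Longrightarrow> h \<in> mor C \<Longrightarrow> tgt C f = src C g \<Longrightarrow> tgt C g = src C h \<Longrightarrow>
    (h \<cdot> g) \<cdot> f = h \<cdot> (g \<cdot> f)"
  using cmp_assoc[of f "src C f" "tgt C f" g "tgt C g" h "tgt C h"] by (auto simp: hom_def)

lemma cmp_ident_mor [simp]:
  "f \<in> mor C \<Longrightarrow> src C f = X \<Longrightarrow> f \<cdot> ident C X = f"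
  "f \<in> mor C \<Longrightarrow> tgt C f = Y \<Longrightarrow> ident C Y \<cdot> f = f"
  using cmp_ident_left cmp_ident_right by (auto simp: hom_def)

lemma src_tgt_obj [simp]: "f \<in> mor C \<Longrightarrow> src C f \<in> obj C" "f \<in> mor C \<Longrightarrow> tgt C f \<in> obj C"
  by (auto simp: src_obj tgt_obj)

lemma inverse_of_unique:
  assumes "inverse_of C f g" "inverse_of C f h"
  shows "g = h"
proof -
  have fgh: "f \<in> mor C" "g \<in> hom C (tgt C f) (src C f)" "h \<in> hom C (tgt C f) (src C f)"
    "g \<cdot> f = ident C (src C f)" "f \<cdot> h = ident C (tgt C f)"
    using assms by (auto simp: inverse_of_def)
  have "g = g \<cdot> (f \<cdot> h)" using fgh by (simp add: hom_def)
  also have "\<dots> = (g \<cdot> f) \<cdot> h" using fgh(1-3) by (simp add: hom_def)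
  also have "\<dots> = h" unfolding fgh(4) using fgh(1,3) by (simp add: hom_def)
  finally show ?thesis .
qed

lemma inverse_mor_eq: "inverse_of C f g \<Longrightarrow> inverse_mor C f = g"
  unfolding inverse_mor_def using inverse_of_unique by blast

lemma inverse_of_inverse_mor: "is_iso C f \<Longrightarrow> inverse_of C f (inverse_mor C f)"
  using inverse_mor_eq unfolding is_iso_def by auto

lemma inverse_of_sym: "inverse_of C f g \<Longrightarrow> inverse_of C g f"
  by (auto simp: inverse_of_def hom_def)

lemma is_iso_mor: "is_iso C f \<Longrightarrow> f \<in> mor C"
  by (auto simp: is_iso_def inverse_of_def)

lemma inverse_mor [simp]:
  assumes "is_iso C f"
  shows "inverse_mor C f \<in> mor C" "src C (inverse_mor C f) = tgt C f"
    "tgt C (inverse_mor C f) = src C f" "inverse_mor C f \<cdot> f = ident C (src C f)"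
    "f \<cdot> inverse_mor C f = ident C (tgt C f)" "is_iso C (inverse_mor C f)"
  using inverse_of_inverse_mor[OF assms] inverse_of_sym[OF inverse_of_inverse_mor[OF assms]]
  unfolding is_iso_def by (auto simp: inverse_of_def hom_def)

text \<open>In right-nested form a cancelling pair is usually followed by a further factor
  \<open>x\<close>, so the inverse laws are stated in front of \<open>x\<close> as well.\<close>

lemma inverse_mor_cancel [simp]:
  assumes "is_iso C f" "x \<in> mor C"
  shows "tgt C x = src C f \<Longrightarrow> inverse_mor C f \<cdot> (f \<cdot> x) = x"
    "tgt C x = tgt C f \<Longrightarrow> f \<cdot> (inverse_mor C f \<cdot> x) = x"
  using assms is_iso_mor[OF assms(1)] by (auto simp flip: cmp_assoc_mor)

lemma is_isoI:
  "f \<in> hom C X Y \<Longrightarrow> g \<in> hom C Y X \<Longrightarrow> g \<cdot> f = ident C X \<Longrightarrow> f \<cdot> g = ident C Y \<Longrightarrow> is_iso C f"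
  unfolding is_iso_def inverse_of_def by (auto simp: hom_def)

lemma is_iso_ident [simp]: "X \<in> obj C \<Longrightarrow> is_iso C (ident C X)"
  by (rule is_isoI[of _ X X "ident C X"]) (auto simp: hom_def)

lemma is_iso_cmp [simp]:
  assumes "is_iso C f" "is_iso C g" "tgt C f = src C g"
  shows "is_iso C (g \<cdot> f)"
  using assms is_iso_mor[OF assms(1)] is_iso_mor[OF assms(2)]
  by (intro is_isoI[of _ "src C f" "tgt C g" "inverse_mor C f \<cdot> inverse_mor C g"]) (auto simp: hom_def)

lemma is_monoD: "is_mono C m \<Longrightarrow> g \<in> hom C W (src C m) \<Longrightarrow> h \<in> hom C W (src C m) \<Longrightarrow> m \<cdot> g = m \<cdot> h \<Longrightarrow> g = h"
  unfolding is_mono_def by blast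

lemma is_epiD: "is_epi C e \<Longrightarrow> g \<in> hom C (tgt C e) W \<Longrightarrow> h \<in> hom C (tgt C e) W \<Longrightarrow> g \<cdot> e = h \<cdot> e \<Longrightarrow> g = h"
  unfolding is_epi_def by blast

lemma is_mono_mor: "is_mono C m \<Longrightarrow> m \<in> mor C"
  by (simp add: is_mono_def)

lemma is_epi_mor: "is_epi C e \<Longrightarrow> e \<in> mor C"
  by (simp add: is_epi_def)

lemma split_mono: "m \<in> hom C X Y \<Longrightarrow> r \<in> hom C Y X \<Longrightarrow> r \<cdot> m = ident C X \<Longrightarrow> is_mono C m"
  unfolding is_mono_def
proof (intro conjI allI ballI impI)
  fix W g h
  assume a: "m \<in> hom C X Y" "r \<in> hom C Y X" "r \<cdot> m = ident C X"
    "g \<in> hom C W (src C m)" "h \<in> hom C W (src C m)" "m \<cdot> g = m \<cdot> h"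
  have "(r \<cdot> m) \<cdot> g = (r \<cdot> m) \<cdot> h"
    using a(1,2,4-) by (auto simp: hom_def)
  with a show "g = h" by (auto simp: hom_def)
qed (auto simp: hom_def)

lemma split_epi: "e \<in> hom C X Y \<Longrightarrow> s \<in> hom C Y X \<Longrightarrow> e \<cdot> s = ident C Y \<Longrightarrow> is_epi C e"
  unfolding is_epi_def
proof (intro conjI allI ballI impI)
  fix W g h
  assume a: "e \<in> hom C X Y" "s \<in> hom C Y X" "e \<cdot> s = ident C Y"
    "g \<in> hom C (tgt C e) W" "h \<in> hom C (tgt C e) W" "g \<cdot> e = h \<cdot> e"
  have "g \<cdot> (e \<cdot> s) = (g \<cdot> e) \<cdot> s" using a(1,2,4) by (auto simp: hom_def)
  also have "\<dots> = h \<cdot> (e \<cdot> s)" unfolding a(6) using a(1,2,5) by (auto simp: hom_def)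
  finally show "g = h" unfolding a(3) using a(1,4,5) by (auto simp: hom_def)
qed (auto simp: hom_def)

lemma iso_mono: "is_iso C f \<Longrightarrow> is_mono C f"
  by (rule split_mono[of f "src C f" "tgt C f" "inverse_mor C f"]) (auto simp: hom_def is_iso_mor)

lemma iso_epi: "is_iso C f \<Longrightarrow> is_epi C f"
  by (rule split_epi[of f "src C f" "tgt C f" "inverse_mor C f"]) (auto simp: hom_def is_iso_mor)

lemma mono_cmp:
  assumes "is_mono C f" "is_mono C g" "tgt C f = src C g"
  shows "is_mono C (g \<cdot> f)"
  unfolding is_mono_def
proof (intro conjI allI ballI impI)
  note fg = is_mono_mor[OF assms(1)] is_mono_mor[OF assms(2)] assms(3)
  show "g \<cdot> f \<in> mor C" using fg by simp
  fix W u v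
  assume "u \<in> hom C W (src C (g \<cdot> f))" "v \<in> hom C W (src C (g \<cdot> f))"
  then have uv: "u \<in> hom C W (src C f)" "v \<in> hom C W (src C f)" using fg by simp_all
  note uv' = uv[THEN homD(1)] uv[THEN homD(3)]
  assume "g \<cdot> f \<cdot> u = g \<cdot> f \<cdot> v"
  then have "g \<cdot> (f \<cdot> u) = g \<cdot> (f \<cdot> v)" using fg uv' by simp
  moreover have "f \<cdot> u \<in> hom C W (src C g)" "f \<cdot> v \<in> hom C W (src C g)"
    using fg cmp_hom[OF uv(1), of f] cmp_hom[OF uv(2), of f] by (simp_all add: hom_def)
  ultimately have "f \<cdot> u = f \<cdot> v" using is_monoD[OF assms(2)] by blast
  then show "u = v" using is_monoD[OF assms(1)] uv by blast
qed

lemma epi_cmp: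
  assumes "is_epi C f" "is_epi C g" "tgt C f = src C g"
  shows "is_epi C (g \<cdot> f)"
  unfolding is_epi_def
proof (intro conjI allI ballI impI)
  note fg = is_epi_mor[OF assms(1)] is_epi_mor[OF assms(2)] assms(3)
  show "g \<cdot> f \<in> mor C" using fg by simp
  fix W u v
  assume "u \<in> hom C (tgt C (g \<cdot> f)) W" "v \<in> hom C (tgt C (g \<cdot> f)) W"
  then have uv: "u \<in> hom C (tgt C g) W" "v \<in> hom C (tgt C g) W" using fg by simp_all
  note uv' = uv[THEN homD(1)] uv[THEN homD(2)]
  assume "u \<cdot> (g \<cdot> f) = v \<cdot> (g \<cdot> f)"
  then have "(u \<cdot> g) \<cdot> f = (v \<cdot> g) \<cdot> f" using fg uv' by simp
  moreover have "u \<cdot> g \<in> hom C (tgt C f) W" "v \<cdot> g \<in> hom C (tgt C f) W"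
    using fg cmp_hom[of g "tgt C f" "tgt C g"] uv by (simp_all add: hom_def)
  ultimately have "u \<cdot> g = v \<cdot> g" using is_epiD[OF assms(1)] by blast
  then show "u = v" using is_epiD[OF assms(2)] uv by blast
qed

lemma mono_cancel:
  assumes "is_mono C (g \<cdot> f)" "f \<in> hom C X Y" "g \<in> hom C Y Z"
  shows "is_mono C f"
  unfolding is_mono_def
proof (intro conjI allI ballI impI)
  fix W u v
  assume a: "u \<in> hom C W (src C f)" "v \<in> hom C W (src C f)" "f \<cdot> u = f \<cdot> v"
  have "g \<cdot> f \<cdot> u = g \<cdot> f \<cdot> v"
    using a assms by (auto simp: hom_def)
  then show "u = v"
    using a assms(2,3) by - (rule is_monoD[OF assms(1), of u W v], auto simp: hom_def)
qed (use assms in \<open>auto simp: hom_def\<close>)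

lemma epi_cancel:
  assumes "is_epi C (g \<cdot> f)" "f \<in> hom C X Y" "g \<in> hom C Y Z"
  shows "is_epi C g"
  unfolding is_epi_def
proof (intro conjI allI ballI impI)
  fix W u v
  assume a: "u \<in> hom C (tgt C g) W" "v \<in> hom C (tgt C g) W" "u \<cdot> g = v \<cdot> g"
  have "(u \<cdot> g) \<cdot> f = (v \<cdot> g) \<cdot> f"
    using a by simp
  then have "u \<cdot> (g \<cdot> f) = v \<cdot> (g \<cdot> f)"
    using a(1,2) assms(2,3) by (auto simp: hom_def)
  then show "u = v"
    using a assms(2,3) by - (rule is_epiD[OF assms(1), of u W v], auto simp: hom_def)
qed (use assms in \<open>auto simp: hom_def\<close>)

lemma isomorphicI: "is_iso C f \<Longrightarrow> f \<in> hom C X Y \<Longrightarrow> isomorphic C X Y"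
  by (auto simp: isomorphic_def)

lemma isomorphic_refl: "X \<in> obj C \<Longrightarrow> isomorphic C X X"
  by (rule isomorphicI[of "ident C X"]) (auto simp: ident_hom)

lemma isomorphic_sym:
  assumes "isomorphic C X Y"
  shows "isomorphic C Y X"
proof -
  obtain f where f: "f \<in> hom C X Y" "is_iso C f" using assms by (auto simp: isomorphic_def)
  then show ?thesis by (intro isomorphicI[of "inverse_mor C f"]) (auto simp: hom_def)
qed

lemma isomorphic_trans [trans]:
  assumes "isomorphic C X Y" "isomorphic C Y Z"
  shows "isomorphic C X Z"
proof -
  obtain f g where f: "f \<in> hom C X Y" "is_iso C f" and g: "g \<in> hom C Y Z" "is_iso C g"
    using assms by (auto simp: isomorphic_def)
  then show ?thesis by (intro isomorphicI[of "g \<cdot> f"]) (auto simp: hom_def)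
qed

end

section \<open>Adjoint endofunctors, transposition and mates\<close>

locale adjunction = category C
  for C :: "('o, 'm, 'z) cat_scheme" (structure) +
  fixes L R :: "'o \<Rightarrow> 'o" and Lm Rm :: "'m \<Rightarrow> 'm" and \<Phi> :: "'o \<Rightarrow> 'o \<Rightarrow> 'm \<Rightarrow> 'm"
  assumes L_obj: "U \<in> obj C \<Longrightarrow> L U \<in> obj C"
    and R_obj: "Z \<in> obj C \<Longrightarrow> R Z \<in> obj C"
    and L_hom: "f \<in> hom C U V \<Longrightarrow> Lm f \<in> hom C (L U) (L V)"
    and R_hom: "f \<in> hom C U V \<Longrightarrow> Rm f \<in> hom C (R U) (R V)"
    and transpose_bij: "U \<in> obj C \<Longrightarrow> Z \<in> obj C \<Longrightarrow> bij_betw (\<Phi> U Z) (hom C (L U) Z) (hom C U (R Z))"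
    and transpose_right: "U \<in> obj C \<Longrightarrow> g \<in> hom C (L U) Z \<Longrightarrow> k \<in> hom C Z Z' \<Longrightarrow>
      \<Phi> U Z' (k \<cdot> g) = Rm k \<cdot> \<Phi> U Z g"
    and transpose_left: "h \<in> hom C U' U \<Longrightarrow> g \<in> hom C (L U) Z \<Longrightarrow> \<Phi> U' Z (g \<cdot> Lm h) = \<Phi> U Z g \<cdot> h"
begin

lemma transpose_hom: "U \<in> obj C \<Longrightarrow> g \<in> hom C (L U) Z \<Longrightarrow> \<Phi> U Z g \<in> hom C U (R Z)"
  using transpose_bij[of U Z] hom_obj by (auto simp: bij_betw_def)

lemma transpose_inj: "U \<in> obj C \<Longrightarrow> g \<in> hom C (L U) Z \<Longrightarrow> h \<in> hom C (L U) Z \<Longrightarrow> \<Phi> U Z g = \<Phi> U Z h \<Longrightarrow> g = h"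
  using transpose_bij[of U Z] hom_obj by (auto simp: bij_betw_def inj_on_def)

lemma transpose_surj:
  assumes "Z \<in> obj C" "h \<in> hom C U (R Z)"
  obtains g where "g \<in> hom C (L U) Z" "\<Phi> U Z g = h"
proof -
  have "h \<in> \<Phi> U Z ` hom C (L U) Z"
    using transpose_bij[OF hom_obj(1)[OF assms(2)] assms(1)] assms(2) by (simp add: bij_betw_def)
  then show thesis using that by auto
qed

text \<open>Transposition turns composition with \<open>Rm m\<close> into composition with
  \<open>m\<close>. Tensoring with an object that has both duals is a right as well as a left
  adjoint, so this lemma and \<open>left_epi\<close> together make it preserve monos and
  epis.\<close>

lemma right_mono:
  assumes "is_mono C m"
  shows "is_mono C (Rm m)"
proof -
  note m = is_mono_mor[OF assms]
  have mh: "m \<in> hom C (src C m) (tgt C m)" using m by (simp add: hom_def)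
  note Rm = R_hom[OF mh]
  show ?thesis unfolding is_mono_def
  proof (intro conjI allI ballI impI)
    show "Rm m \<in> mor C" using Rm by (simp add: hom_def)
    fix W u v
    assume a: "u \<in> hom C W (src C (Rm m))" "v \<in> hom C W (src C (Rm m))" "Rm m \<cdot> u = Rm m \<cdot> v"
    have W: "W \<in> obj C" using a hom_obj by blast
    have s: "src C (Rm m) = R (src C m)" using Rm by (simp add: hom_def)
    obtain u' where u': "u' \<in> hom C (L W) (src C m)" "\<Phi> W (src C m) u' = u"
      using transpose_surj a(1) s m by (metis src_tgt_obj(1))
    obtain v' where v': "v' \<in> hom C (L W) (src C m)" "\<Phi> W (src C m) v' = v"
      using transpose_surj a(2) s m by (metis src_tgt_obj(1))
    have "\<Phi> W (tgt C m) (m \<cdot> u') = \<Phi> W (tgt C m) (m \<cdot> v')"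
      using transpose_right[OF W u'(1) mh] transpose_right[OF W v'(1) mh] u'(2) v'(2) a(3) by simp
    then have "m \<cdot> u' = m \<cdot> v'"
      using transpose_inj[OF W] cmp_hom[OF u'(1) mh] cmp_hom[OF v'(1) mh] by blast
    then have "u' = v'" using is_monoD[OF assms] u'(1) v'(1) by blast
    then show "u = v" using u' v' by simp
  qed
qed

lemma left_epi:
  assumes "is_epi C e"
  shows "is_epi C (Lm e)"
proof -
  note e = is_epi_mor[OF assms]
  have eh: "e \<in> hom C (src C e) (tgt C e)" using e by (simp add: hom_def)
  note Le = L_hom[OF eh]
  show ?thesis unfolding is_epi_def
  proof (intro conjI allI ballI impI)
    show "Lm e \<in> mor C" using Le by (simp add: hom_def)
    fix W u v
    assume a: "u \<in> hom C (tgt C (Lm e)) W" "v \<in> hom C (tgt C (Lm e)) W" "u \<cdot> Lm e = v \<cdot> Lm e"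
    have W: "W \<in> obj C" using a hom_obj by blast
    have s: "tgt C (Lm e) = L (tgt C e)" using Le by (simp add: hom_def)
    have u: "u \<in> hom C (L (tgt C e)) W" and v: "v \<in> hom C (L (tgt C e)) W" using a s by auto
    have t: "tgt C e \<in> obj C" using e by simp
    have "\<Phi> (tgt C e) W u \<cdot> e = \<Phi> (tgt C e) W v \<cdot> e"
      using transpose_left[OF eh u] transpose_left[OF eh v] a(3) by simp
    then have "\<Phi> (tgt C e) W u = \<Phi> (tgt C e) W v"
      using is_epiD[OF assms] transpose_hom[OF t u] transpose_hom[OF t v] by blast
    then show "u = v" using transpose_inj t u v by blast
  qed
qed

text \<open>Transposition turns a lifting problem for \<open>L P\<close> against \<open>e\<close>
  into one for \<open>P\<close> against \<open>Rm e\<close>; this carries relative projectivity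
  through tensor products.\<close>

lemma left_lift:
  assumes "P \<in> obj C" "e \<in> hom C V W" "f \<in> hom C (L P) W"
    and "\<And>h. h \<in> hom C P (R W) \<Longrightarrow> \<exists>g \<in> hom C P (R V). Rm e \<cdot> g = h"
  shows "\<exists>g \<in> hom C (L P) V. e \<cdot> g = f"
proof -
  obtain g where g: "g \<in> hom C P (R V)" "Rm e \<cdot> g = \<Phi> P W f"
    using assms(4)[OF transpose_hom[OF assms(1,3)]] by blast
  obtain g' where g': "g' \<in> hom C (L P) V" "\<Phi> P V g' = g"
    using transpose_surj g(1) assms(2) hom_obj by metis
  have "\<Phi> P W (e \<cdot> g') = \<Phi> P W f"
    using transpose_right[OF assms(1) g'(1) assms(2)] g g' by simp
  then have "e \<cdot> g' = f"
    using transpose_inj[OF assms(1)] cmp_hom[OF g'(1) assms(2)] assms(3) by blast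
  with g' show ?thesis by blast
qed

text \<open>Dually, an extension problem for \<open>R I\<close> along \<open>i\<close> transposes to
  one for \<open>I\<close> along \<open>Lm i\<close>; this carries relative injectivity.\<close>

lemma right_extend:
  assumes "I \<in> obj C" "i \<in> hom C U V" "f \<in> hom C U (R I)"
    and "\<And>h. h \<in> hom C (L U) I \<Longrightarrow> \<exists>g \<in> hom C (L V) I. g \<cdot> Lm i = h"
  shows "\<exists>g \<in> hom C V (R I). g \<cdot> i = f"
proof -
  have U: "U \<in> obj C" and V: "V \<in> obj C" using assms(2) hom_obj by auto
  obtain f' where f': "f' \<in> hom C (L U) I" "\<Phi> U I f' = f"
    using transpose_surj assms(1,3) by metis
  obtain g where g: "g \<in> hom C (L V) I" "g \<cdot> Lm i = f'" using assms(4)[OF f'(1)] by blast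
  have "\<Phi> V I g \<cdot> i = f" using transpose_left[OF assms(2) g(1)] g f' by simp
  with transpose_hom[OF V g(1)] show ?thesis by blast
qed

end

text \<open>\<open>\<psi>\<close> is the mate of \<open>\<phi>\<close>: the unit
  \<open>\<eta>\<close> followed by \<open>\<phi>\<close>, transposed back. By \<open>key\<close>,
  precomposition with \<open>\<psi>\<close> corresponds to postcomposition with
  \<open>\<phi>\<close>, which is injective because \<open>\<phi>\<close> is mono.\<close>

lemma adjunction_comparison_epi:
  fixes C (structure)
  assumes "adjunction C L R Lm Rm \<Phi>" "adjunction C L' R' Lm' Rm' \<Phi>'"
    and \<phi>_mono: "\<And>Z. Z \<in> obj C \<Longrightarrow> \<phi> Z \<in> hom C (R Z) (R' Z) \<and> is_mono C (\<phi> Z)"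
    and \<phi>_natural: "\<And>f Z Z'. f \<in> hom C Z Z' \<Longrightarrow> \<phi> Z' \<cdot> Rm f = Rm' f \<cdot> \<phi> Z"
    and U: "U \<in> obj C"
  shows "\<exists>\<psi> \<in> hom C (L' U) (L U). is_epi C \<psi>"
proof -
  interpret A: adjunction C L R Lm Rm \<Phi> by fact
  interpret A': adjunction C L' R' Lm' Rm' \<Phi>' by fact
  have LU: "L U \<in> obj C" by (rule A.L_obj[OF U])
  note id = A.ident_hom[OF LU]
  define \<eta> where "\<eta> = \<Phi> U (L U) (ident C (L U))"
  have \<eta>: "\<eta> \<in> hom C U (R (L U))"
    unfolding \<eta>_def by (rule A.transpose_hom[OF U id])
  have \<eta>': "\<phi> (L U) \<cdot> \<eta> \<in> hom C U (R' (L U))"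
    using A.cmp_hom[OF \<eta>] \<phi>_mono[OF LU] by blast
  obtain \<psi> where \<psi>: "\<psi> \<in> hom C (L' U) (L U)" "\<Phi>' U (L U) \<psi> = \<phi> (L U) \<cdot> \<eta>"
    using A'.transpose_surj[OF LU \<eta>'] by blast
  have key: "\<Phi>' U Z (g \<cdot> \<psi>) = \<phi> Z \<cdot> \<Phi> U Z g" if g: "g \<in> hom C (L U) Z" for g Z
  proof -
    have Z: "Z \<in> obj C" using g A.hom_obj by blast
    have "\<Phi>' U Z (g \<cdot> \<psi>) = Rm' g \<cdot> (\<phi> (L U) \<cdot> \<eta>)"
      using A'.transpose_right[OF U \<psi>(1) g] \<psi>(2) by simp
    also have "\<dots> = (Rm' g \<cdot> \<phi> (L U)) \<cdot> \<eta>"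
      using A'.R_hom[OF g] \<phi>_mono[OF LU] \<eta> by (auto simp: hom_def)
    also have "\<dots> = \<phi> Z \<cdot> (Rm g \<cdot> \<eta>)"
      using A.R_hom[OF g] \<phi>_mono[OF Z] \<eta> by (auto simp: hom_def simp flip: \<phi>_natural[OF g])
    also have "Rm g \<cdot> \<eta> = \<Phi> U Z g"
      unfolding \<eta>_def using A.transpose_right[OF U id g] g by (simp add: hom_def)
    finally show ?thesis .
  qed
  have "is_epi C \<psi>"
    unfolding is_epi_def
  proof (intro conjI allI ballI impI)
    show "\<psi> \<in> mor C" using \<psi> by (simp add: hom_def)
    fix W g h
    assume a: "g \<in> hom C (tgt C \<psi>) W" "h \<in> hom C (tgt C \<psi>) W" "g \<cdot> \<psi> = h \<cdot> \<psi>"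
    have gh: "g \<in> hom C (L U) W" "h \<in> hom C (L U) W" using a \<psi> by (auto simp: hom_def)
    have W: "W \<in> obj C" using a A.hom_obj by blast
    have "\<phi> W \<cdot> \<Phi> U W g = \<phi> W \<cdot> \<Phi> U W h" using key gh a(3) by metis
    moreover have "src C (\<phi> W) = R W" using \<phi>_mono[OF W] by (auto simp: hom_def)
    ultimately have "\<Phi> U W g = \<Phi> U W h"
      using A.is_monoD[of "\<phi> W" _ U] \<phi>_mono[OF W] A.transpose_hom[OF U gh(1)] A.transpose_hom[OF U gh(2)]
      by auto
    then show "g = h" using A.transpose_inj[OF U] gh by blast
  qed
  with \<psi> show ?thesis by blast
qed

text \<open>The mate in the other direction: \<open>\<psi>\<close> is the transpose of
  \<open>\<phi>\<close> followed by the counit \<open>\<epsilon>\<close>. By \<open>key\<close>,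
  postcomposition with \<open>\<psi>\<close> corresponds to precomposition with
  \<open>\<phi>\<close>, which is injective because \<open>\<phi>\<close> is epi.\<close>

lemma adjunction_comparison_mono:
  fixes C (structure)
  assumes "adjunction C L R Lm Rm \<Phi>" "adjunction C L' R' Lm' Rm' \<Phi>'"
    and \<phi>_epi: "\<And>U. U \<in> obj C \<Longrightarrow> \<phi> U \<in> hom C (L U) (L' U) \<and> is_epi C (\<phi> U)"
    and \<phi>_natural: "\<And>f U V. f \<in> hom C U V \<Longrightarrow> \<phi> V \<cdot> Lm f = Lm' f \<cdot> \<phi> U"
    and Z: "Z \<in> obj C"
  shows "\<exists>\<psi> \<in> hom C (R' Z) (R Z). is_mono C \<psi>"
proof -
  interpret A: adjunction C L R Lm Rm \<Phi> by fact
  interpret A': adjunction C L' R' Lm' Rm' \<Phi>' by fact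
  have RZ: "R' Z \<in> obj C" by (rule A'.R_obj[OF Z])
  obtain \<epsilon> where \<epsilon>: "\<epsilon> \<in> hom C (L' (R' Z)) Z" "\<Phi>' (R' Z) Z \<epsilon> = ident C (R' Z)"
    using A'.transpose_surj[OF Z A.ident_hom[OF RZ]] by blast
  have \<epsilon>': "\<epsilon> \<cdot> \<phi> (R' Z) \<in> hom C (L (R' Z)) Z"
    using A.cmp_hom[OF _ \<epsilon>(1)] \<phi>_epi[OF RZ] by blast
  define \<psi> where "\<psi> = \<Phi> (R' Z) Z (\<epsilon> \<cdot> \<phi> (R' Z))"
  have \<psi>: "\<psi> \<in> hom C (R' Z) (R Z)"
    unfolding \<psi>_def by (rule A.transpose_hom[OF RZ \<epsilon>'])
  have key: "\<exists>g'. g' \<in> hom C (L' U) Z \<and> \<Phi>' U Z g' = g \<and> \<Phi> U Z (g' \<cdot> \<phi> U) = \<psi> \<cdot> g"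
    if g: "g \<in> hom C U (R' Z)" for g U
  proof (intro exI conjI)
    have U: "U \<in> obj C" using g A.hom_obj by blast
    show g': "\<epsilon> \<cdot> Lm' g \<in> hom C (L' U) Z" using A.cmp_hom[OF A'.L_hom[OF g] \<epsilon>(1)] .
    show "\<Phi>' U Z (\<epsilon> \<cdot> Lm' g) = g" using A'.transpose_left[OF g \<epsilon>(1)] \<epsilon>(2) g by (auto simp: hom_def)
    have "(\<epsilon> \<cdot> Lm' g) \<cdot> \<phi> U = \<epsilon> \<cdot> (Lm' g \<cdot> \<phi> U)"
      using \<epsilon>(1) A'.L_hom[OF g] \<phi>_epi[OF U] by (auto simp: hom_def)
    also have "\<dots> = (\<epsilon> \<cdot> \<phi> (R' Z)) \<cdot> Lm g"
      using \<epsilon>(1) A.L_hom[OF g] \<phi>_epi[OF RZ] by (auto simp: hom_def simp flip: \<phi>_natural[OF g])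
    finally show "\<Phi> U Z ((\<epsilon> \<cdot> Lm' g) \<cdot> \<phi> U) = \<psi> \<cdot> g"
      unfolding \<psi>_def using A.transpose_left[OF g \<epsilon>'] by simp
  qed
  have "is_mono C \<psi>"
    unfolding is_mono_def
  proof (intro conjI allI ballI impI)
    show "\<psi> \<in> mor C" using \<psi> by (simp add: hom_def)
    fix W g h
    assume a: "g \<in> hom C W (src C \<psi>)" "h \<in> hom C W (src C \<psi>)" "\<psi> \<cdot> g = \<psi> \<cdot> h"
    have W: "W \<in> obj C" using a A.hom_obj by blast
    obtain g' where g': "g' \<in> hom C (L' W) Z" "\<Phi>' W Z g' = g" "\<Phi> W Z (g' \<cdot> \<phi> W) = \<psi> \<cdot> g"
      using key[of g W] a \<psi> by (auto simp: hom_def)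
    obtain h' where h': "h' \<in> hom C (L' W) Z" "\<Phi>' W Z h' = h" "\<Phi> W Z (h' \<cdot> \<phi> W) = \<psi> \<cdot> h"
      using key[of h W] a \<psi> by (auto simp: hom_def)
    have "g' \<cdot> \<phi> W = h' \<cdot> \<phi> W"
      using A.transpose_inj[OF W, of "g' \<cdot> \<phi> W" Z "h' \<cdot> \<phi> W"] a(3) g' h' \<phi>_epi[OF W]
        A.cmp_hom[of "\<phi> W" "L W" "L' W"] by auto
    then have "g' = h'"
      using A.is_epiD[of "\<phi> W" g' Z h'] \<phi>_epi[OF W] g' h' by (auto simp: hom_def)
    then show "g = h" using g' h' by simp
  qed
  with \<psi> show ?thesis by blast
qed

text \<open>Serves to find the dual of a tensor product: tensoring with two objects in succession is
  adjoint to tensoring with their duals in the opposite order.\<close>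

lemma adjunction_comp:
  fixes C (structure)
  assumes "adjunction C L R Lm Rm \<Phi>" "adjunction C L' R' Lm' Rm' \<Phi>'"
  shows "adjunction C (\<lambda>U. L (L' U)) (\<lambda>Z. R' (R Z)) (\<lambda>f. Lm (Lm' f)) (\<lambda>f. Rm' (Rm f))
    (\<lambda>U Z g. \<Phi>' U (R Z) (\<Phi> (L' U) Z g))"
proof -
  interpret A: adjunction C L R Lm Rm \<Phi> by fact
  interpret A': adjunction C L' R' Lm' Rm' \<Phi>' by fact
  show ?thesis
  proof (intro adjunction.intro A.category_axioms adjunction_axioms.intro)
    fix U Z
    assume "U \<in> obj C" "Z \<in> obj C"
    then show "bij_betw (\<lambda>g. \<Phi>' U (R Z) (\<Phi> (L' U) Z g)) (hom C (L (L' U)) Z) (hom C U (R' (R Z)))"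
      using bij_betw_trans[OF A.transpose_bij[of "L' U" Z] A'.transpose_bij[of U "R Z"]]
      by (auto simp: o_def A.R_obj A'.L_obj)
  next
    fix U g Z k Z'
    assume "U \<in> obj C" "g \<in> hom C (L (L' U)) Z" "k \<in> hom C Z Z'"
    then show "\<Phi>' U (R Z') (\<Phi> (L' U) Z' (k \<cdot> g)) = Rm' (Rm k) \<cdot> \<Phi>' U (R Z) (\<Phi> (L' U) Z g)"
      using A.transpose_right A'.transpose_right A.transpose_hom A'.L_obj A.R_hom by metis
  next
    fix h U' U g Z
    assume "h \<in> hom C U' U" "g \<in> hom C (L (L' U)) Z"
    then show "\<Phi>' U' (R Z) (\<Phi> (L' U') Z (g \<cdot> Lm (Lm' h))) = \<Phi>' U (R Z) (\<Phi> (L' U) Z g) \<cdot> h"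
      using A.transpose_left A'.transpose_left A.transpose_hom A'.L_obj A'.L_hom A.hom_obj by metis
  qed (auto simp: A.L_obj A'.L_obj A.R_obj A'.R_obj A.L_hom A'.L_hom A.R_hom A'.R_hom)
qed

section \<open>Abelian categories\<close>

context linear_category
begin

lemma zero_mor [simp]:
  assumes "X \<in> obj C" "Y \<in> obj C"
  shows "zero_mor C X Y \<in> mor C" "src C (zero_mor C X Y) = X" "tgt C (zero_mor C X Y) = Y"
  using zero_hom[OF assms] by (auto simp: hom_def)

lemma add_cancel:
  assumes "f \<in> hom C X Y" "g \<in> hom C X Y" "h \<in> hom C X Y" "f \<oplus> g = f \<oplus> h"
  shows "g = h"
proof -
  obtain k where k: "k \<in> hom C X Y" "f \<oplus> k = zero_mor C X Y"
    using add_inverse[OF assms(1)] by blast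
  have *: "k \<oplus> (f \<oplus> u) = u" if u: "u \<in> hom C X Y" for u
  proof -
    have "k \<oplus> (f \<oplus> u) = (f \<oplus> k) \<oplus> u"
      unfolding add_assoc[OF k(1) assms(1) u, symmetric] add_commute[OF k(1) assms(1)] ..
    also have "\<dots> = u \<oplus> zero_mor C X Y"
      unfolding k(2) by (rule add_commute[OF zero_hom u]) (use hom_obj[OF u] in auto)
    also have "\<dots> = u" by (rule add_zero[OF u])
    finally show ?thesis .
  qed
  have "g = k \<oplus> (f \<oplus> g)" using *[OF assms(2)] ..
  also have "\<dots> = h" unfolding assms(4) by (rule *[OF assms(3)])
  finally show ?thesis .
qed

lemma scale_zero:
  assumes "f \<in> hom C X Y"
  shows "0 \<star> f = zero_mor C X Y"
proof -
  have f0: "0 \<star> f \<in> hom C X Y" using scale_hom[OF assms] .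
  have "0 \<star> f \<oplus> 0 \<star> f = 0 \<star> f \<oplus> zero_mor C X Y"
    using scale_add_left[OF assms, of 0 0] add_zero[OF f0] by simp
  then show ?thesis using add_cancel[OF f0 f0] zero_hom hom_obj[OF assms] by blast
qed

text \<open>The axioms relate composition to scalars but do not mention zero morphisms. A zero
  morphism is \<open>0\<close> times itself, so linearity of composition absorbs it.\<close>

lemma cmp_zero [simp]:
  assumes "f \<in> mor C"
  shows "tgt C f = Y \<Longrightarrow> Z \<in> obj C \<Longrightarrow> zero_mor C Y Z \<cdot> f = zero_mor C (src C f) Z"
    "src C f = Y \<Longrightarrow> X \<in> obj C \<Longrightarrow> f \<cdot> zero_mor C X Y = zero_mor C X (tgt C f)"
proof -
  have f: "f \<in> hom C (src C f) (tgt C f)" using assms by (simp add: hom_def)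
  show "zero_mor C Y Z \<cdot> f = zero_mor C (src C f) Z" if "tgt C f = Y" "Z \<in> obj C"
  proof -
    have z: "zero_mor C Y Z \<in> hom C (tgt C f) Z" using that assms zero_hom by auto
    show ?thesis
      using cmp_scale_left[OF f z, of 0] scale_zero[OF z] scale_zero[OF cmp_hom[OF f z]] that by simp
  qed
  show "f \<cdot> zero_mor C X Y = zero_mor C X (tgt C f)" if "src C f = Y" "X \<in> obj C"
  proof -
    have z: "zero_mor C X Y \<in> hom C X (src C f)" using that assms zero_hom by auto
    show ?thesis
      using cmp_scale_right[OF z f, of 0] scale_zero[OF z] scale_zero[OF cmp_hom[OF z f]] that by simp
  qed
qed

definition diff :: "'m \<Rightarrow> 'm \<Rightarrow> 'm" (infixl "\<ominus>" 65) where
  "f \<ominus> g = f \<oplus> (-1) \<star> g"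

lemma diff_hom: "f \<in> hom C X Y \<Longrightarrow> g \<in> hom C X Y \<Longrightarrow> f \<ominus> g \<in> hom C X Y"
  unfolding diff_def by (intro add_hom scale_hom)

lemma diff_eq_zero_iff:
  assumes "f \<in> hom C X Y" "g \<in> hom C X Y"
  shows "f \<ominus> g = zero_mor C X Y \<longleftrightarrow> f = g"
proof -
  have *: "g \<oplus> (-1) \<star> g = zero_mor C X Y"
    using scale_add_left[OF assms(2), of 1 "-1"] scale_one[OF assms(2)] scale_zero[OF assms(2)] by simp
  note n = scale_hom[OF assms(2), of "-1"]
  show ?thesis
    using * add_cancel[OF n assms(1,2)] add_commute[OF n assms(1)] add_commute[OF n assms(2)]
    by (auto simp: diff_def)
qed

lemma cmp_diff_right:
  "f \<in> hom C X Y \<Longrightarrow> g \<in> hom C X Y \<Longrightarrow> h \<in> hom C Y Z \<Longrightarrow> h \<cdot> (f \<ominus> g) = h \<cdot> f \<ominus> h \<cdot> g"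
  by (simp add: diff_def cmp_add_right scale_hom cmp_scale_right)

lemma cmp_diff_left:
  "f \<in> hom C X Y \<Longrightarrow> g \<in> hom C Y Z \<Longrightarrow> h \<in> hom C Y Z \<Longrightarrow> (g \<ominus> h) \<cdot> f = g \<cdot> f \<ominus> h \<cdot> f"
  by (simp add: diff_def cmp_add_left[of f X Y] scale_hom cmp_scale_left[of f X Y])

lemma is_monoI:
  assumes "m \<in> hom C X Y" "\<And>W u. u \<in> hom C W X \<Longrightarrow> m \<cdot> u = zero_mor C W Y \<Longrightarrow> u = zero_mor C W X"
  shows "is_mono C m"
  unfolding is_mono_def
proof (intro conjI allI ballI impI)
  show "m \<in> mor C" using assms(1) by (simp add: hom_def)
  fix W g h assume "g \<in> hom C W (src C m)" "h \<in> hom C W (src C m)" and eq: "m \<cdot> g = m \<cdot> h"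
  then have gh: "g \<in> hom C W X" "h \<in> hom C W X" using assms(1) by (auto simp: hom_def)
  have "m \<cdot> (g \<ominus> h) = zero_mor C W Y"
    using cmp_diff_right[OF gh assms(1)] eq diff_eq_zero_iff cmp_hom[OF gh(2) assms(1)] by metis
  then show "g = h" using assms(2) diff_hom[OF gh] diff_eq_zero_iff[OF gh] by blast
qed

lemma is_epiI:
  assumes "e \<in> hom C X Y" "\<And>W u. u \<in> hom C Y W \<Longrightarrow> u \<cdot> e = zero_mor C X W \<Longrightarrow> u = zero_mor C Y W"
  shows "is_epi C e"
  unfolding is_epi_def
proof (intro conjI allI ballI impI)
  show "e \<in> mor C" using assms(1) by (simp add: hom_def)
  fix W g h assume "g \<in> hom C (tgt C e) W" "h \<in> hom C (tgt C e) W" and eq: "g \<cdot> e = h \<cdot> e"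
  then have gh: "g \<in> hom C Y W" "h \<in> hom C Y W" using assms(1) by (auto simp: hom_def)
  have "(g \<ominus> h) \<cdot> e = zero_mor C X W"
    using cmp_diff_left[OF assms(1) gh] eq diff_eq_zero_iff cmp_hom[OF assms(1) gh(2)] by metis
  then show "g = h" using assms(2) diff_hom[OF gh] diff_eq_zero_iff[OF gh] by blast
qed

lemma mono_zero:
  assumes "is_mono C m" "u \<in> hom C W (src C m)" "m \<cdot> u = zero_mor C W (tgt C m)"
  shows "u = zero_mor C W (src C m)"
  using is_monoD[OF assms(1,2), of "zero_mor C W (src C m)"] assms(3) is_mono_mor[OF assms(1)]
    zero_hom hom_obj[OF assms(2)] by simp

lemma epi_zero:
  assumes "is_epi C e" "u \<in> hom C (tgt C e) W" "u \<cdot> e = zero_mor C (src C e) W"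
  shows "u = zero_mor C (tgt C e) W"
  using is_epiD[OF assms(1,2), of "zero_mor C (tgt C e) W"] assms(3) is_epi_mor[OF assms(1)]
    zero_hom hom_obj[OF assms(2)] by simp

lemma kernelD:
  assumes "is_kernel C f k"
  shows "f \<in> mor C" "k \<in> mor C" "tgt C k = src C f" "f \<cdot> k = zero_mor C (src C k) (tgt C f)"
  using assms by (auto simp: is_kernel_def)

lemma cokernelD:
  assumes "is_cokernel C f q"
  shows "f \<in> mor C" "q \<in> mor C" "src C q = tgt C f" "q \<cdot> f = zero_mor C (src C f) (tgt C q)"
  using assms by (auto simp: is_cokernel_def)

lemma kernel_factor:
  assumes "is_kernel C f k" "h \<in> hom C W (src C f)" "f \<cdot> h = zero_mor C W (tgt C f)"
  obtains u where "u \<in> hom C W (src C k)" "k \<cdot> u = h"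
  using assms unfolding is_kernel_def by blast

lemma cokernel_factor:
  assumes "is_cokernel C f q" "h \<in> hom C (tgt C f) W" "h \<cdot> f = zero_mor C (src C f) W"
  obtains u where "u \<in> hom C (tgt C q) W" "u \<cdot> q = h"
  using assms unfolding is_cokernel_def by blast

lemma kernel_mono:
  assumes "is_kernel C f k"
  shows "is_mono C k"
  unfolding is_mono_def
proof (intro conjI allI ballI impI)
  note k = kernelD[OF assms]
  show "k \<in> mor C" by fact
  fix W g h
  assume gh: "g \<in> hom C W (src C k)" "h \<in> hom C W (src C k)" "k \<cdot> g = k \<cdot> h"
  have h: "k \<cdot> h \<in> hom C W (src C f)" using gh(2) k(2,3) by (auto simp: hom_def)
  have "f \<cdot> (k \<cdot> h) = (f \<cdot> k) \<cdot> h" using gh(2) k(1-3) by (simp add: hom_def)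
  also have "\<dots> = zero_mor C W (tgt C f)" unfolding k(4) using gh(2) k(1-3) by (auto simp: hom_def)
  finally show "g = h" using assms h gh unfolding is_kernel_def by blast
qed

lemma cokernel_epi:
  assumes "is_cokernel C f q"
  shows "is_epi C q"
  unfolding is_epi_def
proof (intro conjI allI ballI impI)
  note q = cokernelD[OF assms]
  show "q \<in> mor C" by fact
  fix W g h
  assume gh: "g \<in> hom C (tgt C q) W" "h \<in> hom C (tgt C q) W" "g \<cdot> q = h \<cdot> q"
  have h: "h \<cdot> q \<in> hom C (tgt C f) W" using gh(2) q(2,3) by (auto simp: hom_def)
  have "(h \<cdot> q) \<cdot> f = zero_mor C (src C f) W" using gh(2) q by (auto simp: hom_def)
  with assms h gh show "g = h" unfolding is_cokernel_def by blast
qed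

end

section \<open>Morphisms into and out of direct sums\<close>

context linear_category
begin

lemma direct_sum_pair:
  assumes h: "a \<in> hom C X Y\<^sub>1" "b \<in> hom C X Y\<^sub>2" and S: "i \<in> hom C Y\<^sub>1 S" "j \<in> hom C Y\<^sub>2 S"
    "p \<in> hom C S Y\<^sub>1" "q \<in> hom C S Y\<^sub>2" "p \<cdot> i = ident C Y\<^sub>1" "q \<cdot> j = ident C Y\<^sub>2"
    "p \<cdot> j = zero_mor C Y\<^sub>2 Y\<^sub>1" "q \<cdot> i = zero_mor C Y\<^sub>1 Y\<^sub>2"
  shows "\<exists>w \<in> hom C X S. p \<cdot> w = a \<and> q \<cdot> w = b"
proof
  have ia: "i \<cdot> a \<in> hom C X S" and jb: "j \<cdot> b \<in> hom C X S" using h S cmp_hom by blast+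
  show "(i \<cdot> a) \<oplus> (j \<cdot> b) \<in> hom C X S" using add_hom[OF ia jb] .
  note m = h[THEN homD(1)] h[THEN homD(2)] h[THEN homD(3)]
    S(1-4)[THEN homD(1)] S(1-4)[THEN homD(2)] S(1-4)[THEN homD(3)]
  have o: "X \<in> obj C" "Y\<^sub>1 \<in> obj C" "Y\<^sub>2 \<in> obj C" using hom_obj h by blast+
  have "p \<cdot> ((i \<cdot> a) \<oplus> (j \<cdot> b)) = (p \<cdot> i) \<cdot> a \<oplus> (p \<cdot> j) \<cdot> b"
    using cmp_add_right[OF ia jb S(3)] m by simp
  also have "\<dots> = a" unfolding S(5,7) using m o add_zero[OF h(1)] by simp
  finally have 1: "p \<cdot> ((i \<cdot> a) \<oplus> (j \<cdot> b)) = a" .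
  have "q \<cdot> ((i \<cdot> a) \<oplus> (j \<cdot> b)) = (q \<cdot> i) \<cdot> a \<oplus> (q \<cdot> j) \<cdot> b"
    using cmp_add_right[OF ia jb S(4)] m by simp
  also have "\<dots> = zero_mor C X Y\<^sub>2 \<oplus> b" unfolding S(6,8) using m o by simp
  also have "\<dots> = b \<oplus> zero_mor C X Y\<^sub>2" by (rule add_commute[OF zero_hom[OF o(1,3)] h(2)])
  also have "\<dots> = b" by (rule add_zero[OF h(2)])
  finally show "p \<cdot> ((i \<cdot> a) \<oplus> (j \<cdot> b)) = a \<and> q \<cdot> ((i \<cdot> a) \<oplus> (j \<cdot> b)) = b" using 1 by blast
qed

text \<open>\<open>T\<close> can be larger than a direct sum. In the main application it is a tensor
  product of two direct sums, and \<open>\<rho>\<close> and \<open>\<sigma>\<close> separate its two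
  diagonal blocks.\<close>

lemma direct_sum_embed:
  assumes S: "is_direct_sum C X\<^sub>1 X\<^sub>2 S"
    and h: "\<alpha> \<in> hom C X\<^sub>1 T" "\<beta> \<in> hom C X\<^sub>2 T" "\<rho> \<in> hom C T Y\<^sub>1" "\<sigma> \<in> hom C T Y\<^sub>2"
    and mono: "is_mono C (\<rho> \<cdot> \<alpha>)" "is_mono C (\<sigma> \<cdot> \<beta>)"
    and zero: "\<rho> \<cdot> \<beta> = zero_mor C X\<^sub>2 Y\<^sub>1" "\<sigma> \<cdot> \<alpha> = zero_mor C X\<^sub>1 Y\<^sub>2"
  shows "\<exists>f \<in> hom C S T. is_mono C f"
proof -
  obtain i j p q where s: "i \<in> hom C X\<^sub>1 S" "j \<in> hom C X\<^sub>2 S" "p \<in> hom C S X\<^sub>1" "q \<in> hom C S X\<^sub>2"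
    "(i \<cdot> p) \<oplus> (j \<cdot> q) = ident C S"
    using S unfolding is_direct_sum_def by blast
  note ss = s(1-4)[THEN homD(1)] s(1-4)[THEN homD(2)] s(1-4)[THEN homD(3)]
    h[THEN homD(1)] h[THEN homD(2)] h[THEN homD(3)]
  have ap: "\<alpha> \<cdot> p \<in> hom C S T" and bq: "\<beta> \<cdot> q \<in> hom C S T" using cmp_hom h s by blast+
  define f where "f = (\<alpha> \<cdot> p) \<oplus> (\<beta> \<cdot> q)"
  have f: "f \<in> hom C S T" unfolding f_def using add_hom[OF ap bq] .
  note ff = homD[OF f]
  have o: "S \<in> obj C" "X\<^sub>1 \<in> obj C" "X\<^sub>2 \<in> obj C" "Y\<^sub>1 \<in> obj C" "Y\<^sub>2 \<in> obj C" using hom_obj h s by blast+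
  have ra: "\<rho> \<cdot> (\<alpha> \<cdot> p) \<in> hom C S Y\<^sub>1" and sb: "\<sigma> \<cdot> (\<beta> \<cdot> q) \<in> hom C S Y\<^sub>2"
    using cmp_hom ap bq h by blast+
  have "\<rho> \<cdot> f = \<rho> \<cdot> (\<alpha> \<cdot> p) \<oplus> (\<rho> \<cdot> \<beta>) \<cdot> q"
    unfolding f_def using cmp_add_right[OF ap bq h(3)] ss by simp
  also have "\<dots> = (\<rho> \<cdot> \<alpha>) \<cdot> p" unfolding zero using add_zero[OF ra] ss o by simp
  finally have rf: "\<rho> \<cdot> f = (\<rho> \<cdot> \<alpha>) \<cdot> p" .
  have "\<sigma> \<cdot> f = (\<sigma> \<cdot> \<alpha>) \<cdot> p \<oplus> \<sigma> \<cdot> (\<beta> \<cdot> q)"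
    unfolding f_def using cmp_add_right[OF ap bq h(4)] ss by simp
  also have "\<dots> = zero_mor C S Y\<^sub>2 \<oplus> \<sigma> \<cdot> (\<beta> \<cdot> q)" unfolding zero using ss o by simp
  also have "\<dots> = \<sigma> \<cdot> (\<beta> \<cdot> q) \<oplus> zero_mor C S Y\<^sub>2" using add_commute[OF zero_hom sb] o by blast
  also have "\<dots> = (\<sigma> \<cdot> \<beta>) \<cdot> q" using add_zero[OF sb] ss by simp
  finally have sf: "\<sigma> \<cdot> f = (\<sigma> \<cdot> \<beta>) \<cdot> q" .
  have "is_mono C f"
  proof (rule is_monoI[OF f])
    fix W t assume t: "t \<in> hom C W S" "f \<cdot> t = zero_mor C W T"
    note tt = homD[OF t(1)] and W = hom_obj(1)[OF t(1)]
    have "(\<rho> \<cdot> \<alpha>) \<cdot> (p \<cdot> t) = (\<rho> \<cdot> f) \<cdot> t" unfolding rf using ss tt by simp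
    also have "\<dots> = zero_mor C W (tgt C (\<rho> \<cdot> \<alpha>))" using ss tt ff t(2) W by simp
    finally have pt: "p \<cdot> t = zero_mor C W X\<^sub>1"
      using mono_zero[OF mono(1)] cmp_hom[OF t(1) s(3)] ss by simp
    have "(\<sigma> \<cdot> \<beta>) \<cdot> (q \<cdot> t) = (\<sigma> \<cdot> f) \<cdot> t" unfolding sf using ss tt by simp
    also have "\<dots> = zero_mor C W (tgt C (\<sigma> \<cdot> \<beta>))" using ss tt ff t(2) W by simp
    finally have qt: "q \<cdot> t = zero_mor C W X\<^sub>2"
      using mono_zero[OF mono(2)] cmp_hom[OF t(1) s(4)] ss by simp
    have "t = ((i \<cdot> p) \<oplus> (j \<cdot> q)) \<cdot> t" unfolding s(5) using tt by simp
    also have "\<dots> = i \<cdot> (p \<cdot> t) \<oplus> j \<cdot> (q \<cdot> t)"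
      using cmp_add_left[OF t(1) cmp_hom[OF s(3,1)] cmp_hom[OF s(4,2)]] ss tt by simp
    also have "\<dots> = zero_mor C W S"
      unfolding pt qt using ss W add_zero[OF zero_hom[OF W o(1)]] by simp
    finally show "t = zero_mor C W S" .
  qed
  with f show ?thesis by blast
qed

lemma direct_sum_epi:
  assumes S: "is_direct_sum C X\<^sub>1 X\<^sub>2 S" and T: "is_direct_sum C Y\<^sub>1 Y\<^sub>2 T"
    and e: "e\<^sub>1 \<in> hom C X\<^sub>1 Y\<^sub>1" "e\<^sub>2 \<in> hom C X\<^sub>2 Y\<^sub>2" and epi: "is_epi C e\<^sub>1" "is_epi C e\<^sub>2"
  shows "\<exists>f \<in> hom C S T. is_epi C f"
proof -
  obtain i j p q where s: "i \<in> hom C X\<^sub>1 S" "j \<in> hom C X\<^sub>2 S" "p \<in> hom C S X\<^sub>1" "q \<in> hom C S X\<^sub>2"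
    "p \<cdot> i = ident C X\<^sub>1" "q \<cdot> j = ident C X\<^sub>2" "p \<cdot> j = zero_mor C X\<^sub>2 X\<^sub>1" "q \<cdot> i = zero_mor C X\<^sub>1 X\<^sub>2"
    using S unfolding is_direct_sum_def by blast
  obtain i' j' p' q' where s': "i' \<in> hom C Y\<^sub>1 T" "j' \<in> hom C Y\<^sub>2 T" "p' \<in> hom C T Y\<^sub>1" "q' \<in> hom C T Y\<^sub>2"
    "(i' \<cdot> p') \<oplus> (j' \<cdot> q') = ident C T"
    using T unfolding is_direct_sum_def by blast
  note ss = s(1-4)[THEN homD(1)] s(1-4)[THEN homD(2)] s(1-4)[THEN homD(3)]
    s'(1-4)[THEN homD(1)] s'(1-4)[THEN homD(2)] s'(1-4)[THEN homD(3)]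
    e[THEN homD(1)] e[THEN homD(2)] e[THEN homD(3)]
  have o: "S \<in> obj C" "T \<in> obj C" "X\<^sub>1 \<in> obj C" "X\<^sub>2 \<in> obj C" using hom_obj s s' by blast+
  have a: "i' \<cdot> e\<^sub>1 \<in> hom C X\<^sub>1 T" and b: "j' \<cdot> e\<^sub>2 \<in> hom C X\<^sub>2 T" using cmp_hom e s' by blast+
  have ap: "i' \<cdot> e\<^sub>1 \<cdot> p \<in> hom C S T" and bq: "j' \<cdot> e\<^sub>2 \<cdot> q \<in> hom C S T" using cmp_hom a b s by blast+
  define f where "f = (i' \<cdot> e\<^sub>1 \<cdot> p) \<oplus> (j' \<cdot> e\<^sub>2 \<cdot> q)"
  have f: "f \<in> hom C S T" unfolding f_def using add_hom[OF ap bq] .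
  note ff = homD[OF f]
  have "f \<cdot> i = i' \<cdot> e\<^sub>1 \<oplus> zero_mor C X\<^sub>1 T"
    unfolding f_def cmp_add_left[OF s(1) ap bq] using ss s o by simp
  then have fi: "f \<cdot> i = i' \<cdot> e\<^sub>1" using add_zero[OF a] by simp
  have "f \<cdot> j = zero_mor C X\<^sub>2 T \<oplus> j' \<cdot> e\<^sub>2"
    unfolding f_def cmp_add_left[OF s(2) ap bq] using ss s o by simp
  then have fj: "f \<cdot> j = j' \<cdot> e\<^sub>2"
    using add_zero[OF b] add_commute[OF zero_hom b] o by metis
  have "is_epi C f"
  proof (rule is_epiI[OF f])
    fix W u assume u: "u \<in> hom C T W" "u \<cdot> f = zero_mor C S W"
    note uu = homD[OF u(1)] and W = hom_obj(2)[OF u(1)]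
    have "u \<cdot> i' \<cdot> e\<^sub>1 = (u \<cdot> f) \<cdot> i" using fi ss uu ff by simp
    also have "\<dots> = zero_mor C (src C e\<^sub>1) W" unfolding u(2) using ss W by simp
    finally have ui: "u \<cdot> i' = zero_mor C Y\<^sub>1 W"
      using epi_zero[OF epi(1)] cmp_hom[OF s'(1) u(1)] ss by simp
    have "u \<cdot> j' \<cdot> e\<^sub>2 = (u \<cdot> f) \<cdot> j" using fj ss uu ff by simp
    also have "\<dots> = zero_mor C (src C e\<^sub>2) W" unfolding u(2) using ss W by simp
    finally have uj: "u \<cdot> j' = zero_mor C Y\<^sub>2 W"
      using epi_zero[OF epi(2)] cmp_hom[OF s'(2) u(1)] ss by simp
    have "u = u \<cdot> ((i' \<cdot> p') \<oplus> (j' \<cdot> q'))" unfolding s'(5) using uu by simp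
    also have "\<dots> = (u \<cdot> i') \<cdot> p' \<oplus> (u \<cdot> j') \<cdot> q'"
      using cmp_add_right[OF cmp_hom[OF s'(3,1)] cmp_hom[OF s'(4,2)] u(1)] ss uu by simp
    also have "\<dots> = zero_mor C T W"
      unfolding ui uj using ss W add_zero[OF zero_hom[OF o(2) W]] by simp
    finally show "u = zero_mor C T W" .
  qed
  with f show ?thesis by blast
qed

end

section \<open>Kernels against cokernels, images, and pullbacks of epis\<close>

context abelian_category
begin

text \<open>\<open>m\<close> is the kernel of some \<open>f\<close>. As \<open>f\<close> kills
  \<open>m\<close>, it factors through the cokernel \<open>q\<close>, so whatever \<open>q\<close>
  kills is killed by \<open>f\<close> and factors through \<open>m\<close>.\<close>

lemma mono_is_kernel:
  assumes "is_mono C m" "is_cokernel C m q"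
  shows "is_kernel C q m"
proof -
  obtain f where f: "is_kernel C f m" using mono_kernel[OF assms(1)] by blast
  note f' = kernelD[OF f] and q' = cokernelD[OF assms(2)]
  have fh: "f \<in> hom C (tgt C m) (tgt C f)" using f' by (simp add: hom_def)
  obtain t where t: "t \<in> hom C (tgt C q) (tgt C f)" "t \<cdot> q = f"
    using cokernel_factor[OF assms(2) fh f'(4)] .
  show ?thesis unfolding is_kernel_def
  proof (intro conjI allI ballI impI)
    fix W h
    assume h: "h \<in> hom C W (src C q)" "q \<cdot> h = zero_mor C W (tgt C q)"
    have hf: "h \<in> hom C W (src C f)" using h(1) q' f' by simp
    have "f \<cdot> h = t \<cdot> (q \<cdot> h)" unfolding t(2)[symmetric] using t(1) h(1) q'(1-3) by (auto simp: hom_def)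
    also have "\<dots> = zero_mor C W (tgt C f)"
      unfolding h(2) using t(1) h(1) hom_obj[OF h(1)] by (auto simp: hom_def)
    finally have "f \<cdot> h = zero_mor C W (tgt C f)" .
    with f hf show "\<exists>!u. u \<in> hom C W (src C m) \<and> m \<cdot> u = h" unfolding is_kernel_def by blast
  qed (use q' f' in auto)
qed

lemma epi_is_cokernel:
  assumes "is_epi C e" "is_kernel C e k"
  shows "is_cokernel C k e"
proof -
  obtain f where f: "is_cokernel C f e" using epi_cokernel[OF assms(1)] by blast
  note f' = cokernelD[OF f] and k' = kernelD[OF assms(2)]
  have fh: "f \<in> hom C (src C f) (src C e)" using f' by (simp add: hom_def)
  obtain t where t: "t \<in> hom C (src C f) (src C k)" "k \<cdot> t = f"
    using kernel_factor[OF assms(2) fh f'(4)] .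
  show ?thesis unfolding is_cokernel_def
  proof (intro conjI allI ballI impI)
    fix W h
    assume h: "h \<in> hom C (tgt C k) W" "h \<cdot> k = zero_mor C (src C k) W"
    have hf: "h \<in> hom C (tgt C f) W" using h(1) k' f' by simp
    have "h \<cdot> f = (h \<cdot> k) \<cdot> t" unfolding t(2)[symmetric] using t(1) h(1) k'(1-3) by (auto simp: hom_def)
    also have "\<dots> = zero_mor C (src C f) W"
      unfolding h(2) using t(1) h(1) hom_obj[OF h(1)] by (auto simp: hom_def)
    finally have "h \<cdot> f = zero_mor C (src C f) W" .
    with f hf show "\<exists>!u. u \<in> hom C (tgt C e) W \<and> u \<cdot> e = h" unfolding is_cokernel_def by blast
  qed (use k' f' in auto)
qed

lemma short_exact_mono:
  assumes "is_mono C m"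
  obtains q where "short_exact C m q"
  using cokernel[OF is_mono_mor[OF assms]] mono_is_kernel[OF assms] unfolding short_exact_def by blast

lemma short_exact_epi:
  assumes "is_epi C e"
  obtains k where "short_exact C k e"
  using kernel[OF is_epi_mor[OF assms]] epi_is_cokernel[OF assms] unfolding short_exact_def by blast

text \<open>The image is the kernel \<open>m\<close> of the cokernel \<open>q\<close>. If
  \<open>t\<close> kills \<open>e\<close>, then \<open>f\<close> factors through the subobject
  \<open>m \<cdot> k\<close>, where \<open>k\<close> is the kernel of \<open>t\<close>; once
  \<open>k\<close> is seen to be split epi, \<open>t\<close> vanishes.\<close>

lemma image_factorization:
  assumes "f \<in> hom C X Y"
  obtains I e m where "e \<in> hom C X I" "is_epi C e" "m \<in> hom C I Y" "is_mono C m" "m \<cdot> e = f"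
proof -
  have f: "f \<in> mor C" "src C f = X" "tgt C f = Y" using assms by (auto simp: hom_def)
  obtain q where q: "is_cokernel C f q" using cokernel f by blast
  note q' = cokernelD[OF q]
  obtain m where m: "is_kernel C q m" using kernel q' by blast
  note m' = kernelD[OF m]
  define I where "I = src C m"
  have mh: "m \<in> hom C I Y" using m' q' f by (simp add: hom_def I_def)
  have "f \<in> hom C X (src C q)" "q \<cdot> f = zero_mor C X (tgt C q)" using assms q' f by simp_all
  then obtain e where e: "e \<in> hom C X I" "m \<cdot> e = f" using kernel_factor[OF m] I_def by blast
  have "is_epi C e"
  proof (rule is_epiI[OF e(1)])
    fix W t assume t: "t \<in> hom C I W" "t \<cdot> e = zero_mor C X W"
    have tt: "t \<in> mor C" "src C t = I" "tgt C t = W" using t by (auto simp: hom_def)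
    obtain k where k: "is_kernel C t k" using kernel tt(1) by blast
    note k' = kernelD[OF k]
    obtain e' where e': "e' \<in> hom C X (src C k)" "k \<cdot> e' = e"
      using kernel_factor[OF k, of e X] e t tt by auto
    have mk: "is_mono C (m \<cdot> k)"
      using mono_cmp[OF kernel_mono[OF k] kernel_mono[OF m]] k' tt I_def by simp
    \<comment> \<open>Here the normality of monos enters: \<open>h\<close> kills \<open>f\<close>,
      so it factors through \<open>q\<close> and therefore kills \<open>m\<close>; hence
      \<open>m\<close> factors through \<open>m \<cdot> k\<close>.\<close>
    then obtain h where h: "is_kernel C h (m \<cdot> k)" using mono_kernel by blast
    note h' = kernelD[OF h]
    have k1: "tgt C k = I" "src C m = I" using k' tt I_def by auto
    have hs: "src C h = Y" using h'(3) k' m' k1 mh by (simp add: hom_def)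
    have "h \<cdot> f = h \<cdot> ((m \<cdot> k) \<cdot> e')"
      using e' e k' mh k1 by (auto simp: hom_def)
    also have "\<dots> = (h \<cdot> (m \<cdot> k)) \<cdot> e'"
      using e'(1) k'(2,3) mh k1 h'(1) hs by (auto simp: hom_def)
    also have "\<dots> = zero_mor C X (tgt C h)"
      unfolding h'(4) using e'(1) k'(2,3) mh k1 h'(1) hs by (auto simp: hom_def)
    finally have hf: "h \<cdot> f = zero_mor C (src C f) (tgt C h)" using f by simp
    have hh: "h \<in> hom C (tgt C f) (tgt C h)" using h' hs f by (simp add: hom_def)
    obtain h1 where h1: "h1 \<in> hom C (tgt C q) (tgt C h)" "h1 \<cdot> q = h"
      using cokernel_factor[OF q hh hf] .
    have "h \<cdot> m = h1 \<cdot> (q \<cdot> m)"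
      unfolding h1(2)[symmetric] using h1(1) q'(1-3) mh f by (auto simp: hom_def)
    also have "\<dots> = zero_mor C I (tgt C h)"
      unfolding m'(4) using h1(1) m'(1-3) k1 k'(2) by (auto simp: hom_def)
    finally have "h \<cdot> m = zero_mor C I (tgt C h)" .
    moreover have "m \<in> hom C I (src C h)" using mh hs by simp
    ultimately obtain s where s: "s \<in> hom C I (src C k)" "(m \<cdot> k) \<cdot> s = m"
      using kernel_factor[OF h, of m I] k'(2) k1 mh by (auto simp: hom_def)
    have "m \<cdot> (k \<cdot> s) = m \<cdot> ident C I"
      using s k'(2) k1 mh by (auto simp: hom_def)
    moreover have "k \<cdot> s \<in> hom C I (src C m)" "ident C I \<in> hom C I (src C m)"
      using s(1) k'(2) k1 mh by (auto simp: hom_def)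
    ultimately have ks: "k \<cdot> s = ident C I" using is_monoD[OF kernel_mono[OF m]] by blast
    have "t = t \<cdot> (k \<cdot> s)" unfolding ks using tt by simp
    also have "\<dots> = (t \<cdot> k) \<cdot> s" using tt k'(2,3) s(1) by (auto simp: hom_def)
    also have "\<dots> = zero_mor C I W" unfolding k'(4) using tt k'(2,3) s(1) by (auto simp: hom_def)
    finally show "t = zero_mor C I W" .
  qed
  with that e mh kernel_mono[OF m] show thesis by blast
qed

lemma direct_sumE:
  assumes "is_direct_sum C X Y S"
  obtains i j p q where "i \<in> hom C X S" "j \<in> hom C Y S" "p \<in> hom C S X" "q \<in> hom C S Y"
    "p \<cdot> i = ident C X" "q \<cdot> j = ident C Y" "p \<cdot> j = zero_mor C Y X" "q \<cdot> i = zero_mor C X Y"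
    "(i \<cdot> p) \<oplus> (j \<cdot> q) = ident C S"
  using assms unfolding is_direct_sum_def by blast

text \<open>The pullback is realized as the kernel of the difference \<open>d\<close> on a direct
  sum of \<open>W\<close> and \<open>X'\<close>. As \<open>d\<close> restricts to \<open>e\<close>
  on the summand \<open>W\<close>, it is epi and hence the cokernel of \<open>k\<close>; this makes
  \<open>e'\<close> epi.\<close>

lemma pullback_epi:
  assumes e: "e \<in> hom C W X" "is_epi C e" and i: "i \<in> hom C X' X" "is_mono C i"
  obtains W' e' i' where "e' \<in> hom C W' X'" "is_epi C e'" "i' \<in> hom C W' W" "is_mono C i'"
    "e \<cdot> i' = i \<cdot> e'"
proof -
  have o: "W \<in> obj C" "X' \<in> obj C" "X \<in> obj C" using e(1) i(1) hom_obj by auto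
  obtain S where S: "is_direct_sum C W X' S" using direct_sum o by blast
  obtain i1 j1 p q where s: "i1 \<in> hom C W S" "j1 \<in> hom C X' S" "p \<in> hom C S W" "q \<in> hom C S X'"
    "p \<cdot> i1 = ident C W" "q \<cdot> j1 = ident C X'" "p \<cdot> j1 = zero_mor C X' W" "q \<cdot> i1 = zero_mor C W X'"
    "(i1 \<cdot> p) \<oplus> (j1 \<cdot> q) = ident C S"
    using S by (rule direct_sumE)
  note ss = s(1-4)[THEN homD(1)] s(1-4)[THEN homD(2)] s(1-4)[THEN homD(3)]
    homD[OF e(1)] homD[OF i(1)]
  have ep: "e \<cdot> p \<in> hom C S X" and iq: "i \<cdot> q \<in> hom C S X"
    using cmp_hom s e(1) i(1) by blast+
  define d where "d = e \<cdot> p \<ominus> i \<cdot> q"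
  have d: "d \<in> hom C S X" unfolding d_def using diff_hom[OF ep iq] .
  have di: "d \<cdot> i1 = e"
  proof -
    have "d \<cdot> i1 = (e \<cdot> p) \<cdot> i1 \<ominus> (i \<cdot> q) \<cdot> i1"
      unfolding d_def using cmp_diff_left[OF s(1) ep iq] .
    also have "\<dots> = e \<ominus> zero_mor C W X" using s ss o by simp
    also have "\<dots> = e"
      using scale_zero[OF zero_hom[OF o(1,3)]] add_zero[OF e(1)]
        cmp_scale_left scale_scale[OF zero_hom[OF o(1,3)], of "-1" 0] by (simp add: diff_def)
    finally show ?thesis .
  qed
  have "is_epi C d" using epi_cancel[OF _ s(1) d] di e(2) by simp
  obtain k where k: "is_kernel C d k" using kernel homD(1)[OF d] by blast
  have cok: "is_cokernel C k d" by (rule epi_is_cokernel[OF \<open>is_epi C d\<close> k])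
  note k' = kernelD[OF k] note dd = homD[OF d]
  define W' where "W' = src C k"
  have kh: "k \<in> hom C W' S" using k' dd by (simp add: hom_def W'_def)
  note kk = homD[OF kh]
  define i' e' where "i' = p \<cdot> k" and "e' = q \<cdot> k"
  have i': "i' \<in> hom C W' W" and e': "e' \<in> hom C W' X'"
    unfolding i'_def e'_def using cmp_hom kh s by blast+
  have comm: "e \<cdot> i' = i \<cdot> e'"
  proof -
    have "(e \<cdot> p) \<cdot> k \<ominus> (i \<cdot> q) \<cdot> k = zero_mor C W' X"
      using cmp_diff_left[OF kh ep iq] k'(4) dd by (simp add: d_def W'_def)
    then have "(e \<cdot> p) \<cdot> k = (i \<cdot> q) \<cdot> k"
      using diff_eq_zero_iff cmp_hom[OF kh ep] cmp_hom[OF kh iq] by blast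
    then show ?thesis using ss kk by (simp add: i'_def e'_def)
  qed
  have "is_epi C e'"
  proof (rule is_epiI[OF e'])
    fix Z t assume t: "t \<in> hom C X' Z" "t \<cdot> e' = zero_mor C W' Z"
    note tt = homD[OF t(1)]
    have Z: "Z \<in> obj C" using hom_obj t by blast
    \<comment> \<open>\<open>t \<cdot> q\<close> vanishes on the kernel of \<open>d\<close>, hence
      descends along \<open>d\<close> to some \<open>r\<close>. On the summand \<open>W\<close> this
      reads \<open>r \<cdot> e = 0\<close>, which forces \<open>r\<close> and then \<open>t\<close>
      to vanish.\<close>
    have tq: "t \<cdot> q \<in> hom C (tgt C k) Z" using cmp_hom[OF s(4) t(1)] kk by simp
    have "(t \<cdot> q) \<cdot> k = zero_mor C (src C k) Z" using t(2) tt ss kk by (simp add: e'_def)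
    from cokernel_factor[OF cok tq this] obtain r where r: "r \<in> hom C X Z" "r \<cdot> d = t \<cdot> q"
      using dd by metis
    note rr = homD[OF r(1)]
    have "r \<cdot> e = (r \<cdot> d) \<cdot> i1" using di rr dd ss by simp
    also have "\<dots> = zero_mor C W Z" unfolding r(2) using tt ss s o Z by simp
    finally have "r = zero_mor C X Z" using epi_zero[OF e(2)] r(1) ss by simp
    then have "t \<cdot> q = zero_mor C S Z" using r(2) dd Z by simp
    then have "(t \<cdot> q) \<cdot> j1 = zero_mor C X' Z" using ss Z by simp
    then show "t = zero_mor C X' Z" using tt ss s by simp
  qed
  moreover have "is_mono C i'"
  proof (rule is_monoI[OF i'])
    fix Z t assume t: "t \<in> hom C Z W'" "i' \<cdot> t = zero_mor C Z W"
    note tt = homD[OF t(1)]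
    have Z: "Z \<in> obj C" using hom_obj t by blast
    note i'' = homD[OF i'] and e'' = homD[OF e']
    have "i \<cdot> (e' \<cdot> t) = (e \<cdot> i') \<cdot> t" unfolding comm using tt e'' ss by simp
    also have "\<dots> = zero_mor C Z X" using tt i'' ss t(2) Z by simp
    finally have e0: "e' \<cdot> t = zero_mor C Z X'"
      using mono_zero[OF i(2)] cmp_hom[OF t(1) e'] ss by simp
    have "k \<cdot> t = ((i1 \<cdot> p) \<oplus> (j1 \<cdot> q)) \<cdot> (k \<cdot> t)" unfolding s(9) using tt kk by simp
    also have "\<dots> = (i1 \<cdot> p) \<cdot> (k \<cdot> t) \<oplus> (j1 \<cdot> q) \<cdot> (k \<cdot> t)"
      using cmp_add_left[OF cmp_hom[OF t(1) kh] cmp_hom[OF s(3,1)] cmp_hom[OF s(4,2)]] .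
    also have "\<dots> = i1 \<cdot> (i' \<cdot> t) \<oplus> j1 \<cdot> (e' \<cdot> t)"
      using tt kk ss by (simp add: i'_def e'_def)
    also have "\<dots> = zero_mor C Z S"
      unfolding t(2) e0 using ss Z o add_zero[OF zero_hom] hom_obj[OF s(1)] by simp
    finally show "t = zero_mor C Z W'"
      using mono_zero[OF kernel_mono[OF k]] t(1) kk by simp
  qed
  ultimately show thesis using that e' i' comm by blast
qed

end

section \<open>Tensoring with a dualizable object\<close>

text \<open>
  Only naturality and the pentagon are used, and the zigzag composites are only required to be
  invertible.  This makes the hypotheses symmetric under reversal of the tensor product and lets
  strong monoidal functors preserve them without any unit coherence.
\<close>

locale semigroupal_category = category C
  for C :: "('o, 'm, 'z) cat_scheme" (structure) +
  fixes T :: "'o \<Rightarrow> 'o \<Rightarrow> 'o" (infixl "\<boxtimes>" 75)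
    and M :: "'m \<Rightarrow> 'm \<Rightarrow> 'm" (infixl "\<boxdot>" 75)
    and A A' :: "'o \<Rightarrow> 'o \<Rightarrow> 'o \<Rightarrow> 'm"
    and I :: 'o and l :: "'o \<Rightarrow> 'm"
  assumes T_obj [simp]: "X \<in> obj C \<Longrightarrow> Y \<in> obj C \<Longrightarrow> X \<boxtimes> Y \<in> obj C"
    and M_hom: "f \<in> hom C X X' \<Longrightarrow> g \<in> hom C Y Y' \<Longrightarrow> f \<boxdot> g \<in> hom C (X \<boxtimes> Y) (X' \<boxtimes> Y')"
    and M_ident [simp]: "X \<in> obj C \<Longrightarrow> Y \<in> obj C \<Longrightarrow> ident C X \<boxdot> ident C Y = ident C (X \<boxtimes> Y)"
    and M_cmp: "f \<in> hom C X X' \<Longrightarrow> f' \<in> hom C X' X'' \<Longrightarrow> g \<in> hom C Y Y' \<Longrightarrow> g' \<in> hom C Y' Y'' \<Longrightarrow>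
      (f' \<cdot> f) \<boxdot> (g' \<cdot> g) = (f' \<boxdot> g') \<cdot> (f \<boxdot> g)"
    and A_inverse: "X \<in> obj C \<Longrightarrow> Y \<in> obj C \<Longrightarrow> Z \<in> obj C \<Longrightarrow> inverse_of C (A X Y Z) (A' X Y Z)"
    and A_hom: "X \<in> obj C \<Longrightarrow> Y \<in> obj C \<Longrightarrow> Z \<in> obj C \<Longrightarrow>
      A X Y Z \<in> hom C (X \<boxtimes> Y \<boxtimes> Z) (X \<boxtimes> (Y \<boxtimes> Z))"
    and A_natural: "f \<in> hom C X X' \<Longrightarrow> g \<in> hom C Y Y' \<Longrightarrow> h \<in> hom C Z Z' \<Longrightarrow>
      A X' Y' Z' \<cdot> (f \<boxdot> g \<boxdot> h) = (f \<boxdot> (g \<boxdot> h)) \<cdot> A X Y Z"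
    and A_pentagon: "W \<in> obj C \<Longrightarrow> X \<in> obj C \<Longrightarrow> Y \<in> obj C \<Longrightarrow> Z \<in> obj C \<Longrightarrow>
      A W X (Y \<boxtimes> Z) \<cdot> A (W \<boxtimes> X) Y Z =
      (ident C W \<boxdot> A X Y Z) \<cdot> A W (X \<boxtimes> Y) Z \<cdot> (A W X Y \<boxdot> ident C Z)"
    and I_obj [simp]: "I \<in> obj C"
    and l_hom: "X \<in> obj C \<Longrightarrow> l X \<in> hom C (I \<boxtimes> X) X"
    and l_iso [simp]: "X \<in> obj C \<Longrightarrow> is_iso C (l X)"
    and l_natural: "f \<in> hom C X X' \<Longrightarrow> l X' \<cdot> (ident C I \<boxdot> f) = f \<cdot> l X"
begin

lemma M_mor [simp]:
  assumes "f \<in> mor C" "g \<in> mor C"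
  shows "f \<boxdot> g \<in> mor C" "src C (f \<boxdot> g) = src C f \<boxtimes> src C g" "tgt C (f \<boxdot> g) = tgt C f \<boxtimes> tgt C g"
  using M_hom[of f "src C f" "tgt C f" g "src C g" "tgt C g"] assms by (auto simp: hom_def)

lemma A_mor [simp]:
  assumes "X \<in> obj C" "Y \<in> obj C" "Z \<in> obj C"
  shows "A X Y Z \<in> mor C" "src C (A X Y Z) = X \<boxtimes> Y \<boxtimes> Z" "tgt C (A X Y Z) = X \<boxtimes> (Y \<boxtimes> Z)"
    "A' X Y Z \<in> mor C" "src C (A' X Y Z) = X \<boxtimes> (Y \<boxtimes> Z)" "tgt C (A' X Y Z) = X \<boxtimes> Y \<boxtimes> Z"
    "A' X Y Z \<cdot> A X Y Z = ident C (X \<boxtimes> Y \<boxtimes> Z)" "A X Y Z \<cdot> A' X Y Z = ident C (X \<boxtimes> (Y \<boxtimes> Z))"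
    "is_iso C (A X Y Z)" "is_iso C (A' X Y Z)"
  using A_hom[OF assms] A_inverse[OF assms] inverse_of_sym[OF A_inverse[OF assms]]
  by (auto simp: hom_def inverse_of_def is_iso_def)

lemma A_cancel [simp]:
  assumes "X \<in> obj C" "Y \<in> obj C" "Z \<in> obj C" "x \<in> mor C"
  shows "tgt C x = X \<boxtimes> Y \<boxtimes> Z \<Longrightarrow> A' X Y Z \<cdot> (A X Y Z \<cdot> x) = x"
    "tgt C x = X \<boxtimes> (Y \<boxtimes> Z) \<Longrightarrow> A X Y Z \<cdot> (A' X Y Z \<cdot> x) = x"
  using assms by (auto simp flip: cmp_assoc_mor)

lemma l_mor [simp]:
  assumes "X \<in> obj C"
  shows "l X \<in> mor C" "src C (l X) = I \<boxtimes> X" "tgt C (l X) = X"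
  using l_hom[OF assms] by (auto simp: hom_def)

lemma M_cmp_mor:
  assumes "f \<in> mor C" "f' \<in> mor C" "g \<in> mor C" "g' \<in> mor C" "tgt C f = src C f'" "tgt C g = src C g'"
  shows "(f' \<boxdot> g') \<cdot> (f \<boxdot> g) = (f' \<cdot> f) \<boxdot> (g' \<cdot> g)"
  using M_cmp[of f "src C f" "tgt C f" f' "tgt C f'" g "src C g" "tgt C g" g' "tgt C g'"] assms
  by (auto simp: hom_def)

lemma M_cmp_mor':
  assumes "f \<in> mor C" "f' \<in> mor C" "g \<in> mor C" "g' \<in> mor C" "tgt C f = src C f'" "tgt C g = src C g'"
    "x \<in> mor C" "tgt C x = src C f \<boxtimes> src C g"
  shows "(f' \<boxdot> g') \<cdot> ((f \<boxdot> g) \<cdot> x) = ((f' \<cdot> f) \<boxdot> (g' \<cdot> g)) \<cdot> x"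
proof -
  have "(f' \<boxdot> g') \<cdot> ((f \<boxdot> g) \<cdot> x) = ((f' \<boxdot> g') \<cdot> (f \<boxdot> g)) \<cdot> x" using assms by simp
  then show ?thesis using M_cmp_mor[OF assms(1-6)] by simp
qed

lemma is_iso_M [simp]:
  assumes "is_iso C f" "is_iso C g"
  shows "is_iso C (f \<boxdot> g)"
  using is_iso_mor[OF assms(1)] is_iso_mor[OF assms(2)] assms
  by (intro is_isoI[of _ "src C f \<boxtimes> src C g" "tgt C f \<boxtimes> tgt C g" "inverse_mor C f \<boxdot> inverse_mor C g"])
    (auto simp: hom_def M_cmp_mor)

text \<open>Naturality of the associator, solved for the right-nested product so that it can be
  substituted inside a composite.\<close>

lemma M_assoc_left:
  assumes "f \<in> mor C" "g \<in> mor C" "h \<in> mor C"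
  shows "f \<boxdot> (g \<boxdot> h) = A (tgt C f) (tgt C g) (tgt C h) \<cdot> ((f \<boxdot> g \<boxdot> h) \<cdot> A' (src C f) (src C g) (src C h))"
proof -
  have "A (tgt C f) (tgt C g) (tgt C h) \<cdot> ((f \<boxdot> g \<boxdot> h) \<cdot> A' (src C f) (src C g) (src C h)) =
      (A (tgt C f) (tgt C g) (tgt C h) \<cdot> (f \<boxdot> g \<boxdot> h)) \<cdot> A' (src C f) (src C g) (src C h)"
    using assms by simp
  also have "\<dots> = ((f \<boxdot> (g \<boxdot> h)) \<cdot> A (src C f) (src C g) (src C h)) \<cdot> A' (src C f) (src C g) (src C h)"
    using A_natural[of f "src C f" "tgt C f" g "src C g" "tgt C g" h "src C h" "tgt C h"] assms
    by (simp add: hom_def)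
  also have "\<dots> = f \<boxdot> (g \<boxdot> h)" using assms by simp
  finally show ?thesis ..
qed

text \<open>The pentagon solved for the string of four associators that stands between evaluation
  and coevaluation in the step \<open>mid\<close> of \<open>tensor_adjunction\<close>;
  \<open>pentagon_middle'\<close> is its counterpart for \<open>mid'\<close>.\<close>

lemma pentagon_middle:
  assumes o: "W \<in> obj C" "X \<in> obj C" "Y \<in> obj C" "Z \<in> obj C"
  shows "A' (W \<boxtimes> X) Y Z \<cdot> (A' W X (Y \<boxtimes> Z) \<cdot> ((ident C W \<boxdot> A X Y Z) \<cdot> A W (X \<boxtimes> Y) Z)) = A' W X Y \<boxdot> ident C Z"
proof -
  let ?B = "(ident C W \<boxdot> A X Y Z) \<cdot> A W (X \<boxtimes> Y) Z"
  have "?B = (?B \<cdot> (A W X Y \<boxdot> ident C Z)) \<cdot> (A' W X Y \<boxdot> ident C Z)"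
    using o by (simp add: M_cmp_mor)
  also have "\<dots> = (A W X (Y \<boxtimes> Z) \<cdot> A (W \<boxtimes> X) Y Z) \<cdot> (A' W X Y \<boxdot> ident C Z)"
    using A_pentagon[OF o] by simp
  finally have "?B = A W X (Y \<boxtimes> Z) \<cdot> (A (W \<boxtimes> X) Y Z \<cdot> (A' W X Y \<boxdot> ident C Z))" using o by simp
  then show ?thesis using o by simp
qed

lemma pentagon_middle':
  assumes o: "W \<in> obj C" "X \<in> obj C" "Y \<in> obj C" "Z \<in> obj C"
  shows "A' W (X \<boxtimes> Y) Z \<cdot> ((ident C W \<boxdot> A' X Y Z) \<cdot> (A W X (Y \<boxtimes> Z) \<cdot> A (W \<boxtimes> X) Y Z)) = A W X Y \<boxdot> ident C Z"
proof -
  have "A W X (Y \<boxtimes> Z) \<cdot> A (W \<boxtimes> X) Y Z =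
      (ident C W \<boxdot> A X Y Z) \<cdot> (A W (X \<boxtimes> Y) Z \<cdot> (A W X Y \<boxdot> ident C Z))"
    using A_pentagon[OF o] o by simp
  then show ?thesis using o by (simp add: M_cmp_mor')
qed

text \<open>Applies an equation for a composite of four morphisms in front of a further factor
  \<open>x\<close>, where nesting to the right has hidden that composite.\<close>

lemma reassoc4:
  assumes "a \<in> mor C" "b \<in> mor C" "c \<in> mor C" "d \<in> mor C" "x \<in> mor C"
    "tgt C b = src C a" "tgt C c = src C b" "tgt C d = src C c" "tgt C x = src C d"
    "a \<cdot> (b \<cdot> (c \<cdot> d)) = y"
  shows "a \<cdot> (b \<cdot> (c \<cdot> (d \<cdot> x))) = y \<cdot> x"
  using assms by auto

definition weakly_dual :: "'o \<Rightarrow> 'o \<Rightarrow> 'm \<Rightarrow> 'm \<Rightarrow> bool" where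
  "weakly_dual Y X ev coev \<longleftrightarrow> X \<in> obj C \<and> Y \<in> obj C \<and> ev \<in> hom C (Y \<boxtimes> X) I \<and> coev \<in> hom C I (X \<boxtimes> Y) \<and>
     is_iso C ((ident C X \<boxdot> ev) \<cdot> (A X Y X \<cdot> (coev \<boxdot> ident C X))) \<and>
     is_iso C ((ev \<boxdot> ident C Y) \<cdot> (A' Y X Y \<cdot> (ident C Y \<boxdot> coev)))"

text \<open>\<open>\<Phi>\<close> and \<open>\<Psi>\<close> are the usual transpositions built from
  coevaluation and evaluation. As the zigzags are only invertible, the round trips give
  \<open>g \<cdot> \<theta> U\<close> and \<open>\<theta>' Z \<cdot> h\<close>, with automorphisms
  \<open>\<theta>\<close> and \<open>\<theta>'\<close> that contain the zigzags; this suffices for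
  \<open>\<Phi>\<close> to be bijective.\<close>

lemma tensor_adjunction:
  assumes "weakly_dual Y X ev coev"
  shows "\<exists>\<Phi>. adjunction C (\<lambda>U. Y \<boxtimes> U) (\<lambda>Z. X \<boxtimes> Z) (\<lambda>f. ident C Y \<boxdot> f) (\<lambda>f. ident C X \<boxdot> f) \<Phi>"
proof -
  define z1 z2 where "z1 = (ident C X \<boxdot> ev) \<cdot> (A X Y X \<cdot> (coev \<boxdot> ident C X))"
    and "z2 = (ev \<boxdot> ident C Y) \<cdot> (A' Y X Y \<cdot> (ident C Y \<boxdot> coev))"
  have o [simp]: "X \<in> obj C" "Y \<in> obj C"
    and ev [simp]: "ev \<in> mor C" "src C ev = Y \<boxtimes> X" "tgt C ev = I"
    and coev [simp]: "coev \<in> mor C" "src C coev = I" "tgt C coev = X \<boxtimes> Y"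
    and z_iso [simp]: "is_iso C z1" "is_iso C z2"
    using assms by (auto simp: weakly_dual_def hom_def z1_def z2_def)
  have z [simp]: "z1 \<in> mor C" "src C z1 = I \<boxtimes> X" "tgt C z1 = X \<boxtimes> I"
    "z2 \<in> mor C" "src C z2 = Y \<boxtimes> I" "tgt C z2 = I \<boxtimes> Y"
    unfolding z1_def z2_def by simp_all
  define \<Phi> where "\<Phi> U Z g = (ident C X \<boxdot> g) \<cdot> (A X Y U \<cdot> ((coev \<boxdot> ident C U) \<cdot> inverse_mor C (l U)))" for U Z :: 'o and g
  define \<Psi> where "\<Psi> Z h = l Z \<cdot> ((ev \<boxdot> ident C Z) \<cdot> (A' Y X Z \<cdot> (ident C Y \<boxdot> h)))" for Z h
  define \<theta> where "\<theta> U = l (Y \<boxtimes> U) \<cdot> (A I Y U \<cdot> ((z2 \<boxdot> ident C U) \<cdot> (A' Y I U \<cdot> (ident C Y \<boxdot> inverse_mor C (l U)))))" for U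
  define \<theta>' where "\<theta>' Z = (ident C X \<boxdot> l Z) \<cdot> (A X I Z \<cdot> ((z1 \<boxdot> ident C Z) \<cdot> (A' I X Z \<cdot> inverse_mor C (l (X \<boxtimes> Z)))))" for Z
  have \<Phi>_hom: "\<Phi> U Z g \<in> hom C U (X \<boxtimes> Z)" if "U \<in> obj C" "g \<in> hom C (Y \<boxtimes> U) Z" for U Z g
    using that unfolding \<Phi>_def by (auto simp: hom_def)
  have \<Psi>_hom: "\<Psi> Z h \<in> hom C (Y \<boxtimes> U) Z" if "Z \<in> obj C" "h \<in> hom C U (X \<boxtimes> Z)" for U Z h
    using that unfolding \<Psi>_def by (auto simp: hom_def)
  have \<theta>: "is_iso C (\<theta> U)" "\<theta> U \<in> hom C (Y \<boxtimes> U) (Y \<boxtimes> U)" if "U \<in> obj C" for U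
    unfolding \<theta>_def using that by (simp_all add: hom_def)
  have \<theta>': "is_iso C (\<theta>' Z)" "\<theta>' Z \<in> hom C (X \<boxtimes> Z) (X \<boxtimes> Z)" if "Z \<in> obj C" for Z
    unfolding \<theta>'_def using that by (simp_all add: hom_def)
  have linv_nat: "(ident C I \<boxdot> h) \<cdot> inverse_mor C (l U) = inverse_mor C (l V) \<cdot> h" if "h \<in> hom C U V" for h U V
  proof -
    have h: "h \<in> mor C" "src C h = U" "tgt C h = V" using that by (auto simp: hom_def)
    have o: "U \<in> obj C" "V \<in> obj C" using hom_obj that by auto
    have "(ident C I \<boxdot> h) \<cdot> inverse_mor C (l U) =
        inverse_mor C (l V) \<cdot> ((l V \<cdot> (ident C I \<boxdot> h)) \<cdot> inverse_mor C (l U))"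
      using h o by simp
    also have "\<dots> = inverse_mor C (l V) \<cdot> h"
      unfolding l_natural[OF that] using h o by simp
    finally show ?thesis .
  qed
  \<comment> \<open>The snake with a spectator \<open>U\<close>: \<open>1\<close> and
    \<open>2\<close> rebracket so that coevaluation and evaluation act inside left-nested products,
    and \<open>3\<close> collapses the associators between them, which leaves the zigzag
    \<open>z2\<close> tensored with \<open>U\<close>.\<close>
  have mid: "(ev \<boxdot> ident C (Y \<boxtimes> U)) \<cdot> (A' Y X (Y \<boxtimes> U) \<cdot> ((ident C Y \<boxdot> A X Y U) \<cdot> ((ident C Y \<boxdot> (coev \<boxdot> ident C U)) \<cdot> x))) =
      A I Y U \<cdot> ((z2 \<boxdot> ident C U) \<cdot> (A' Y I U \<cdot> x))"
    if U: "U \<in> obj C" and x: "x \<in> mor C" "tgt C x = Y \<boxtimes> (I \<boxtimes> U)" for U x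
  proof -
    have 1: "ident C Y \<boxdot> (coev \<boxdot> ident C U) = A Y (X \<boxtimes> Y) U \<cdot> ((ident C Y \<boxdot> coev \<boxdot> ident C U) \<cdot> A' Y I U)"
      using M_assoc_left[of "ident C Y" coev "ident C U"] U by simp
    have 2: "ev \<boxdot> ident C (Y \<boxtimes> U) = A I Y U \<cdot> ((ev \<boxdot> ident C Y \<boxdot> ident C U) \<cdot> A' (Y \<boxtimes> X) Y U)"
      using M_assoc_left[of ev "ident C Y" "ident C U"] U by simp
    have 3: "A' (Y \<boxtimes> X) Y U \<cdot> (A' Y X (Y \<boxtimes> U) \<cdot> ((ident C Y \<boxdot> A X Y U) \<cdot> (A Y (X \<boxtimes> Y) U \<cdot> w))) =
        (A' Y X Y \<boxdot> ident C U) \<cdot> w" if "w \<in> mor C" "tgt C w = Y \<boxtimes> (X \<boxtimes> Y) \<boxtimes> U" for w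
      using that U by (intro reassoc4 pentagon_middle) auto
    show ?thesis
      unfolding 1 2 z2_def using U x by (simp add: 3 M_cmp_mor')
  qed
  have mid': "(ident C X \<boxdot> (ev \<boxdot> ident C Z)) \<cdot> ((ident C X \<boxdot> A' Y X Z) \<cdot> (A X Y (X \<boxtimes> Z) \<cdot> ((coev \<boxdot> ident C (X \<boxtimes> Z)) \<cdot> x))) =
      A X I Z \<cdot> ((z1 \<boxdot> ident C Z) \<cdot> (A' I X Z \<cdot> x))"
    if Z: "Z \<in> obj C" and x: "x \<in> mor C" "tgt C x = I \<boxtimes> (X \<boxtimes> Z)" for Z x
  proof -
    have 1: "ident C X \<boxdot> (ev \<boxdot> ident C Z) = A X I Z \<cdot> ((ident C X \<boxdot> ev \<boxdot> ident C Z) \<cdot> A' X (Y \<boxtimes> X) Z)"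
      using M_assoc_left[of "ident C X" ev "ident C Z"] Z by simp
    have 2: "coev \<boxdot> ident C (X \<boxtimes> Z) = A (X \<boxtimes> Y) X Z \<cdot> ((coev \<boxdot> ident C X \<boxdot> ident C Z) \<cdot> A' I X Z)"
      using M_assoc_left[of coev "ident C X" "ident C Z"] Z by simp
    have 3: "A' X (Y \<boxtimes> X) Z \<cdot> ((ident C X \<boxdot> A' Y X Z) \<cdot> (A X Y (X \<boxtimes> Z) \<cdot> (A (X \<boxtimes> Y) X Z \<cdot> w))) =
        (A X Y X \<boxdot> ident C Z) \<cdot> w" if "w \<in> mor C" "tgt C w = X \<boxtimes> Y \<boxtimes> X \<boxtimes> Z" for w
      using that Z by (intro reassoc4 pentagon_middle') auto
    show ?thesis
      unfolding 1 2 z1_def using Z x by (simp add: 3 M_cmp_mor')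
  qed
  have \<Psi>\<Phi>: "\<Psi> Z (\<Phi> U Z g) = g \<cdot> \<theta> U" if U: "U \<in> obj C" and g: "g \<in> hom C (Y \<boxtimes> U) Z" for U Z g
  proof -
    note gg = homD[OF g] and Z = hom_obj(2)[OF g]
    define c where "c = (ident C Y \<boxdot> A X Y U) \<cdot> ((ident C Y \<boxdot> (coev \<boxdot> ident C U)) \<cdot> (ident C Y \<boxdot> inverse_mor C (l U)))"
    have c: "c \<in> mor C" "tgt C c = Y \<boxtimes> (X \<boxtimes> (Y \<boxtimes> U))" unfolding c_def using U by simp_all
    have "ident C Y \<boxdot> \<Phi> U Z g = (ident C Y \<boxdot> (ident C X \<boxdot> g)) \<cdot> c"
      unfolding \<Phi>_def c_def using U gg by (simp add: M_cmp_mor M_cmp_mor')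
    also have "\<dots> = A Y X Z \<cdot> ((ident C (Y \<boxtimes> X) \<boxdot> g) \<cdot> (A' Y X (Y \<boxtimes> U) \<cdot> c))"
      using M_assoc_left[of "ident C Y" "ident C X" g] U gg Z c by simp
    finally have "\<Psi> Z (\<Phi> U Z g) = l Z \<cdot> ((ev \<boxdot> ident C Z) \<cdot> ((ident C (Y \<boxtimes> X) \<boxdot> g) \<cdot> (A' Y X (Y \<boxtimes> U) \<cdot> c)))"
      unfolding \<Psi>_def using U gg Z c by simp
    also have "\<dots> = l Z \<cdot> ((ident C I \<boxdot> g) \<cdot> ((ev \<boxdot> ident C (Y \<boxtimes> U)) \<cdot> (A' Y X (Y \<boxtimes> U) \<cdot> c)))"
      using U gg Z c by (simp add: M_cmp_mor')
    also have "\<dots> = (l Z \<cdot> (ident C I \<boxdot> g)) \<cdot> ((ev \<boxdot> ident C (Y \<boxtimes> U)) \<cdot> (A' Y X (Y \<boxtimes> U) \<cdot> c))"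
      using U gg Z c by simp
    also have "\<dots> = g \<cdot> (l (Y \<boxtimes> U) \<cdot> ((ev \<boxdot> ident C (Y \<boxtimes> U)) \<cdot> (A' Y X (Y \<boxtimes> U) \<cdot> c)))"
      unfolding l_natural[OF g] using U gg Z c by simp
    also have "\<dots> = g \<cdot> \<theta> U"
      unfolding c_def \<theta>_def using U by (simp add: mid)
    finally show ?thesis .
  qed
  have \<Phi>\<Psi>: "\<Phi> U Z (\<Psi> Z h) = \<theta>' Z \<cdot> h" if Z: "Z \<in> obj C" and h: "h \<in> hom C U (X \<boxtimes> Z)" for U Z h
  proof -
    note hh = homD[OF h] and U = hom_obj(1)[OF h]
    define c where "c = (ident C X \<boxdot> l Z)"
    have c: "c \<in> mor C" "src C c = X \<boxtimes> (I \<boxtimes> Z)" "tgt C c = X \<boxtimes> Z" unfolding c_def using Z by simp_all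
    have "\<Phi> U Z (\<Psi> Z h) = c \<cdot> ((ident C X \<boxdot> (ev \<boxdot> ident C Z)) \<cdot> ((ident C X \<boxdot> A' Y X Z) \<cdot>
        ((ident C X \<boxdot> (ident C Y \<boxdot> h)) \<cdot> (A X Y U \<cdot> ((coev \<boxdot> ident C U) \<cdot> inverse_mor C (l U))))))"
      unfolding \<Phi>_def \<Psi>_def c_def using U hh Z by (simp add: M_cmp_mor M_cmp_mor')
    also have "(ident C X \<boxdot> (ident C Y \<boxdot> h)) \<cdot> (A X Y U \<cdot> ((coev \<boxdot> ident C U) \<cdot> inverse_mor C (l U))) =
        A X Y (X \<boxtimes> Z) \<cdot> ((ident C (X \<boxtimes> Y) \<boxdot> h) \<cdot> ((coev \<boxdot> ident C U) \<cdot> inverse_mor C (l U)))"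
      using M_assoc_left[of "ident C X" "ident C Y" h] U hh Z by simp
    also have "\<dots> = A X Y (X \<boxtimes> Z) \<cdot> ((coev \<boxdot> ident C (X \<boxtimes> Z)) \<cdot> ((ident C I \<boxdot> h) \<cdot> inverse_mor C (l U)))"
      using U hh Z by (simp add: M_cmp_mor')
    also have "(ident C I \<boxdot> h) \<cdot> inverse_mor C (l U) = inverse_mor C (l (X \<boxtimes> Z)) \<cdot> h"
      by (rule linv_nat[OF h])
    also have "c \<cdot> ((ident C X \<boxdot> (ev \<boxdot> ident C Z)) \<cdot> ((ident C X \<boxdot> A' Y X Z) \<cdot>
        (A X Y (X \<boxtimes> Z) \<cdot> ((coev \<boxdot> ident C (X \<boxtimes> Z)) \<cdot> (inverse_mor C (l (X \<boxtimes> Z)) \<cdot> h))))) =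
        c \<cdot> (A X I Z \<cdot> ((z1 \<boxdot> ident C Z) \<cdot> (A' I X Z \<cdot> (inverse_mor C (l (X \<boxtimes> Z)) \<cdot> h))))"
      using U hh Z by (subst mid') simp_all
    also have "\<dots> = \<theta>' Z \<cdot> h" unfolding c_def \<theta>'_def using U hh Z by simp
    finally show ?thesis .
  qed
  have "adjunction C (\<lambda>U. Y \<boxtimes> U) (\<lambda>Z. X \<boxtimes> Z) (\<lambda>f. ident C Y \<boxdot> f) (\<lambda>f. ident C X \<boxdot> f) \<Phi>"
  proof (intro adjunction.intro category_axioms adjunction_axioms.intro)
    fix U Z assume U: "U \<in> obj C" and Z: "Z \<in> obj C"
    show "bij_betw (\<Phi> U Z) (hom C (Y \<boxtimes> U) Z) (hom C U (X \<boxtimes> Z))"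
      unfolding bij_betw_def
    proof
      show "inj_on (\<Phi> U Z) (hom C (Y \<boxtimes> U) Z)"
      proof (rule inj_onI)
        fix g h assume g: "g \<in> hom C (Y \<boxtimes> U) Z" and h: "h \<in> hom C (Y \<boxtimes> U) Z" and eq: "\<Phi> U Z g = \<Phi> U Z h"
        have "g \<cdot> \<theta> U = h \<cdot> \<theta> U" using \<Psi>\<Phi>[OF U g] \<Psi>\<Phi>[OF U h] eq by simp
        with iso_epi[OF \<theta>(1)[OF U]] show "g = h"
          using is_epiD[of "\<theta> U" g Z h] g h homD[OF \<theta>(2)[OF U]] by simp
      qed
      show "\<Phi> U Z ` hom C (Y \<boxtimes> U) Z = hom C U (X \<boxtimes> Z)"
      proof (intro equalityI subsetI)
        fix h assume h: "h \<in> hom C U (X \<boxtimes> Z)"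
        note hh = homD[OF h] and t = \<theta>'[OF Z] and tt = homD[OF \<theta>'(2)[OF Z]]
        define k where "k = inverse_mor C (\<theta>' Z) \<cdot> h"
        have k: "k \<in> hom C U (X \<boxtimes> Z)" unfolding k_def using hh tt t by (simp add: hom_def)
        have "\<Phi> U Z (\<Psi> Z k) = h" using \<Phi>\<Psi>[OF Z k] t tt hh by (simp add: k_def)
        then show "h \<in> \<Phi> U Z ` hom C (Y \<boxtimes> U) Z" using \<Psi>_hom[OF Z k] by force
      qed (use \<Phi>_hom U in auto)
    qed
  next
    fix U g Z k Z' assume U: "U \<in> obj C" and g: "g \<in> hom C (Y \<boxtimes> U) Z" and k: "k \<in> hom C Z Z'"
    show "\<Phi> U Z' (k \<cdot> g) = (ident C X \<boxdot> k) \<cdot> \<Phi> U Z g"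
      unfolding \<Phi>_def using U homD[OF g] homD[OF k] by (simp add: M_cmp_mor')
  next
    fix h U' U g Z assume h: "h \<in> hom C U' U" and g: "g \<in> hom C (Y \<boxtimes> U) Z"
    note hh = homD[OF h] and gg = homD[OF g] and U = hom_obj[OF h]
    have "\<Phi> U' Z (g \<cdot> (ident C Y \<boxdot> h)) =
        (ident C X \<boxdot> g) \<cdot> ((ident C X \<boxdot> (ident C Y \<boxdot> h)) \<cdot> (A X Y U' \<cdot> ((coev \<boxdot> ident C U') \<cdot> inverse_mor C (l U'))))"
      unfolding \<Phi>_def using hh gg U by (simp add: M_cmp_mor')
    also have "\<dots> = (ident C X \<boxdot> g) \<cdot> (A X Y U \<cdot> ((coev \<boxdot> ident C U) \<cdot> ((ident C I \<boxdot> h) \<cdot> inverse_mor C (l U'))))"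
      using M_assoc_left[of "ident C X" "ident C Y" h] hh gg U by (simp add: M_cmp_mor')
    also have "\<dots> = \<Phi> U Z g \<cdot> h"
      unfolding linv_nat[OF h] \<Phi>_def using hh gg U by simp
    finally show "\<Phi> U' Z (g \<cdot> (ident C Y \<boxdot> h)) = \<Phi> U Z g \<cdot> h" .
  qed (auto simp: hom_def)
  then show ?thesis by blast
qed

end

lemma (in linear_category) right_adjoint_kernel:
  assumes adj: "adjunction C L R Lm Rm \<Phi>" and ker: "is_kernel C f k"
    and R_zero: "\<And>X Y. X \<in> obj C \<Longrightarrow> Y \<in> obj C \<Longrightarrow> Rm (zero_mor C X Y) = zero_mor C (R X) (R Y)"
    and R_cmp: "Rm (f \<cdot> k) = Rm f \<cdot> Rm k"
  shows "is_kernel C (Rm f) (Rm k)"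
proof -
  interpret adjunction C L R Lm Rm \<Phi> by fact
  note k = kernelD[OF ker]
  have fh: "f \<in> hom C (src C f) (tgt C f)" using k by (simp add: hom_def)
  have kh: "k \<in> hom C (src C k) (src C f)" using k by (simp add: hom_def)
  note Rf = homD[OF R_hom[OF fh]] and Rk = homD[OF R_hom[OF kh]]
  show ?thesis unfolding is_kernel_def
  proof (intro conjI allI ballI impI)
    show "Rm f \<cdot> Rm k = zero_mor C (src C (Rm k)) (tgt C (Rm f))"
      using R_cmp[symmetric] k R_zero Rf Rk by simp
    fix W h assume h: "h \<in> hom C W (src C (Rm f))" "Rm f \<cdot> h = zero_mor C W (tgt C (Rm f))"
    have W: "W \<in> obj C" using h hom_obj by blast
    note LW = L_obj[OF W]
    have h1: "h \<in> hom C W (R (src C f))" using h Rf by simp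
    obtain h' where h': "h' \<in> hom C (L W) (src C f)" "\<Phi> W (src C f) h' = h"
      using transpose_surj[OF _ h1] k by auto
    have z: "zero_mor C (src C f) (tgt C f) \<in> hom C (src C f) (tgt C f)" using k zero_hom by simp
    \<comment> \<open>That only zero has the transpose zero is not part of the adjunction; it comes
      from writing zero as \<open>Rm\<close> of a zero morphism composed with \<open>h\<close> and
      transposing back.\<close>
    have "\<Phi> W (tgt C f) (f \<cdot> h') = zero_mor C W (R (tgt C f))"
      using transpose_right[OF W h'(1) fh] h' h Rf by simp
    also have "\<dots> = Rm (zero_mor C (src C f) (tgt C f)) \<cdot> h"
      using R_zero k homD[OF h1] R_obj by simp
    also have "\<dots> = \<Phi> W (tgt C f) (zero_mor C (src C f) (tgt C f) \<cdot> h')"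
      using transpose_right[OF W h'(1) z] h' by simp
    finally have "f \<cdot> h' = zero_mor C (src C f) (tgt C f) \<cdot> h'"
      using transpose_inj[OF W cmp_hom[OF h'(1) fh] cmp_hom[OF h'(1) z]] by simp
    then have "f \<cdot> h' = zero_mor C (L W) (tgt C f)" using homD[OF h'(1)] k by simp
    then obtain u where u: "u \<in> hom C (L W) (src C k)" "k \<cdot> u = h'"
      using kernel_factor[OF ker h'(1)] by blast
    have "Rm k \<cdot> \<Phi> W (src C k) u = h"
      using transpose_right[OF W u(1) kh] u h' by simp
    moreover have "\<Phi> W (src C k) u \<in> hom C W (src C (Rm k))"
      using transpose_hom[OF W u(1)] Rk by simp
    moreover have "is_mono C (Rm k)" using right_mono[OF kernel_mono[OF ker]] .
    ultimately show "\<exists>!u. u \<in> hom C W (src C (Rm k)) \<and> Rm k \<cdot> u = h"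
      using is_monoD[of "Rm k"] by blast
  qed (use Rf Rk in auto)
qed

section \<open>Left and right duals as adjoints of tensoring\<close>

context monoidal_category
begin

sublocale left: semigroupal_category C "\<lambda>X Y. X \<otimes> Y" "\<lambda>f g. f \<odot> g" "assoc C"
  "\<lambda>X Y Z. inverse_mor C (assoc C X Y Z)" "\<one>" "lunit C"
  by unfold_locales
    (auto intro: tensO_obj tensM_hom tensM_ident interchange inverse_of_inverse_mor assoc_iso
      assoc_hom assoc_natural pentagon unit_obj lunit_hom lunit_iso lunit_natural)

text \<open>The same category with the factors of the tensor product exchanged: associator and
  inverse associator trade places, and \<open>runit\<close> takes over from \<open>lunit\<close>.
  Results on tensoring from the left thus also hold for tensoring from the right.\<close>

sublocale right: semigroupal_category C "\<lambda>X Y. Y \<otimes> X" "\<lambda>f g. g \<odot> f"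
  "\<lambda>X Y Z. inverse_mor C (assoc C Z Y X)" "\<lambda>X Y Z. assoc C Z Y X" "\<one>" "runit C"
proof
  fix X Y Z assume "X \<in> obj C" "Y \<in> obj C" "Z \<in> obj C"
  then show "inverse_of C (inverse_mor C (assoc C Z Y X)) (assoc C Z Y X)"
    "inverse_mor C (assoc C Z Y X) \<in> hom C (Z \<otimes> (Y \<otimes> X)) (Z \<otimes> Y \<otimes> X)"
    using inverse_of_sym[OF inverse_of_inverse_mor[OF assoc_iso]] by (auto intro: homI)
next
  fix f X X' g Y Y' h Z Z'
  assume a: "f \<in> hom C X X'" "g \<in> hom C Y Y'" "h \<in> hom C Z Z'"
  note o = hom_obj[OF a(1)] hom_obj[OF a(2)] hom_obj[OF a(3)]
  show "inverse_mor C (assoc C Z' Y' X') \<cdot> (h \<odot> (g \<odot> f)) = h \<odot> g \<odot> f \<cdot> inverse_mor C (assoc C Z Y X)"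
    using left.M_assoc_left[of h g f] homD[OF a(1)] homD[OF a(2)] homD[OF a(3)] o by simp
next
  fix W X Y Z assume o: "W \<in> obj C" "X \<in> obj C" "Y \<in> obj C" "Z \<in> obj C"
  \<comment> \<open>The reversed pentagon equates the inverses of the two sides of the original
    one.\<close>
  define P Q where "P = assoc C Z Y (X \<otimes> W) \<cdot> assoc C (Z \<otimes> Y) X W"
    and "Q = inverse_mor C (assoc C (Z \<otimes> Y) X W) \<cdot> inverse_mor C (assoc C Z Y (X \<otimes> W))"
  have "Q = inverse_mor C P"
    by (rule sym, rule inverse_mor_eq) (use o in \<open>auto simp: inverse_of_def P_def Q_def hom_def\<close>)
  also have "\<dots> = (inverse_mor C (assoc C Z Y X) \<odot> ident C W) \<cdot> inverse_mor C (assoc C Z (Y \<otimes> X) W) \<cdot>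
      (ident C Z \<odot> inverse_mor C (assoc C Y X W))"
    by (rule inverse_mor_eq)
      (use o in \<open>auto simp: inverse_of_def P_def pentagon hom_def left.M_cmp_mor left.M_cmp_mor'\<close>)
  finally show "inverse_mor C (assoc C (Z \<otimes> Y) X W) \<cdot> inverse_mor C (assoc C Z Y (X \<otimes> W)) =
      (inverse_mor C (assoc C Z Y X) \<odot> ident C W) \<cdot> inverse_mor C (assoc C Z (Y \<otimes> X) W) \<cdot>
      (ident C Z \<odot> inverse_mor C (assoc C Y X W))" unfolding Q_def .
qed (auto intro: tensM_hom interchange runit_hom runit_iso runit_natural)

text \<open>Reversal exchanges left and right duals, with the same evaluation and coevaluation; the
  two zigzag conditions trade places.\<close>

lemma right_weakly_dual: "right.weakly_dual X Y ev coev \<longleftrightarrow> left.weakly_dual Y X ev coev"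
  unfolding left.weakly_dual_def right.weakly_dual_def by auto

text \<open>The triangle identities, solved for the zigzags, express these as composites of unit
  isomorphisms, which are invertible.\<close>

lemma dual_pair_weakly_dual:
  assumes "dual_pair C Y X"
  shows "\<exists>ev coev. left.weakly_dual Y X ev coev"
proof -
  have o [simp]: "X \<in> obj C" "Y \<in> obj C" using assms by (auto simp: dual_pair_def)
  obtain ev coev where ev: "ev \<in> hom C (Y \<otimes> X) \<one>" and coev: "coev \<in> hom C \<one> (X \<otimes> Y)"
    and z1: "runit C X \<cdot> (ident C X \<odot> ev) \<cdot> assoc C X Y X \<cdot> (coev \<odot> ident C X) \<cdot> inverse_mor C (lunit C X) = ident C X"
    and z2: "lunit C Y \<cdot> (ev \<odot> ident C Y) \<cdot> inverse_mor C (assoc C Y X Y) \<cdot> (ident C Y \<odot> coev) \<cdot>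
      inverse_mor C (runit C Y) = ident C Y"
    using assms unfolding dual_pair_def by blast
  note e = homD[OF ev] homD[OF coev]
  have split: "x = inverse_mor C r \<cdot> l"
    if "is_iso C r" "is_iso C l" "x \<in> mor C" "src C x = src C l" "tgt C x = src C r" "tgt C l = tgt C r"
      "r \<cdot> (x \<cdot> inverse_mor C l) = ident C (tgt C r)" for r l x
  proof -
    have "inverse_mor C r \<cdot> ((r \<cdot> (x \<cdot> inverse_mor C l)) \<cdot> l) = x"
      using that(1-6) is_iso_mor[OF that(1)] is_iso_mor[OF that(2)] by simp
    then show ?thesis unfolding that(7)
      using that(1-6) is_iso_mor[OF that(1)] is_iso_mor[OF that(2)] by simp
  qed
  have "(ident C X \<odot> ev) \<cdot> (assoc C X Y X \<cdot> (coev \<odot> ident C X)) = inverse_mor C (runit C X) \<cdot> lunit C X"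
    by (rule split) (use z1 e in \<open>auto\<close>)
  moreover have "(ev \<odot> ident C Y) \<cdot> (inverse_mor C (assoc C Y X Y) \<cdot> (ident C Y \<odot> coev)) =
      inverse_mor C (lunit C Y) \<cdot> runit C Y"
    by (rule split) (use z2 e in \<open>auto\<close>)
  ultimately have "left.weakly_dual Y X ev coev"
    unfolding left.weakly_dual_def using ev coev by simp
  then show ?thesis by blast
qed

lemma left_adjunction:
  assumes "left.weakly_dual Y X ev coev"
  obtains \<Phi> where "adjunction C (\<lambda>U. Y \<otimes> U) (\<lambda>Z. X \<otimes> Z) (\<lambda>f. ident C Y \<odot> f) (\<lambda>f. ident C X \<odot> f) \<Phi>"
  using left.tensor_adjunction[OF assms] by blast

lemma right_adjunction:
  assumes "left.weakly_dual Y X ev coev"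
  obtains \<Phi> where "adjunction C (\<lambda>U. U \<otimes> X) (\<lambda>Z. Z \<otimes> Y) (\<lambda>f. f \<odot> ident C X) (\<lambda>f. f \<odot> ident C Y) \<Phi>"
  using right.tensor_adjunction[of X Y ev coev] assms unfolding right_weakly_dual by blast

text \<open>\<open>s\<close> comes from coevaluation and \<open>r\<close> from evaluation. Their
  composite contains the zigzag \<open>z\<close>, which is only known to be invertible, so its
  inverse is built into \<open>r\<close>.\<close>

lemma dual_retract:
  assumes "left.weakly_dual Y X ev coev"
  shows "\<exists>s \<in> hom C X (X \<otimes> Y \<otimes> X). \<exists>r \<in> hom C (X \<otimes> Y \<otimes> X) X. r \<cdot> s = ident C X"
proof -
  define z where "z = (ident C X \<odot> ev) \<cdot> (assoc C X Y X \<cdot> (coev \<odot> ident C X))"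
  have o [simp]: "X \<in> obj C" "Y \<in> obj C"
    and ev [simp]: "ev \<in> mor C" "src C ev = Y \<otimes> X" "tgt C ev = \<one>"
    and coev [simp]: "coev \<in> mor C" "src C coev = \<one>" "tgt C coev = X \<otimes> Y"
    and z_iso [simp]: "is_iso C z"
    using assms by (auto simp: left.weakly_dual_def hom_def z_def)
  have z [simp]: "z \<in> mor C" "src C z = \<one> \<otimes> X" "tgt C z = X \<otimes> \<one>" by (simp_all add: z_def)
  define s where "s = (coev \<odot> ident C X) \<cdot> inverse_mor C (lunit C X)"
  define r where "r = lunit C X \<cdot> (inverse_mor C z \<cdot> ((ident C X \<odot> ev) \<cdot> assoc C X Y X))"
  have s: "s \<in> hom C X (X \<otimes> Y \<otimes> X)" and r: "r \<in> hom C (X \<otimes> Y \<otimes> X) X"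
    by (auto simp: s_def r_def hom_def)
  have "r \<cdot> s = lunit C X \<cdot> (inverse_mor C z \<cdot> ((ident C X \<odot> ev) \<cdot> (assoc C X Y X \<cdot>
      ((coev \<odot> ident C X) \<cdot> inverse_mor C (lunit C X)))))"
    by (simp add: r_def s_def)
  also have "(ident C X \<odot> ev) \<cdot> (assoc C X Y X \<cdot> ((coev \<odot> ident C X) \<cdot> inverse_mor C (lunit C X))) =
      z \<cdot> inverse_mor C (lunit C X)"
    by (simp add: z_def)
  also have "lunit C X \<cdot> (inverse_mor C z \<cdot> (z \<cdot> inverse_mor C (lunit C X))) = ident C X" by simp
  finally show ?thesis using s r by blast
qed

lemma isomorphic_tensor:
  assumes "isomorphic C X X'" "isomorphic C Y Y'"
  shows "isomorphic C (X \<otimes> Y) (X' \<otimes> Y')"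
proof -
  obtain f g where "f \<in> hom C X X'" "is_iso C f" "g \<in> hom C Y Y'" "is_iso C g"
    using assms by (auto simp: isomorphic_def)
  then show ?thesis by (intro isomorphicI[of "f \<odot> g"]) (auto intro: tensM_hom)
qed

lemma isomorphic_assoc:
  "X \<in> obj C \<Longrightarrow> Y \<in> obj C \<Longrightarrow> Z \<in> obj C \<Longrightarrow> isomorphic C (X \<otimes> Y \<otimes> Z) (X \<otimes> (Y \<otimes> Z))"
  using isomorphicI[OF assoc_iso assoc_hom] .

lemma isomorphic_lunit: "X \<in> obj C \<Longrightarrow> isomorphic C (\<one> \<otimes> X) X"
  using isomorphicI[OF lunit_iso lunit_hom] .

lemma isomorphic_runit: "X \<in> obj C \<Longrightarrow> isomorphic C (X \<otimes> \<one>) X"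
  using isomorphicI[OF runit_iso runit_hom] .

end

section \<open>Exactness of the tensor product\<close>

context rigid_monoidal_category
begin

lemma dualsE:
  assumes "X \<in> obj C"
  obtains Y ev coev Y' ev' coev' where "dual_pair C Y X" "left.weakly_dual Y X ev coev"
    "dual_pair C X Y'" "left.weakly_dual X Y' ev' coev'"
  using left_dual[OF assms] right_dual[OF assms] dual_pair_weakly_dual by metis

lemma tensor_mono_left: "X \<in> obj C \<Longrightarrow> is_mono C m \<Longrightarrow> is_mono C (ident C X \<odot> m)"
  by (elim dualsE left_adjunction) (rule adjunction.right_mono)

lemma tensor_epi_left: "X \<in> obj C \<Longrightarrow> is_epi C e \<Longrightarrow> is_epi C (ident C X \<odot> e)"
  by (elim dualsE left_adjunction) (rule adjunction.left_epi)

lemma tensor_mono_right: "X \<in> obj C \<Longrightarrow> is_mono C m \<Longrightarrow> is_mono C (m \<odot> ident C X)"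
  by (elim dualsE right_adjunction) (rule adjunction.right_mono)

lemma tensor_epi_right: "X \<in> obj C \<Longrightarrow> is_epi C e \<Longrightarrow> is_epi C (e \<odot> ident C X)"
  by (elim dualsE right_adjunction) (rule adjunction.left_epi)

lemma tensor_split:
  assumes "f \<in> mor C" "g \<in> mor C"
  shows "f \<odot> g = (ident C (tgt C f) \<odot> g) \<cdot> (f \<odot> ident C (src C g))"
  using assms by (simp add: left.M_cmp_mor)

lemma tensor_mono: "is_mono C f \<Longrightarrow> is_mono C g \<Longrightarrow> is_mono C (f \<odot> g)"
  using tensor_split[of f g] by (simp add: is_mono_mor mono_cmp tensor_mono_left tensor_mono_right)

lemma tensor_epi: "is_epi C f \<Longrightarrow> is_epi C g \<Longrightarrow> is_epi C (f \<odot> g)"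
  using tensor_split[of f g] by (simp add: is_epi_mor epi_cmp tensor_epi_left tensor_epi_right)

end

context finite_tensor_category
begin

lemma tensor_zero_left:
  assumes "f \<in> mor C" "X \<in> obj C" "Y \<in> obj C"
  shows "zero_mor C X Y \<odot> f = zero_mor C (X \<otimes> src C f) (Y \<otimes> tgt C f)"
proof -
  have f: "f \<in> hom C (src C f) (tgt C f)" using assms by (simp add: hom_def)
  note z = zero_hom[OF assms(2,3)]
  show ?thesis
    using tensM_scale_left[OF z f, of 0] scale_zero[OF z] scale_zero[OF tensM_hom[OF z f]] by simp
qed

text \<open>\<open>P\<close> is a left dual of its right dual \<open>Y\<close>, so tensoring with
  \<open>P\<close> on the right is right adjoint to tensoring with \<open>Y\<close>, and right
  adjoints preserve kernels.\<close>

lemma tensor_kernel_right: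
  assumes "P \<in> obj C" "is_kernel C f k"
  shows "is_kernel C (f \<odot> ident C P) (k \<odot> ident C P)"
proof -
  obtain Y ev coev where w: "left.weakly_dual P Y ev coev" using assms(1) by (rule dualsE)
  obtain \<Phi> where adj: "adjunction C (\<lambda>U. U \<otimes> Y) (\<lambda>Z. Z \<otimes> P) (\<lambda>f. f \<odot> ident C Y) (\<lambda>f. f \<odot> ident C P) \<Phi>"
    using w by (rule right_adjunction)
  show ?thesis
    by (rule right_adjoint_kernel[OF adj assms(2)])
      (use assms(1) kernelD[OF assms(2)] in \<open>simp_all add: tensor_zero_left left.M_cmp_mor\<close>)
qed

end

section \<open>Duals of monos and epis\<close>

context rigid_monoidal_category
begin

text \<open>\<open>m\<close> induces a natural mono from tensoring with \<open>X\<close> to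
  tensoring with \<open>X'\<close>, and the left adjoints are tensoring with \<open>Y\<close> and
  \<open>Y'\<close>. The mate is evaluated at the unit object, hence the factor
  \<open>\<one>\<close>.\<close>

lemma left_dual_epi:
  assumes m: "m \<in> hom C X X'" "is_mono C m"
    and w: "left.weakly_dual Y X ev coev" "left.weakly_dual Y' X' ev' coev'"
  shows "\<exists>\<psi> \<in> hom C (Y' \<otimes> \<one>) (Y \<otimes> \<one>). is_epi C \<psi>"
proof -
  obtain \<Phi> where a: "adjunction C (\<lambda>U. Y \<otimes> U) (\<lambda>Z. X \<otimes> Z) (\<lambda>f. ident C Y \<odot> f) (\<lambda>f. ident C X \<odot> f) \<Phi>"
    using w(1) by (rule left_adjunction)
  obtain \<Phi>' where a': "adjunction C (\<lambda>U. Y' \<otimes> U) (\<lambda>Z. X' \<otimes> Z) (\<lambda>f. ident C Y' \<odot> f) (\<lambda>f. ident C X' \<odot> f) \<Phi>'"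
    using w(2) by (rule left_adjunction)
  show ?thesis
    by (rule adjunction_comparison_epi[OF a a', of "\<lambda>Z. m \<odot> ident C Z"])
      (use m hom_obj[OF m(1)] tensor_mono_right in \<open>auto simp: hom_def left.M_cmp_mor\<close>)
qed

text \<open>The epi \<open>e\<close> has to sit on the left adjoints, so the adjunctions for
  tensoring from the right are used; this puts the unit on the other side than in
  \<open>left_dual_epi\<close>.\<close>

lemma left_dual_mono:
  assumes e: "e \<in> hom C X X'" "is_epi C e"
    and w: "left.weakly_dual Y X ev coev" "left.weakly_dual Y' X' ev' coev'"
  shows "\<exists>\<psi> \<in> hom C (\<one> \<otimes> Y') (\<one> \<otimes> Y). is_mono C \<psi>"
proof -
  obtain \<Phi> where a: "adjunction C (\<lambda>U. U \<otimes> X) (\<lambda>Z. Z \<otimes> Y) (\<lambda>f. f \<odot> ident C X) (\<lambda>f. f \<odot> ident C Y) \<Phi>"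
    using w(1) by (rule right_adjunction)
  obtain \<Phi>' where a': "adjunction C (\<lambda>U. U \<otimes> X') (\<lambda>Z. Z \<otimes> Y') (\<lambda>f. f \<odot> ident C X') (\<lambda>f. f \<odot> ident C Y') \<Phi>'"
    using w(2) by (rule right_adjunction)
  show ?thesis
    by (rule adjunction_comparison_mono[OF a a', of "\<lambda>U. ident C U \<odot> e"])
      (use e hom_obj[OF e(1)] tensor_epi_left in \<open>auto simp: hom_def left.M_cmp_mor\<close>)
qed

lemma right_dual_epi:
  assumes m: "m \<in> hom C X X'" "is_mono C m"
    and w: "left.weakly_dual X Y ev coev" "left.weakly_dual X' Y' ev' coev'"
  shows "\<exists>\<psi> \<in> hom C (\<one> \<otimes> Y') (\<one> \<otimes> Y). is_epi C \<psi>"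
proof -
  obtain \<Phi> where a: "adjunction C (\<lambda>U. U \<otimes> Y) (\<lambda>Z. Z \<otimes> X) (\<lambda>f. f \<odot> ident C Y) (\<lambda>f. f \<odot> ident C X) \<Phi>"
    using w(1) by (rule right_adjunction)
  obtain \<Phi>' where a': "adjunction C (\<lambda>U. U \<otimes> Y') (\<lambda>Z. Z \<otimes> X') (\<lambda>f. f \<odot> ident C Y') (\<lambda>f. f \<odot> ident C X') \<Phi>'"
    using w(2) by (rule right_adjunction)
  show ?thesis
    by (rule adjunction_comparison_epi[OF a a', of "\<lambda>Z. ident C Z \<odot> m"])
      (use m hom_obj[OF m(1)] tensor_mono_left in \<open>auto simp: hom_def left.M_cmp_mor\<close>)
qed

lemma right_dual_mono:
  assumes e: "e \<in> hom C X X'" "is_epi C e"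
    and w: "left.weakly_dual X Y ev coev" "left.weakly_dual X' Y' ev' coev'"
  shows "\<exists>\<psi> \<in> hom C (Y' \<otimes> \<one>) (Y \<otimes> \<one>). is_mono C \<psi>"
proof -
  obtain \<Phi> where a: "adjunction C (\<lambda>U. X \<otimes> U) (\<lambda>Z. Y \<otimes> Z) (\<lambda>f. ident C X \<odot> f) (\<lambda>f. ident C Y \<odot> f) \<Phi>"
    using w(1) by (rule left_adjunction)
  obtain \<Phi>' where a': "adjunction C (\<lambda>U. X' \<otimes> U) (\<lambda>Z. Y' \<otimes> Z) (\<lambda>f. ident C X' \<odot> f) (\<lambda>f. ident C Y' \<odot> f) \<Phi>'"
    using w(2) by (rule left_adjunction)
  show ?thesis
    by (rule adjunction_comparison_mono[OF a a', of "\<lambda>U. e \<odot> ident C U"])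
      (use e hom_obj[OF e(1)] tensor_epi_right in \<open>auto simp: hom_def left.M_cmp_mor\<close>)
qed

end

section \<open>Relative projectives and injectives of a tensor subcategory\<close>

locale tensor_subcategory_of = finite_tensor_category C + sub: tensor_subcategory C D
  for C :: "('o, 'm, 'k::field, 'z) lin_mon_cat_scheme" (structure) and D
begin

lemma sub_hom: "m \<in> hom C X Y \<Longrightarrow> is_mono C m \<Longrightarrow> Y \<in> D \<Longrightarrow> X \<in> D"
  using sub.subobject[of m] by (simp add: hom_def)

lemma quot_hom: "e \<in> hom C X Y \<Longrightarrow> is_epi C e \<Longrightarrow> X \<in> D \<Longrightarrow> Y \<in> D"
  using sub.quotient[of e] by (simp add: hom_def)

lemma sub_obj: "X \<in> D \<Longrightarrow> X \<in> obj C"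
  using sub.subset by blast

text \<open>\<open>u\<close> is the unit of the reflection of \<open>X\<close> into
  \<open>D\<close>, its largest quotient there. The factor \<open>h'\<close> is unique because
  \<open>u\<close> is epi.\<close>

definition reflection :: "'o \<Rightarrow> 'm \<Rightarrow> bool" where
  "reflection X u \<longleftrightarrow> is_epi C u \<and> src C u = X \<and> tgt C u \<in> D \<and>
     (\<forall>Z \<in> D. \<forall>h \<in> hom C X Z. \<exists>h' \<in> hom C (tgt C u) Z. h' \<cdot> u = h)"

text \<open>If every morphism into \<open>D\<close> kills the simple subobject, the reflection of
  the quotient, composed with \<open>g\<close>, already serves. Otherwise some \<open>z\<close> is
  injective on the simple subobject, and the image of \<open>(z, v)\<close> is the
  reflection.\<close>

lemma reflection_extension:
  assumes fg: "short_exact C f g" and S: "simple_object C (src C f)" and u0: "reflection (tgt C g) u0"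
  shows "\<exists>u. reflection (tgt C f) u"
proof -
  have ker: "is_kernel C g f" and cok: "is_cokernel C f g" using fg by (auto simp: short_exact_def)
  have f: "f \<in> mor C" "is_mono C f" and g: "g \<in> mor C" "is_epi C g" "src C g = tgt C f"
    using kernelD[OF ker] kernel_mono[OF ker] cokernel_epi[OF cok] by auto
  define X R0 v where "X = tgt C f" and "R0 = tgt C u0" and "v = u0 \<cdot> g"
  have u: "is_epi C u0" "u0 \<in> mor C" "src C u0 = tgt C g" "R0 \<in> D"
    and u_univ: "\<And>Z h. Z \<in> D \<Longrightarrow> h \<in> hom C (tgt C g) Z \<Longrightarrow> \<exists>h' \<in> hom C R0 Z. h' \<cdot> u0 = h"
    using u0 by (auto simp: reflection_def is_epi_mor R0_def)
  have v: "v \<in> hom C X R0" "is_epi C v"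
    using u f g epi_cmp[OF g(2) u(1)] by (auto simp: v_def X_def R0_def hom_def)
  note vv = homD[OF v(1)]
  have X: "X \<in> obj C" using f by (simp add: X_def)
  have thru: "\<exists>d \<in> hom C R0 Z. d \<cdot> v = h"
    if Z: "Z \<in> D" and h: "h \<in> hom C X Z" and hf: "h \<cdot> f = zero_mor C (src C f) Z" for Z h
  proof -
    obtain d where d: "d \<in> hom C (tgt C g) Z" "d \<cdot> g = h"
      using cokernel_factor[OF cok] h hf by (auto simp: X_def)
    obtain d' where d': "d' \<in> hom C R0 Z" "d' \<cdot> u0 = d" using u_univ[OF Z d(1)] by blast
    have "d' \<cdot> v = d' \<cdot> u0 \<cdot> g" using d'(1) u g by (auto simp: v_def hom_def R0_def)
    then show ?thesis using d d' by auto
  qed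
  show ?thesis
  proof (cases "\<forall>Z \<in> D. \<forall>z \<in> hom C X Z. z \<cdot> f = zero_mor C (src C f) Z")
    case True
    then have "reflection (tgt C f) v"
      using v vv u thru unfolding reflection_def by (auto simp: X_def)
    then show ?thesis by blast
  next
    case False
    then obtain Z z where Z: "Z \<in> D" and z: "z \<in> hom C X Z" and nz: "z \<cdot> f \<noteq> zero_mor C (src C f) Z"
      by blast
    note zz = homD[OF z]
    have zf: "z \<cdot> f \<in> hom C (src C f) Z" using f zz by (simp add: hom_def X_def)
    \<comment> \<open>By simplicity the kernel of \<open>z \<cdot> f\<close> is zero or everything,
      and the latter contradicts \<open>nz\<close>.\<close>
    have zf_mono: "is_mono C (z \<cdot> f)"
    proof -
      obtain \<kappa> where \<kappa>: "is_kernel C (z \<cdot> f) \<kappa>" using kernel homD(1)[OF zf] by blast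
      note k = kernelD[OF \<kappa>]
      have ks: "tgt C \<kappa> = src C f" using k homD[OF zf] by simp
      have "is_zero C (src C \<kappa>) \<or> is_iso C \<kappa>"
        using S kernel_mono[OF \<kappa>] ks unfolding simple_object_def by blast
      then show ?thesis
      proof
        assume z0: "is_zero C (src C \<kappa>)"
        show ?thesis
        proof (rule is_monoI[OF zf])
          fix W t assume t: "t \<in> hom C W (src C f)" "z \<cdot> f \<cdot> t = zero_mor C W Z"
          have W: "W \<in> obj C" using t hom_obj by blast
          obtain t' where t': "t' \<in> hom C W (src C \<kappa>)" "\<kappa> \<cdot> t' = t"
            using kernel_factor[OF \<kappa>, of t W] t homD[OF zf] by auto
          have "zero_mor C W (src C \<kappa>) \<in> hom C W (src C \<kappa>)" using W k zero_hom by simp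
          then have "t' = zero_mor C W (src C \<kappa>)" using z0 t'(1) W unfolding is_zero_def by blast
          then show "t = zero_mor C W (src C f)" using t'(2) k ks W by simp
        qed
      next
        assume iso: "is_iso C \<kappa>"
        have "z \<cdot> f = ((z \<cdot> f) \<cdot> \<kappa>) \<cdot> inverse_mor C \<kappa>"
          using iso k(1,2) ks f zz X_def by simp
        also have "\<dots> = zero_mor C (src C f) Z"
          unfolding k(4) using iso k(1,2) ks homD[OF zf] hom_obj[OF zf] by simp
        finally show ?thesis using nz by blast
      qed
    qed
    \<comment> \<open>The candidate is the image \<open>I\<close> of \<open>(z, v)\<close> in a
      direct sum of \<open>Z\<close> and \<open>R0\<close>: it detects the simple subobject through
      \<open>z\<close> and the old reflection through \<open>v\<close>.\<close>
    obtain Q where Q: "is_direct_sum C Z R0 Q" using direct_sum sub_obj Z u by blast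
    obtain i j p q where s: "i \<in> hom C Z Q" "j \<in> hom C R0 Q" "p \<in> hom C Q Z" "q \<in> hom C Q R0"
      "p \<cdot> i = ident C Z" "q \<cdot> j = ident C R0" "p \<cdot> j = zero_mor C R0 Z" "q \<cdot> i = zero_mor C Z R0"
      "(i \<cdot> p) \<oplus> (j \<cdot> q) = ident C Q"
      using Q by (rule direct_sumE)
    obtain w where w: "w \<in> hom C X Q" "p \<cdot> w = z" "q \<cdot> w = v"
      using direct_sum_pair[OF z v(1) s(1-8)] by blast
    obtain I e m where im: "e \<in> hom C X I" "is_epi C e" "m \<in> hom C I Q" "is_mono C m" "m \<cdot> e = w"
      using w(1) by (rule image_factorization)
    have I: "I \<in> D" using sub_hom im(3,4) sub.direct_sum[OF Z u(4) Q] by blast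
    note ss = s(1-4)[THEN homD(1)] s(1-4)[THEN homD(2)] s(1-4)[THEN homD(3)] homD[OF im(1)] homD[OF im(3)]
    have pme: "p \<cdot> (m \<cdot> e) = z" "q \<cdot> (m \<cdot> e) = v" using w im(5) by auto
    obtain k where k: "is_kernel C e k" using kernel ss by blast
    note k' = kernelD[OF k]
    define K where "K = src C k"
    have kh: "k \<in> hom C K X" using k' ss by (simp add: hom_def K_def)
    note kk = homD[OF kh]
    have K: "K \<in> obj C" using hom_obj kh by blast
    have ek: "e \<cdot> k = zero_mor C K I" using k'(4) ss by (simp add: K_def)
    have ek_cok: "is_cokernel C k e" by (rule epi_is_cokernel[OF im(2) k])
    \<comment> \<open>Let \<open>W\<close> be the image of \<open>(h, e)\<close>; then
      \<open>h\<close> factors through \<open>e\<close> as soon as \<open>e2\<close> kills the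
      kernel \<open>k\<close> of \<open>e\<close>. Modulo the simple subobject \<open>e2\<close>
      factors through \<open>v\<close>, which kills \<open>k\<close>, so \<open>e2 \<cdot> k\<close>
      lands in the simple subobject. There \<open>z\<close> is injective, and \<open>z\<close> kills
      \<open>k\<close>.\<close>
    have univ: "\<exists>h' \<in> hom C I Z'. h' \<cdot> e = h" if Z': "Z' \<in> D" and h: "h \<in> hom C X Z'" for Z' h
    proof -
      note hh = homD[OF h]
      obtain Q' where Q': "is_direct_sum C Z' I Q'" using direct_sum sub_obj Z' I by blast
      obtain i' j' p' q' where s': "i' \<in> hom C Z' Q'" "j' \<in> hom C I Q'" "p' \<in> hom C Q' Z'" "q' \<in> hom C Q' I"
        "p' \<cdot> i' = ident C Z'" "q' \<cdot> j' = ident C I" "p' \<cdot> j' = zero_mor C I Z'" "q' \<cdot> i' = zero_mor C Z' I"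
        "(i' \<cdot> p') \<oplus> (j' \<cdot> q') = ident C Q'"
        using Q' by (rule direct_sumE)
      obtain w' where w': "w' \<in> hom C X Q'" "p' \<cdot> w' = h" "q' \<cdot> w' = e"
        using direct_sum_pair[OF h im(1) s'(1-8)] by blast
      obtain W e2 m2 where im2: "e2 \<in> hom C X W" "is_epi C e2" "m2 \<in> hom C W Q'" "is_mono C m2" "m2 \<cdot> e2 = w'"
        using w'(1) by (rule image_factorization)
      have W: "W \<in> D" using sub_hom im2(3,4) sub.direct_sum[OF Z' I Q'] by blast
      note ss' = s'(1-4)[THEN homD(1)] s'(1-4)[THEN homD(2)] s'(1-4)[THEN homD(3)] homD[OF im2(1)] homD[OF im2(3)]
      define a b where "a = p' \<cdot> m2" and "b = q' \<cdot> m2"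
      have ab: "a \<in> hom C W Z'" "b \<in> hom C W I" unfolding a_def b_def using cmp_hom im2 s' by blast+
      note abm = homD[OF ab(1)] homD[OF ab(2)]
      have ab2: "a \<cdot> e2 = h" "b \<cdot> e2 = e" using w' im2(5) ss' by (simp_all add: a_def b_def)
      have e2f: "e2 \<cdot> f \<in> hom C (src C f) W" using ss' f by (simp add: hom_def X_def)
      have "(p \<cdot> (m \<cdot> b)) \<cdot> (e2 \<cdot> f) = (p \<cdot> (m \<cdot> (b \<cdot> e2))) \<cdot> f"
        using ss ss' abm f X_def by simp
      also have "\<dots> = z \<cdot> f" unfolding ab2 pme ..
      finally have pmb: "(p \<cdot> (m \<cdot> b)) \<cdot> (e2 \<cdot> f) = z \<cdot> f" .
      have pmb_hom: "p \<cdot> (m \<cdot> b) \<in> hom C W Z" using ss abm by (simp add: hom_def)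
      have e2f_mono: "is_mono C (e2 \<cdot> f)"
        using mono_cancel[OF _ e2f pmb_hom] zf_mono unfolding pmb .
      obtain c where c: "is_cokernel C (e2 \<cdot> f) c" using cokernel homD(1)[OF e2f] by blast
      note c' = cokernelD[OF c]
      define V where "V = tgt C c"
      have ch: "c \<in> hom C W V" using c' homD[OF e2f] by (simp add: hom_def V_def)
      have V: "V \<in> D" using quot_hom[OF ch cokernel_epi[OF c] W] .
      note chh = homD[OF ch]
      have ce2: "c \<cdot> e2 \<in> hom C X V" using cmp_hom im2(1) ch by blast
      have "c \<cdot> e2 \<cdot> f = zero_mor C (src C f) V"
        using c'(4) homD[OF e2f] chh ss' f X_def by simp
      then obtain d where d: "d \<in> hom C R0 V" "d \<cdot> v = c \<cdot> e2" using thru[OF V ce2] by blast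
      have "v \<cdot> k = (q \<cdot> m) \<cdot> (e \<cdot> k)" unfolding pme(2)[symmetric] using ss kk by simp
      also have "\<dots> = zero_mor C K R0" unfolding ek using ss K by simp
      finally have vk: "v \<cdot> k = zero_mor C K R0" .
      have "c \<cdot> (e2 \<cdot> k) = (c \<cdot> e2) \<cdot> k" using chh ss' kk by simp
      also have "\<dots> = d \<cdot> (v \<cdot> k)" unfolding d(2)[symmetric] using homD[OF d(1)] vv kk by simp
      also have "\<dots> = zero_mor C K V" unfolding vk using homD[OF d(1)] K by simp
      finally have "c \<cdot> (e2 \<cdot> k) = zero_mor C K (tgt C c)" by (simp add: V_def)
      moreover have "e2 \<cdot> k \<in> hom C K (src C c)" using ss' kk chh by (simp add: hom_def)
      ultimately obtain t where t: "t \<in> hom C K (src C (e2 \<cdot> f))" "(e2 \<cdot> f) \<cdot> t = e2 \<cdot> k"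
        using kernel_factor[OF mono_is_kernel[OF e2f_mono c]] by blast
      have th: "t \<in> hom C K (src C f)" using t(1) homD[OF e2f] by simp
      note tt = homD[OF th]
      have "(z \<cdot> f) \<cdot> t = (p \<cdot> (m \<cdot> b)) \<cdot> ((e2 \<cdot> f) \<cdot> t)"
        unfolding pmb[symmetric] using homD[OF pmb_hom] homD[OF e2f] tt by simp
      also have "\<dots> = (p \<cdot> m) \<cdot> ((b \<cdot> e2) \<cdot> k)" unfolding t(2) using ss ss' abm kk by simp
      also have "\<dots> = zero_mor C K Z" unfolding ab2 ek using ss K by simp
      finally have "(z \<cdot> f) \<cdot> t = zero_mor C K (tgt C (z \<cdot> f))" using homD[OF zf] by simp
      then have "t = zero_mor C K (src C f)"
        using mono_zero[OF zf_mono] th homD[OF zf] by simp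
      then have e2k: "e2 \<cdot> k = zero_mor C K W" using t(2) homD[OF e2f] K by simp
      have "h \<cdot> k = a \<cdot> (e2 \<cdot> k)" unfolding ab2(1)[symmetric] using abm ss' kk by simp
      also have "\<dots> = zero_mor C K Z'" unfolding e2k using abm K by simp
      finally have "h \<cdot> k = zero_mor C (src C k) Z'" by (simp add: K_def)
      moreover have "h \<in> hom C (tgt C k) Z'" using h kk by simp
      ultimately obtain h' where "h' \<in> hom C (tgt C e) Z'" "h' \<cdot> e = h"
        using cokernel_factor[OF ek_cok] by blast
      then show ?thesis using ss by auto
    qed
    have "reflection (tgt C f) e"
      unfolding reflection_def using im(2) ss I univ by (auto simp: X_def)
    then show ?thesis by blast
  qed
qed

lemma reflection_exists:
  assumes "X \<in> obj C"
  shows "\<exists>u. reflection X u"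
  using finite_length[OF assms]
proof (induction rule: finite_length.induct)
  case (length_zero X)
  then have X: "X \<in> obj C" "X \<in> D" using sub.zero by (auto simp: is_zero_def)
  have "reflection X (ident C X)" unfolding reflection_def
    using X iso_epi[OF is_iso_ident[OF X(1)]] by (auto simp: hom_def)
  then show ?case by blast
next
  case (length_step f g)
  then show ?case using reflection_extension by blast
qed

section \<open>Lifting and extension properties inside the subcategory\<close>

definition rel_projective :: "'o \<Rightarrow> bool" where
  "rel_projective P \<longleftrightarrow> P \<in> D \<and> (\<forall>V \<in> D. \<forall>W \<in> D. \<forall>e \<in> hom C V W. is_epi C e \<longrightarrow>
     (\<forall>f \<in> hom C P W. \<exists>g \<in> hom C P V. e \<cdot> g = f))"

definition rel_injective :: "'o \<Rightarrow> bool" where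
  "rel_injective I \<longleftrightarrow> I \<in> D \<and> (\<forall>U \<in> D. \<forall>V \<in> D. \<forall>i \<in> hom C U V. is_mono C i \<longrightarrow>
     (\<forall>f \<in> hom C U I. \<exists>g \<in> hom C V I. g \<cdot> i = f))"

lemma rel_projectiveD:
  "rel_projective P \<Longrightarrow> e \<in> hom C V W \<Longrightarrow> is_epi C e \<Longrightarrow> V \<in> D \<Longrightarrow> f \<in> hom C P W \<Longrightarrow>
    \<exists>g \<in> hom C P V. e \<cdot> g = f"
  using quot_hom unfolding rel_projective_def by blast

lemma rel_injectiveD:
  "rel_injective I \<Longrightarrow> i \<in> hom C U V \<Longrightarrow> is_mono C i \<Longrightarrow> V \<in> D \<Longrightarrow> f \<in> hom C U I \<Longrightarrow>
    \<exists>g \<in> hom C V I. g \<cdot> i = f"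
  using sub_hom unfolding rel_injective_def by blast

text \<open>The projective \<open>P0\<close> covering \<open>X\<close> need not lie in
  \<open>D\<close>, but its reflection \<open>P\<close> does. Morphisms from \<open>P0\<close> to
  objects of \<open>D\<close> factor uniquely through \<open>P\<close>, so the cover and the lifting
  property both descend to \<open>P\<close>.\<close>

lemma enough_rel_projectives:
  assumes "X \<in> D"
  shows "\<exists>P e. rel_projective P \<and> e \<in> hom C P X \<and> is_epi C e"
proof -
  obtain p where p: "is_epi C p" "tgt C p = X" "projective C (src C p)"
    using enough_projectives[OF sub_obj[OF assms]] by blast
  define P0 where "P0 = src C p"
  have ph: "p \<in> hom C P0 X" using p is_epi_mor by (auto simp: hom_def P0_def)
  obtain u where u: "reflection P0 u" using reflection_exists hom_obj ph by blast
  define P where "P = tgt C u"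
  have uh: "u \<in> hom C P0 P" "is_epi C u" "P \<in> D"
    and univ: "\<And>Z h. Z \<in> D \<Longrightarrow> h \<in> hom C P0 Z \<Longrightarrow> \<exists>h' \<in> hom C P Z. h' \<cdot> u = h"
    using u by (auto simp: reflection_def hom_def P_def is_epi_mor)
  note uu = homD[OF uh(1)]
  obtain p' where p': "p' \<in> hom C P X" "p' \<cdot> u = p" using univ[OF assms ph] by blast
  have "is_epi C p'" using epi_cancel[OF _ uh(1) p'(1)] p'(2) p(1) by simp
  moreover have "rel_projective P"
    unfolding rel_projective_def
  proof (intro conjI ballI impI uh(3))
    fix V W e f
    assume V: "V \<in> D" "W \<in> D" and e: "e \<in> hom C V W" "is_epi C e" and f: "f \<in> hom C P W"
    have "f \<cdot> u \<in> hom C P0 (tgt C e)" using cmp_hom[OF uh(1) f] homD[OF e(1)] by simp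
    then obtain g where g: "g \<in> hom C P0 V" "e \<cdot> g = f \<cdot> u"
      using p(3) e homD[OF e(1)] unfolding projective_def P0_def by blast
    obtain g' where g': "g' \<in> hom C P V" "g' \<cdot> u = g" using univ[OF V(1) g(1)] by blast
    have "(e \<cdot> g') \<cdot> u = f \<cdot> u" using g g' uu homD[OF e(1)] homD[OF g'(1)] by simp
    then have "e \<cdot> g' = f" using is_epiD[OF uh(2)] cmp_hom[OF g'(1) e(1)] f uu by blast
    with g' show "\<exists>g \<in> hom C P V. e \<cdot> g = f" by blast
  qed
  ultimately show ?thesis using p' by blast
qed

text \<open>With a right dual \<open>W'\<close> of \<open>W\<close>, morphisms from
  \<open>W \<otimes> P\<close> correspond to morphisms from \<open>P\<close> into
  \<open>W' \<otimes> -\<close>, and tensoring with \<open>W'\<close> preserves epis and stays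
  inside \<open>D\<close>.\<close>

lemma rel_projective_tensor:
  assumes P: "rel_projective P" and W: "W \<in> D"
  shows "rel_projective (W \<otimes> P)"
  unfolding rel_projective_def
proof (intro conjI ballI impI)
  have PD: "P \<in> D" using P by (simp add: rel_projective_def)
  then show "W \<otimes> P \<in> D" using sub.tensor W by blast
  fix V U e f
  assume V: "V \<in> D" "U \<in> D" and e: "e \<in> hom C V U" "is_epi C e" and f: "f \<in> hom C (W \<otimes> P) U"
  obtain W' ev coev where d: "dual_pair C W W'" and w: "left.weakly_dual W W' ev coev"
    using sub_obj[OF W] by (rule dualsE)
  have W': "W' \<in> D" using sub.right_dual[OF W d] .
  obtain \<Phi> where a: "adjunction C (\<lambda>U. W \<otimes> U) (\<lambda>Z. W' \<otimes> Z) (\<lambda>f. ident C W \<odot> f) (\<lambda>f. ident C W' \<odot> f) \<Phi>"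
    using w by (rule left_adjunction)
  show "\<exists>g \<in> hom C (W \<otimes> P) V. e \<cdot> g = f"
  proof (rule adjunction.left_lift[OF a sub_obj[OF PD] e(1) f])
    fix h assume "h \<in> hom C P (W' \<otimes> U)"
    then show "\<exists>g \<in> hom C P (W' \<otimes> V). (ident C W' \<odot> e) \<cdot> g = h"
      by (rule rel_projectiveD[OF P, rotated -1])
        (use e sub_obj[OF W'] V W' sub.tensor in \<open>auto intro: tensM_hom ident_hom tensor_epi_left\<close>)
  qed
qed

text \<open>The cokernel of \<open>i \<otimes> P\<close> is relatively projective, so its projection splits.\<close>

lemma tensor_rel_projective_split:
  assumes P: "rel_projective P" and i: "i \<in> hom C U V" "is_mono C i" and V: "V \<in> D"
  shows "\<exists>r \<in> hom C (V \<otimes> P) (U \<otimes> P). r \<cdot> (i \<odot> ident C P) = ident C (U \<otimes> P)"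
proof -
  have PD: "P \<in> D" using P by (simp add: rel_projective_def)
  note PO = sub_obj[OF PD]
  obtain q where q: "short_exact C i q" using i(2) by (rule short_exact_mono)
  have ker: "is_kernel C q i" and cok: "is_cokernel C i q" using q by (auto simp: short_exact_def)
  note ii = homD[OF i(1)] and q' = cokernelD[OF cok]
  define W where "W = tgt C q"
  have qh: "q \<in> hom C V W" using q' ii by (simp add: hom_def W_def)
  have q_epi: "is_epi C q" using cokernel_epi[OF cok] .
  have W: "W \<in> D" using quot_hom[OF qh q_epi V] .
  define i' q1 where "i' = i \<odot> ident C P" and "q1 = q \<odot> ident C P"
  have i'h: "i' \<in> hom C (U \<otimes> P) (V \<otimes> P)" and q1h: "q1 \<in> hom C (V \<otimes> P) (W \<otimes> P)"
    unfolding i'_def q1_def using i qh PO by (auto intro: tensM_hom ident_hom)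
  note hh = homD[OF i'h] homD[OF q1h]
  have q1_epi: "is_epi C q1" unfolding q1_def using tensor_epi_right[OF PO q_epi] .
  have ker1: "is_kernel C q1 i'" unfolding q1_def i'_def using tensor_kernel_right[OF PO ker] .
  have o: "U \<otimes> P \<in> obj C" "V \<otimes> P \<in> obj C" "W \<otimes> P \<in> obj C" using hom_obj i'h q1h by blast+
  have VP: "V \<otimes> P \<in> D" using sub.tensor V PD by blast
  obtain s where s: "s \<in> hom C (W \<otimes> P) (V \<otimes> P)" "q1 \<cdot> s = ident C (W \<otimes> P)"
    using rel_projectiveD[OF rel_projective_tensor[OF P W] q1h q1_epi VP ident_hom[OF o(3)]] by blast
  note ss = homD[OF s(1)]
  have sq: "s \<cdot> q1 \<in> hom C (V \<otimes> P) (V \<otimes> P)" using cmp_hom[OF q1h s(1)] .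
  note idV = ident_hom[OF o(2)]
  \<comment> \<open>\<open>\<delta>\<close> is the idempotent complementary to
    \<open>s \<cdot> q1\<close>. As \<open>q1\<close> kills it, it factors through the kernel
    \<open>i'\<close>, and the factor \<open>r\<close> is the wanted retraction.\<close>
  define \<delta> where "\<delta> = ident C (V \<otimes> P) \<ominus> s \<cdot> q1"
  have \<delta>: "\<delta> \<in> hom C (V \<otimes> P) (V \<otimes> P)" unfolding \<delta>_def using diff_hom[OF idV sq] .
  have "q1 \<cdot> \<delta> = q1 \<cdot> ident C (V \<otimes> P) \<ominus> q1 \<cdot> (s \<cdot> q1)"
    unfolding \<delta>_def by (rule cmp_diff_right[OF idV sq q1h])
  also have "q1 \<cdot> (s \<cdot> q1) = (q1 \<cdot> s) \<cdot> q1" using hh ss by simp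
  also have "q1 \<cdot> ident C (V \<otimes> P) \<ominus> (q1 \<cdot> s) \<cdot> q1 = zero_mor C (V \<otimes> P) (W \<otimes> P)"
    unfolding s(2) using hh diff_eq_zero_iff[OF q1h q1h] by simp
  finally obtain r where r: "r \<in> hom C (V \<otimes> P) (U \<otimes> P)" "i' \<cdot> r = \<delta>"
    using kernel_factor[OF ker1, of \<delta> "V \<otimes> P"] \<delta> hh by auto
  note rr = homD[OF r(1)]
  have qi: "q1 \<cdot> i' = zero_mor C (U \<otimes> P) (W \<otimes> P)" using kernelD(4)[OF ker1] hh by simp
  have "i' \<cdot> (r \<cdot> i') = \<delta> \<cdot> i'" unfolding r(2)[symmetric] using rr hh by simp
  also have "\<dots> = ident C (V \<otimes> P) \<cdot> i' \<ominus> (s \<cdot> q1) \<cdot> i'"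
    unfolding \<delta>_def by (rule cmp_diff_left[OF i'h idV sq])
  also have "(s \<cdot> q1) \<cdot> i' = zero_mor C (U \<otimes> P) (V \<otimes> P)"
    using hh ss qi o by simp
  also have "ident C (V \<otimes> P) \<cdot> i' \<ominus> zero_mor C (U \<otimes> P) (V \<otimes> P) = i' \<cdot> ident C (U \<otimes> P)"
  proof -
    have z: "zero_mor C (U \<otimes> P) (V \<otimes> P) \<in> hom C (U \<otimes> P) (V \<otimes> P)" using zero_hom o by blast
    have "(- 1) \<star> zero_mor C (U \<otimes> P) (V \<otimes> P) = zero_mor C (U \<otimes> P) (V \<otimes> P)"
      using scale_zero[OF z] scale_scale[OF z, of "-1" 0] by simp
    then show ?thesis unfolding diff_def using add_zero[OF i'h] hh by simp
  qed
  finally have "i' \<cdot> (r \<cdot> i') = i' \<cdot> ident C (U \<otimes> P)" .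
  moreover have "r \<cdot> i' \<in> hom C (U \<otimes> P) (src C i')" "ident C (U \<otimes> P) \<in> hom C (U \<otimes> P) (src C i')"
    using cmp_hom[OF i'h r(1)] ident_hom[OF o(1)] hh by simp_all
  ultimately have "r \<cdot> i' = ident C (U \<otimes> P)" using is_monoD[OF kernel_mono[OF ker1]] by blast
  with r show ?thesis unfolding i'_def by blast
qed

text \<open>Morphisms into \<open>Z \<otimes> Y\<close> correspond to morphisms from
  \<open>- \<otimes> P\<close> into \<open>Z\<close>, so extending along \<open>i\<close> means
  extending along \<open>i\<close> tensored with \<open>P\<close>, which its retraction solves. The
  case \<open>Z = P\<close> will lead to \<open>P\<close> itself.\<close>

lemma rel_injective_tensor_dual:
  assumes P: "rel_projective P" and d: "dual_pair C Y P" and Z: "Z \<in> D"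
  shows "rel_injective (Z \<otimes> Y)"
  unfolding rel_injective_def
proof (intro conjI ballI impI)
  have PD: "P \<in> D" using P by (simp add: rel_projective_def)
  note PO = sub_obj[OF PD]
  have Y: "Y \<in> D" using sub.left_dual[OF PD d] .
  then show "Z \<otimes> Y \<in> D" using sub.tensor Z by blast
  fix U V i f
  assume UV: "U \<in> D" "V \<in> D" and i: "i \<in> hom C U V" "is_mono C i" and f: "f \<in> hom C U (Z \<otimes> Y)"
  obtain ev coev where "left.weakly_dual Y P ev coev" using dual_pair_weakly_dual[OF d] by blast
  then obtain \<Phi> where a: "adjunction C (\<lambda>U. U \<otimes> P) (\<lambda>Z. Z \<otimes> Y) (\<lambda>f. f \<odot> ident C P) (\<lambda>f. f \<odot> ident C Y) \<Phi>"
    by (rule right_adjunction)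
  obtain r where r: "r \<in> hom C (V \<otimes> P) (U \<otimes> P)" "r \<cdot> (i \<odot> ident C P) = ident C (U \<otimes> P)"
    using tensor_rel_projective_split[OF P i UV(2)] by blast
  show "\<exists>g \<in> hom C V (Z \<otimes> Y). g \<cdot> i = f"
  proof (rule adjunction.right_extend[OF a sub_obj[OF Z] i(1) f])
    fix h assume h: "h \<in> hom C (U \<otimes> P) Z"
    have "h \<cdot> r \<cdot> (i \<odot> ident C P) = h"
      using homD[OF h] homD[OF r(1)] homD[OF i(1)] r(2) PO by simp
    then show "\<exists>g \<in> hom C (V \<otimes> P) Z. g \<cdot> (i \<odot> ident C P) = h"
      using cmp_hom[OF r(1) h] by blast
  qed
qed

text \<open>With a right dual \<open>X'\<close> of \<open>X\<close>, extending into
  \<open>I \<otimes> X\<close> along \<open>i\<close> means extending into \<open>I\<close> along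
  \<open>i\<close> tensored with \<open>X'\<close>, which is again a mono of
  \<open>D\<close>.\<close>

lemma rel_injective_tensor:
  assumes I: "rel_injective I" and X: "X \<in> D"
  shows "rel_injective (I \<otimes> X)"
  unfolding rel_injective_def
proof (intro conjI ballI impI)
  have ID: "I \<in> D" using I by (simp add: rel_injective_def)
  then show "I \<otimes> X \<in> D" using sub.tensor X by blast
  fix U V i f
  assume UV: "U \<in> D" "V \<in> D" and i: "i \<in> hom C U V" "is_mono C i" and f: "f \<in> hom C U (I \<otimes> X)"
  obtain X' ev coev where d: "dual_pair C X X'" and w: "left.weakly_dual X X' ev coev"
    using sub_obj[OF X] by (rule dualsE)
  have X': "X' \<in> D" using sub.right_dual[OF X d] .
  obtain \<Phi> where a: "adjunction C (\<lambda>U. U \<otimes> X') (\<lambda>Z. Z \<otimes> X) (\<lambda>f. f \<odot> ident C X') (\<lambda>f. f \<odot> ident C X) \<Phi>"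
    using w by (rule right_adjunction)
  show "\<exists>g \<in> hom C V (I \<otimes> X). g \<cdot> i = f"
  proof (rule adjunction.right_extend[OF a sub_obj[OF ID] i(1) f])
    fix h assume "h \<in> hom C (U \<otimes> X') I"
    then show "\<exists>g \<in> hom C (V \<otimes> X') I. g \<cdot> (i \<odot> ident C X') = h"
      by (rule rel_injectiveD[OF I, rotated -1])
        (use i sub_obj[OF X'] UV X' sub.tensor in \<open>auto intro: tensM_hom ident_hom tensor_mono_right\<close>)
  qed
qed

lemma rel_projective_imp_rel_injective:
  assumes P: "rel_projective P"
  shows "rel_injective P"
  unfolding rel_injective_def
proof (intro conjI ballI impI)
  show PD: "P \<in> D" using P by (simp add: rel_projective_def)
  obtain Y ev coev where d: "dual_pair C Y P" and w: "left.weakly_dual Y P ev coev"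
    using sub_obj[OF PD] by (rule dualsE)
  have inj: "rel_injective (P \<otimes> Y \<otimes> P)"
    using rel_injective_tensor[OF rel_injective_tensor_dual[OF P d PD] PD] .
  obtain s r where sr: "s \<in> hom C P (P \<otimes> Y \<otimes> P)" "r \<in> hom C (P \<otimes> Y \<otimes> P) P" "r \<cdot> s = ident C P"
    using dual_retract[OF w] by blast
  fix U V i f
  assume UV: "U \<in> D" "V \<in> D" and i: "i \<in> hom C U V" "is_mono C i" and f: "f \<in> hom C U P"
  obtain g where g: "g \<in> hom C V (P \<otimes> Y \<otimes> P)" "g \<cdot> i = s \<cdot> f"
    using rel_injectiveD[OF inj i UV(2) cmp_hom[OF f sr(1)]] by blast
  note hh = homD[OF sr(1)] homD[OF sr(2)] homD[OF f] homD[OF g(1)] homD[OF i(1)]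
  have "(r \<cdot> g) \<cdot> i = (r \<cdot> s) \<cdot> f" using hh g(2) by simp
  also have "\<dots> = f" unfolding sr(3) using hh by simp
  finally show "\<exists>g \<in> hom C V P. g \<cdot> i = f" using cmp_hom[OF g(1) sr(2)] by blast
qed

end

section \<open>Subquotients of a generating set\<close>

definition subquotients :: "('o, 'm, 'z) cat_scheme \<Rightarrow> 'o set \<Rightarrow> 'o set" where
  "subquotients C G = {X. \<exists>g \<in> G. \<exists>W. (\<exists>m \<in> hom C W g. is_mono C m) \<and> (\<exists>e \<in> hom C W X. is_epi C e)}"

lemma (in category) subquotients_quot:
  assumes "X \<in> subquotients C G" "e \<in> hom C X Y" "is_epi C e"
  shows "Y \<in> subquotients C G"
proof -
  obtain g W m e' where w: "g \<in> G" "m \<in> hom C W g" "is_mono C m" "e' \<in> hom C W X" "is_epi C e'"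
    using assms(1) unfolding subquotients_def by blast
  have "e \<cdot> e' \<in> hom C W Y" "is_epi C (e \<cdot> e')"
    using cmp_hom[OF w(4) assms(2)] epi_cmp[OF w(5) assms(3)] homD[OF w(4)] homD[OF assms(2)] by simp_all
  with w show ?thesis unfolding subquotients_def by blast
qed

lemma (in category) subquotients_gen:
  assumes "g \<in> G" "g \<in> obj C"
  shows "g \<in> subquotients C G"
  using assms ident_hom[OF assms(2)] iso_mono iso_epi is_iso_ident[OF assms(2)]
  unfolding subquotients_def by blast

lemma (in category) subquotients_isomorphic:
  "X \<in> subquotients C G \<Longrightarrow> isomorphic C X Y \<Longrightarrow> Y \<in> subquotients C G"
  using subquotients_quot iso_epi unfolding isomorphic_def by blast

text \<open>Subquotients are encoded as quotients of subobjects, so a subobject of the quotient is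
  first pulled back to a subobject \<open>W'\<close> of \<open>W\<close>.\<close>

lemma (in abelian_category) subquotients_sub:
  assumes "X \<in> subquotients C G" "i \<in> hom C Y X" "is_mono C i"
  shows "Y \<in> subquotients C G"
proof -
  obtain g W m e where w: "g \<in> G" "m \<in> hom C W g" "is_mono C m" "e \<in> hom C W X" "is_epi C e"
    using assms(1) unfolding subquotients_def by blast
  obtain W' e' i' where p: "e' \<in> hom C W' Y" "is_epi C e'" "i' \<in> hom C W' W" "is_mono C i'"
    using pullback_epi[OF w(4,5) assms(2,3)] by blast
  have "m \<cdot> i' \<in> hom C W' g" "is_mono C (m \<cdot> i')"
    using cmp_hom[OF p(3) w(2)] mono_cmp[OF p(4) w(3)] homD[OF p(3)] homD[OF w(2)] by simp_all
  with w p show ?thesis unfolding subquotients_def by blast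
qed

text \<open>Closure is asked of the members of \<open>G\<close> alone, and only up to subquotients.
  This can be checked both for the products \<open>d \<otimes> b\<close> and for the objects
  \<open>fobj F b\<close>, whose duals and sums are only reached by comparison morphisms.\<close>

locale tensor_generators = finite_tensor_category C
  for C :: "('o, 'm, 'k::field, 'z) lin_mon_cat_scheme" (structure) +
  fixes G :: "'o set"
  assumes G_obj: "G \<subseteq> obj C"
    and G_unit: "\<one> \<in> subquotients C G"
    and G_tensor: "g \<in> G \<Longrightarrow> h \<in> G \<Longrightarrow> g \<otimes> h \<in> subquotients C G"
    and G_sum: "g \<in> G \<Longrightarrow> h \<in> G \<Longrightarrow> is_direct_sum C g h S \<Longrightarrow> S \<in> subquotients C G"
    and G_left_dual: "g \<in> G \<Longrightarrow> dual_pair C Y g \<Longrightarrow> Y \<in> subquotients C G"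
    and G_right_dual: "g \<in> G \<Longrightarrow> dual_pair C g Y \<Longrightarrow> Y \<in> subquotients C G"
begin

lemma subquotients_obj: "subquotients C G \<subseteq> obj C"
  unfolding subquotients_def using hom_obj by blast

lemma unit_right_subquotients: "X \<otimes> \<one> \<in> subquotients C G \<longleftrightarrow> X \<in> subquotients C G" if "X \<in> obj C"
  using isomorphic_runit[OF that] isomorphic_sym subquotients_isomorphic by blast

lemma unit_left_subquotients: "\<one> \<otimes> X \<in> subquotients C G \<longleftrightarrow> X \<in> subquotients C G" if "X \<in> obj C"
  using isomorphic_lunit[OF that] isomorphic_sym subquotients_isomorphic by blast

text \<open>As \<open>W\<close> is a subobject of \<open>g\<close>, its dual is a quotient of the
  dual of \<open>g\<close>; as \<open>X\<close> is a quotient of \<open>W\<close>, its dual is a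
  subobject of the dual of \<open>W\<close>.\<close>

lemma subquotients_dual:
  assumes "X \<in> subquotients C G"
  shows "dual_pair C Y X \<Longrightarrow> Y \<in> subquotients C G" "dual_pair C X Y \<Longrightarrow> Y \<in> subquotients C G"
proof -
  obtain g W m e where w: "g \<in> G" "m \<in> hom C W g" "is_mono C m" "e \<in> hom C W X" "is_epi C e"
    using assms unfolding subquotients_def by blast
  have o: "W \<in> obj C" "g \<in> obj C" "X \<in> obj C" using hom_obj w by blast+
  obtain Yg evg cog Y'g ev'g co'g where dg: "dual_pair C Yg g" "left.weakly_dual Yg g evg cog"
    "dual_pair C g Y'g" "left.weakly_dual g Y'g ev'g co'g" using o(2) by (rule dualsE)
  obtain Yw evw cow Y'w ev'w co'w where dw: "dual_pair C Yw W" "left.weakly_dual Yw W evw cow"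
    "dual_pair C W Y'w" "left.weakly_dual W Y'w ev'w co'w" using o(1) by (rule dualsE)
  have oo: "Yg \<in> obj C" "Y'g \<in> obj C" "Yw \<in> obj C" "Y'w \<in> obj C"
    using dg dw by (auto simp: dual_pair_def)
  have "Yg \<otimes> \<one> \<in> subquotients C G" "\<one> \<otimes> Y'g \<in> subquotients C G"
    using G_left_dual[OF w(1) dg(1)] G_right_dual[OF w(1) dg(3)] oo
    by (simp_all add: unit_left_subquotients unit_right_subquotients)
  then have "Yw \<otimes> \<one> \<in> subquotients C G" "\<one> \<otimes> Y'w \<in> subquotients C G"
    using left_dual_epi[OF w(2,3) dw(2) dg(2)] right_dual_epi[OF w(2,3) dw(4) dg(4)] subquotients_quot
    by blast+
  \<comment> \<open>Moves the unit factor to the side where the mono comparison expects it.\<close>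
  then have *: "\<one> \<otimes> Yw \<in> subquotients C G" "Y'w \<otimes> \<one> \<in> subquotients C G"
    using oo by (simp_all add: unit_left_subquotients unit_right_subquotients)
  show "Y \<in> subquotients C G" if d: "dual_pair C Y X"
  proof -
    obtain ev co where wd: "left.weakly_dual Y X ev co" using dual_pair_weakly_dual[OF d] by blast
    have "\<one> \<otimes> Y \<in> subquotients C G"
      using left_dual_mono[OF w(4,5) dw(2) wd] *(1) subquotients_sub by blast
    then show ?thesis using unit_left_subquotients d by (simp add: dual_pair_def)
  qed
  show "Y \<in> subquotients C G" if d: "dual_pair C X Y"
  proof -
    obtain ev co where wd: "left.weakly_dual X Y ev co" using dual_pair_weakly_dual[OF d] by blast
    have "Y \<otimes> \<one> \<in> subquotients C G"
      using right_dual_mono[OF w(4,5) dw(4) wd] *(2) subquotients_sub by blast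
    then show ?thesis using unit_right_subquotients d by (simp add: dual_pair_def)
  qed
qed

sublocale tensor_subcategory_of C "subquotients C G"
proof
  show "subquotients C G \<subseteq> obj C" by (rule subquotients_obj)
  show "\<one> \<in> subquotients C G" by (rule G_unit)
  show "src C f \<in> subquotients C G" if "is_mono C f" "tgt C f \<in> subquotients C G" for f
    using subquotients_sub[OF that(2), of f] that is_mono_mor by (simp add: hom_def)
  show "tgt C f \<in> subquotients C G" if "is_epi C f" "src C f \<in> subquotients C G" for f
    using subquotients_quot[OF that(2), of f] that is_epi_mor by (simp add: hom_def)
  show "X \<in> subquotients C G" if X: "is_zero C X" for X
  proof -
    have X': "X \<in> obj C" using X by (simp add: is_zero_def)
    have z: "zero_mor C X \<one> \<in> hom C X \<one>" using zero_hom X' unit_obj by blast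
    have "is_mono C (zero_mor C X \<one>)"
    proof (rule is_monoI[OF z])
      fix W u assume u: "u \<in> hom C W X"
      have W: "W \<in> obj C" using u hom_obj by blast
      then show "u = zero_mor C W X" using X u zero_hom[OF W X'] unfolding is_zero_def by blast
    qed
    then show ?thesis using subquotients_sub[OF G_unit z] by blast
  qed
  show "S \<in> subquotients C G"
    if X: "X \<in> subquotients C G" and Y: "Y \<in> subquotients C G" and S: "is_direct_sum C X Y S" for X Y S
  proof -
    obtain g W m e where w: "g \<in> G" "m \<in> hom C W g" "is_mono C m" "e \<in> hom C W X" "is_epi C e"
      using X unfolding subquotients_def by blast
    obtain g' W' m' e' where w': "g' \<in> G" "m' \<in> hom C W' g'" "is_mono C m'" "e' \<in> hom C W' Y" "is_epi C e'"
      using Y unfolding subquotients_def by blast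
    have o: "W \<in> obj C" "W' \<in> obj C" "g \<in> obj C" "g' \<in> obj C" using hom_obj w w' by blast+
    \<comment> \<open>\<open>S\<close> is a quotient of the direct sum \<open>V\<close> of
      \<open>W\<close> and \<open>W'\<close>, and \<open>V\<close> embeds into the direct sum
      \<open>T\<close> of the two generators.\<close>
    obtain V where V: "is_direct_sum C W W' V" using direct_sum o by blast
    obtain T where T: "is_direct_sum C g g' T" using direct_sum o by blast
    obtain i j p q where s: "i \<in> hom C g T" "j \<in> hom C g' T" "p \<in> hom C T g" "q \<in> hom C T g'"
      "p \<cdot> i = ident C g" "q \<cdot> j = ident C g'" "p \<cdot> j = zero_mor C g' g" "q \<cdot> i = zero_mor C g g'"
      using T by (rule direct_sumE)
    note ss = s(1-4)[THEN homD(1)] s(1-4)[THEN homD(2)] s(1-4)[THEN homD(3)] homD[OF w(2)] homD[OF w'(2)]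
    have "p \<cdot> (i \<cdot> m) = (p \<cdot> i) \<cdot> m" "p \<cdot> (j \<cdot> m') = (p \<cdot> j) \<cdot> m'"
      "q \<cdot> (i \<cdot> m) = (q \<cdot> i) \<cdot> m" "q \<cdot> (j \<cdot> m') = (q \<cdot> j) \<cdot> m'"
      using ss by simp_all
    then have "p \<cdot> (i \<cdot> m) = m" "p \<cdot> (j \<cdot> m') = zero_mor C W' g"
      "q \<cdot> (i \<cdot> m) = zero_mor C W g'" "q \<cdot> (j \<cdot> m') = m'"
      using s ss o by simp_all
    then obtain f where f: "f \<in> hom C V T" "is_mono C f"
      using direct_sum_embed[OF V cmp_hom[OF w(2) s(1)] cmp_hom[OF w'(2) s(2)] s(3,4)] w(3) w'(3) by auto
    obtain f' where f': "f' \<in> hom C V S" "is_epi C f'"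
      using direct_sum_epi[OF V S w(4) w'(4) w(5) w'(5)] by blast
    show ?thesis
      using subquotients_quot[OF subquotients_sub[OF G_sum[OF w(1) w'(1) T] f] f'] .
  qed
  show "X \<otimes> Y \<in> subquotients C G" if X: "X \<in> subquotients C G" and Y: "Y \<in> subquotients C G" for X Y
  proof -
    obtain g W m e where w: "g \<in> G" "m \<in> hom C W g" "is_mono C m" "e \<in> hom C W X" "is_epi C e"
      using X unfolding subquotients_def by blast
    obtain g' W' m' e' where w': "g' \<in> G" "m' \<in> hom C W' g'" "is_mono C m'" "e' \<in> hom C W' Y" "is_epi C e'"
      using Y unfolding subquotients_def by blast
    show ?thesis
      using subquotients_quot[OF subquotients_sub[OF G_tensor[OF w(1) w'(1)] tensM_hom[OF w(2) w'(2)]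
            tensor_mono[OF w(3) w'(3)]] tensM_hom[OF w(4) w'(4)] tensor_epi[OF w(5) w'(5)]] .
  qed
  show "Y \<in> subquotients C G" if "X \<in> subquotients C G" "dual_pair C Y X" for X Y
    using subquotients_dual(1) that by blast
  show "Y \<in> subquotients C G" if "X \<in> subquotients C G" "dual_pair C X Y" for X Y
    using subquotients_dual(2) that by blast
qed

text \<open>
  A relatively projective cover of \<open>X\<close> is a quotient of a subobject of some \<open>g \<in> G\<close>.  It splits off
  from the subobject by projectivity and then from \<open>g\<close> by injectivity.
\<close>

lemma subquotient_is_quotient:
  assumes "X \<in> subquotients C G"
  shows "\<exists>g \<in> G. \<exists>e \<in> hom C g X. is_epi C e"
proof -
  obtain P p where P: "rel_projective P" and p: "p \<in> hom C P X" "is_epi C p"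
    using enough_rel_projectives[OF assms] by blast
  have PD: "P \<in> subquotients C G" using P by (simp add: rel_projective_def)
  note idP = ident_hom[OF sub_obj[OF PD]]
  obtain g W m e where w: "g \<in> G" "m \<in> hom C W g" "is_mono C m" "e \<in> hom C W P" "is_epi C e"
    using PD unfolding subquotients_def by blast
  have g: "g \<in> subquotients C G" using subquotients_gen w(1) G_obj by blast
  have W: "W \<in> subquotients C G" using sub_hom[OF w(2,3) g] .
  obtain s where s: "s \<in> hom C P W" "e \<cdot> s = ident C P"
    using rel_projectiveD[OF P w(4,5) W idP] by blast
  have ms: "m \<cdot> s \<in> hom C P g" using cmp_hom s w by blast
  have "is_mono C s" by (rule split_mono[OF s(1) w(4) s(2)])
  then have "is_mono C (m \<cdot> s)" using mono_cmp[OF _ w(3)] homD[OF s(1)] homD[OF w(2)] by simp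
  then obtain r where r: "r \<in> hom C g P" "r \<cdot> (m \<cdot> s) = ident C P"
    using rel_injectiveD[OF rel_projective_imp_rel_injective[OF P] ms _ g idP] by blast
  have "is_epi C r" by (rule split_epi[OF r(1) ms r(2)])
  then have "p \<cdot> r \<in> hom C g X" "is_epi C (p \<cdot> r)"
    using cmp_hom[OF r(1) p(1)] epi_cmp[OF _ p(2)] homD[OF r(1)] homD[OF p(1)] by simp_all
  with w(1) show ?thesis by blast
qed

end

section \<open>The modular law for commuting tensor subcategories\<close>

context finite_tensor_category
begin

context
  fixes D E :: "'o set"
  assumes D: "tensor_subcategory C D" and E: "tensor_subcategory C E"
    and commute: "\<And>X Y. X \<in> obj C \<Longrightarrow> Y \<in> E \<Longrightarrow> isomorphic C (X \<otimes> Y) (Y \<otimes> X)"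
begin

interpretation D: tensor_subcategory_of C D
  by (intro tensor_subcategory_of.intro finite_tensor_category_axioms D)

interpretation E: tensor_subcategory_of C E
  by (intro tensor_subcategory_of.intro finite_tensor_category_axioms E)

definition "product_objects = {d \<otimes> b | d b. d \<in> D \<and> b \<in> E}"

lemma product_objects_isomorphic:
  assumes "d \<in> D" "b \<in> E" "isomorphic C (d \<otimes> b) X"
  shows "X \<in> subquotients C product_objects"
  using assms D.sub_obj E.sub_obj
  by (intro subquotients_isomorphic[OF subquotients_gen assms(3)]) (auto simp: product_objects_def)

text \<open>The expected dual of \<open>d \<otimes> b\<close> is \<open>b' \<otimes> d'\<close>. The
  associator compares tensoring with \<open>d \<otimes> b\<close> and tensoring with
  \<open>b\<close> and then \<open>d\<close>; its mate is, up to unit factors, an epi from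
  \<open>b' \<otimes> d'\<close> to \<open>Y\<close>, which suffices. \<open>commute\<close>
  restores the order of the factors.\<close>

lemma product_objects_left_dual:
  assumes d: "d \<in> D" and b: "b \<in> E" and dual: "dual_pair C Y (d \<otimes> b)"
  shows "Y \<in> subquotients C product_objects"
proof -
  have o: "d \<in> obj C" "b \<in> obj C" "Y \<in> obj C"
    using D.sub_obj[OF d] E.sub_obj[OF b] dual by (auto simp: dual_pair_def)
  obtain d' evd cod where d': "dual_pair C d' d" "left.weakly_dual d' d evd cod" using o(1) by (rule dualsE)
  obtain b' evb cob where b': "dual_pair C b' b" "left.weakly_dual b' b evb cob" using o(2) by (rule dualsE)
  have dD: "d' \<in> D" and bE: "b' \<in> E" using D.sub.left_dual[OF d d'(1)] E.sub.left_dual[OF b b'(1)] .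
  note o' = D.sub_obj[OF dD] E.sub_obj[OF bE]
  obtain ev co where w: "left.weakly_dual Y (d \<otimes> b) ev co" using dual_pair_weakly_dual[OF dual] by blast
  obtain \<Phi> where a: "adjunction C (\<lambda>U. Y \<otimes> U) (\<lambda>Z. d \<otimes> b \<otimes> Z) (\<lambda>f. ident C Y \<odot> f)
      (\<lambda>f. ident C (d \<otimes> b) \<odot> f) \<Phi>" using w by (rule left_adjunction)
  obtain \<Phi>d where ad: "adjunction C (\<lambda>U. d' \<otimes> U) (\<lambda>Z. d \<otimes> Z) (\<lambda>f. ident C d' \<odot> f) (\<lambda>f. ident C d \<odot> f) \<Phi>d"
    using d'(2) by (rule left_adjunction)
  obtain \<Phi>b where ab: "adjunction C (\<lambda>U. b' \<otimes> U) (\<lambda>Z. b \<otimes> Z) (\<lambda>f. ident C b' \<odot> f) (\<lambda>f. ident C b \<odot> f) \<Phi>b"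
    using b'(2) by (rule left_adjunction)
  have "\<exists>\<psi> \<in> hom C (b' \<otimes> (d' \<otimes> \<one>)) (Y \<otimes> \<one>). is_epi C \<psi>"
  proof (rule adjunction_comparison_epi[OF a adjunction_comp[OF ab ad], of "assoc C d b"])
    show "assoc C d b Z \<in> hom C (d \<otimes> b \<otimes> Z) (d \<otimes> (b \<otimes> Z)) \<and> is_mono C (assoc C d b Z)" if "Z \<in> obj C" for Z
      using that o assoc_hom iso_mono assoc_iso by blast
    show "assoc C d b Z' \<cdot> (ident C (d \<otimes> b) \<odot> f) = (ident C d \<odot> (ident C b \<odot> f)) \<cdot> assoc C d b Z"
      if "f \<in> hom C Z Z'" for f Z Z'
      using assoc_natural[OF ident_hom[OF o(1)] ident_hom[OF o(2)] that] o by simp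
  qed (rule unit_obj)
  then obtain \<psi> where \<psi>: "\<psi> \<in> hom C (b' \<otimes> (d' \<otimes> \<one>)) (Y \<otimes> \<one>)" "is_epi C \<psi>" by blast
  have "isomorphic C (d' \<otimes> b') (b' \<otimes> d')" using commute o' bE by blast
  also have "isomorphic C (b' \<otimes> d') (b' \<otimes> (d' \<otimes> \<one>))"
    using o' by (intro isomorphic_tensor isomorphic_refl isomorphic_sym[OF isomorphic_runit])
  finally have "b' \<otimes> (d' \<otimes> \<one>) \<in> subquotients C product_objects"
    by (rule product_objects_isomorphic[OF dD bE])
  then have "Y \<otimes> \<one> \<in> subquotients C product_objects" using \<psi> subquotients_quot by blast
  then show ?thesis using subquotients_isomorphic isomorphic_runit[OF o(3)] by blast
qed

text \<open>The mirror image of \<open>product_objects_left_dual\<close>, with tensoring from the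
  right and the inverse associator.\<close>

lemma product_objects_right_dual:
  assumes d: "d \<in> D" and b: "b \<in> E" and dual: "dual_pair C (d \<otimes> b) Y"
  shows "Y \<in> subquotients C product_objects"
proof -
  have o: "d \<in> obj C" "b \<in> obj C" "Y \<in> obj C"
    using D.sub_obj[OF d] E.sub_obj[OF b] dual by (auto simp: dual_pair_def)
  obtain d' evd cod where d': "dual_pair C d d'" "left.weakly_dual d d' evd cod" using o(1) by (rule dualsE)
  obtain b' evb cob where b': "dual_pair C b b'" "left.weakly_dual b b' evb cob" using o(2) by (rule dualsE)
  have dD: "d' \<in> D" and bE: "b' \<in> E" using D.sub.right_dual[OF d d'(1)] E.sub.right_dual[OF b b'(1)] .
  note o' = D.sub_obj[OF dD] E.sub_obj[OF bE]
  obtain ev co where w: "left.weakly_dual (d \<otimes> b) Y ev co" using dual_pair_weakly_dual[OF dual] by blast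
  obtain \<Phi> where a: "adjunction C (\<lambda>U. U \<otimes> Y) (\<lambda>Z. Z \<otimes> (d \<otimes> b)) (\<lambda>f. f \<odot> ident C Y)
      (\<lambda>f. f \<odot> ident C (d \<otimes> b)) \<Phi>" using w by (rule right_adjunction)
  obtain \<Phi>d where ad: "adjunction C (\<lambda>U. U \<otimes> d') (\<lambda>Z. Z \<otimes> d) (\<lambda>f. f \<odot> ident C d') (\<lambda>f. f \<odot> ident C d) \<Phi>d"
    using d'(2) by (rule right_adjunction)
  obtain \<Phi>b where ab: "adjunction C (\<lambda>U. U \<otimes> b') (\<lambda>Z. Z \<otimes> b) (\<lambda>f. f \<odot> ident C b') (\<lambda>f. f \<odot> ident C b) \<Phi>b"
    using b'(2) by (rule right_adjunction)
  have "\<exists>\<psi> \<in> hom C (\<one> \<otimes> b' \<otimes> d') (\<one> \<otimes> Y). is_epi C \<psi>"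
  proof (rule adjunction_comparison_epi[OF a adjunction_comp[OF ad ab], of "\<lambda>Z. inverse_mor C (assoc C Z d b)"])
    show "inverse_mor C (assoc C Z d b) \<in> hom C (Z \<otimes> (d \<otimes> b)) (Z \<otimes> d \<otimes> b) \<and>
        is_mono C (inverse_mor C (assoc C Z d b))" if "Z \<in> obj C" for Z
      using that o by (auto simp: hom_def intro!: iso_mono)
    show "inverse_mor C (assoc C Z' d b) \<cdot> (f \<odot> ident C (d \<otimes> b)) =
        (f \<odot> ident C d \<odot> ident C b) \<cdot> inverse_mor C (assoc C Z d b)"
      if "f \<in> hom C Z Z'" for f Z Z'
      using right.A_natural[OF ident_hom[OF o(2)] ident_hom[OF o(1)] that] o by simp
  qed (rule unit_obj)
  then obtain \<psi> where \<psi>: "\<psi> \<in> hom C (\<one> \<otimes> b' \<otimes> d') (\<one> \<otimes> Y)" "is_epi C \<psi>" by blast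
  have "isomorphic C (d' \<otimes> b') (b' \<otimes> d')" using commute o' bE by blast
  also have "isomorphic C (b' \<otimes> d') (\<one> \<otimes> b' \<otimes> d')"
    using o' by (intro isomorphic_tensor isomorphic_refl isomorphic_sym[OF isomorphic_lunit])
  finally have "\<one> \<otimes> b' \<otimes> d' \<in> subquotients C product_objects"
    by (rule product_objects_isomorphic[OF dD bE])
  then have "\<one> \<otimes> Y \<in> subquotients C product_objects" using \<psi> subquotients_quot by blast
  then show ?thesis using subquotients_isomorphic isomorphic_lunit[OF o(3)] by blast
qed

lemma product_objects_generators: "tensor_generators C product_objects"
proof (intro tensor_generators.intro finite_tensor_category_axioms tensor_generators_axioms.intro)
  show "product_objects \<subseteq> obj C"
    using D.sub_obj E.sub_obj by (auto simp: product_objects_def)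
  show "\<one> \<in> subquotients C product_objects"
    using product_objects_isomorphic[OF D.sub.unit E.sub.unit] isomorphic_lunit[OF unit_obj] by blast
  fix g assume "g \<in> product_objects"
  then obtain d b where g: "g = d \<otimes> b" "d \<in> D" "b \<in> E" by (auto simp: product_objects_def)
  note o = D.sub_obj[OF g(2)] E.sub_obj[OF g(3)]
  show "Y \<in> subquotients C product_objects" if "dual_pair C Y g" for Y
    using product_objects_left_dual[OF g(2,3)] that g(1) by blast
  show "Y \<in> subquotients C product_objects" if "dual_pair C g Y" for Y
    using product_objects_right_dual[OF g(2,3)] that g(1) by blast
  fix h assume "h \<in> product_objects"
  then obtain d' b' where h: "h = d' \<otimes> b'" "d' \<in> D" "b' \<in> E" by (auto simp: product_objects_def)
  note o' = D.sub_obj[OF h(2)] E.sub_obj[OF h(3)]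
  \<comment> \<open>Only the middle factors change places: \<open>commute\<close> applies because
    \<open>b\<close> lies in \<open>E\<close>, whatever \<open>d'\<close> is.\<close>
  have "isomorphic C (d \<otimes> d' \<otimes> (b \<otimes> b')) (d \<otimes> (d' \<otimes> (b \<otimes> b')))"
    using o o' by (intro isomorphic_assoc) auto
  also have "isomorphic C \<dots> (d \<otimes> (d' \<otimes> b \<otimes> b'))"
    using o o' by (intro isomorphic_tensor isomorphic_refl isomorphic_sym[OF isomorphic_assoc])
  also have "isomorphic C \<dots> (d \<otimes> (b \<otimes> d' \<otimes> b'))"
    using o o' g(3) by (intro isomorphic_tensor isomorphic_refl commute)
  also have "isomorphic C \<dots> (d \<otimes> (b \<otimes> (d' \<otimes> b')))"
    using o o' by (intro isomorphic_tensor isomorphic_refl isomorphic_assoc)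
  also have "isomorphic C \<dots> (d \<otimes> b \<otimes> (d' \<otimes> b'))"
    using o o' by (intro isomorphic_sym[OF isomorphic_assoc]) auto
  finally show "g \<otimes> h \<in> subquotients C product_objects"
    unfolding g(1) h(1)
    using product_objects_isomorphic[OF D.sub.tensor[OF g(2) h(2)] E.sub.tensor[OF g(3) h(3)]] by blast
  fix S assume S: "is_direct_sum C g h S"
  \<comment> \<open>The direct sum of \<open>d \<otimes> b\<close> and
    \<open>d' \<otimes> b'\<close> sits as the diagonal part in \<open>T \<otimes> T'\<close>, which
    is again a product of an object of \<open>D\<close> and one of \<open>E\<close>.\<close>
  obtain T where T: "is_direct_sum C d d' T" using direct_sum o o' by blast
  obtain i j p q where s: "i \<in> hom C d T" "j \<in> hom C d' T" "p \<in> hom C T d" "q \<in> hom C T d'"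
    "p \<cdot> i = ident C d" "q \<cdot> j = ident C d'" "p \<cdot> j = zero_mor C d' d" "q \<cdot> i = zero_mor C d d'"
    using T by (rule direct_sumE)
  obtain T' where T': "is_direct_sum C b b' T'" using direct_sum o o' by blast
  obtain i' j' p' q' where s': "i' \<in> hom C b T'" "j' \<in> hom C b' T'" "p' \<in> hom C T' b" "q' \<in> hom C T' b'"
    "p' \<cdot> i' = ident C b" "q' \<cdot> j' = ident C b'" "p' \<cdot> j' = zero_mor C b' b" "q' \<cdot> i' = zero_mor C b b'"
    using T' by (rule direct_sumE)
  note ss = s(1-4)[THEN homD(1)] s(1-4)[THEN homD(2)] s(1-4)[THEN homD(3)]
    s'(1-4)[THEN homD(1)] s'(1-4)[THEN homD(2)] s'(1-4)[THEN homD(3)]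
  have "(p \<odot> p') \<cdot> (i \<odot> i') = ident C g" "(q \<odot> q') \<cdot> (j \<odot> j') = ident C h"
    "(p \<odot> p') \<cdot> (j \<odot> j') = zero_mor C h g" "(q \<odot> q') \<cdot> (i \<odot> i') = zero_mor C g h"
    using ss s s' o o' by (simp_all add: left.M_cmp_mor g(1) h(1) tensor_zero_left)
  then obtain f where f: "f \<in> hom C S (T \<otimes> T')" "is_mono C f"
    using direct_sum_embed[OF S, of "i \<odot> i'" "T \<otimes> T'" "j \<odot> j'" "p \<odot> p'" g "q \<odot> q'" h]
      tensM_hom s s' iso_mono[OF is_iso_ident] o o' g(1) h(1) tensO_obj by metis
  have "T \<otimes> T' \<in> subquotients C product_objects"
    using D.sub.direct_sum[OF g(2) h(2) T] E.sub.direct_sum[OF g(3) h(3) T'] D.sub_obj E.sub_obj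
    by (intro subquotients_gen) (auto simp: product_objects_def)
  then show "S \<in> subquotients C product_objects" using f subquotients_sub by blast
qed

lemma join_is_quotient:
  assumes "X \<in> D \<^bold>\<or> E"
  shows "\<exists>d \<in> D. \<exists>b \<in> E. \<exists>e \<in> hom C (d \<otimes> b) X. is_epi C e"
proof -
  interpret G: tensor_generators C product_objects by (rule product_objects_generators)
  have "tensor_subcategory C (subquotients C product_objects)" ..
  moreover have "D \<subseteq> subquotients C product_objects"
    using product_objects_isomorphic[OF _ E.sub.unit] isomorphic_runit D.sub_obj by blast
  moreover have "E \<subseteq> subquotients C product_objects"
    using product_objects_isomorphic[OF D.sub.unit] isomorphic_lunit E.sub_obj by blast
  ultimately have "X \<in> subquotients C product_objects"
    using assms unfolding tsub_join_def by blast
  then show ?thesis using G.subquotient_is_quotient by (force simp: product_objects_def)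
qed

end

text \<open>Stated for any \<open>E\<close> whose objects commute with all objects up to
  isomorphism, which separates the lattice argument from braidings and functors.\<close>

theorem modular_law:
  assumes D1: "tensor_subcategory C D\<^sub>1" and D2: "tensor_subcategory C D\<^sub>2" and E: "tensor_subcategory C E"
    and commute: "\<And>X Y. X \<in> obj C \<Longrightarrow> Y \<in> E \<Longrightarrow> isomorphic C (X \<otimes> Y) (Y \<otimes> X)"
    and sub: "D\<^sub>1 \<subseteq> D\<^sub>2"
  shows "D\<^sub>1 \<^bold>\<or> (E \<^bold>\<and> D\<^sub>2) = (D\<^sub>1 \<^bold>\<or> E) \<^bold>\<and> D\<^sub>2"
proof (intro equalityI subsetI)
  fix X assume "X \<in> D\<^sub>1 \<^bold>\<or> (E \<^bold>\<and> D\<^sub>2)"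
  then show "X \<in> (D\<^sub>1 \<^bold>\<or> E) \<^bold>\<and> D\<^sub>2"
    \<comment> \<open>Because \<open>D\<^sub>1\<close> is contained in \<open>D\<^sub>2\<close>, the
      tensor subcategory \<open>D\<^sub>2\<close> itself takes part in the intersection on the
      left.\<close>
    unfolding tsub_join_def tsub_meet_def using D2 sub by blast
next
  fix X assume "X \<in> (D\<^sub>1 \<^bold>\<or> E) \<^bold>\<and> D\<^sub>2"
  then have X1: "X \<in> D\<^sub>1 \<^bold>\<or> E" and X2: "X \<in> D\<^sub>2" by (auto simp: tsub_meet_def)
  interpret D1: tensor_subcategory_of C D\<^sub>1
    by (intro tensor_subcategory_of.intro finite_tensor_category_axioms D1)
  interpret D2: tensor_subcategory_of C D\<^sub>2
    by (intro tensor_subcategory_of.intro finite_tensor_category_axioms D2)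
  interpret E: tensor_subcategory_of C E
    by (intro tensor_subcategory_of.intro finite_tensor_category_axioms E)
  obtain d b e where d: "d \<in> D\<^sub>1" and b: "b \<in> E" and e: "e \<in> hom C (d \<otimes> b) X" "is_epi C e"
    using join_is_quotient[OF D1 E commute X1] by blast
  note o = D1.sub_obj[OF d] E.sub_obj[OF b] D2.sub_obj[OF X2]
  obtain d' ev co where d': "dual_pair C d d'" "left.weakly_dual d d' ev co"
    using o(1) by (rule dualsE)
  have d'X: "d' \<otimes> X \<in> D\<^sub>2" using D2.sub.tensor X2 D1.sub.right_dual[OF d d'(1)] sub by blast
  obtain \<Phi> where "adjunction C (\<lambda>U. d \<otimes> U) (\<lambda>Z. d' \<otimes> Z) (\<lambda>f. ident C d \<odot> f) (\<lambda>f. ident C d' \<odot> f) \<Phi>"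
    using d'(2) by (rule left_adjunction)
  then interpret A: adjunction C "\<lambda>U. d \<otimes> U" "\<lambda>Z. d' \<otimes> Z" "\<lambda>f. ident C d \<odot> f" "\<lambda>f. ident C d' \<odot> f" \<Phi> .
  obtain b' \<epsilon> m where im: "\<epsilon> \<in> hom C b b'" "is_epi C \<epsilon>" "m \<in> hom C b' (d' \<otimes> X)" "is_mono C m"
    "m \<cdot> \<epsilon> = \<Phi> b X e"
    using A.transpose_hom[OF o(2) e(1)] by (rule image_factorization)
  have b': "b' \<in> E" "b' \<in> D\<^sub>2" using E.quot_hom[OF im(1,2) b] D2.sub_hom[OF im(3,4) d'X] .
  note ob' = E.sub_obj[OF b'(1)]
  obtain m' where m': "m' \<in> hom C (d \<otimes> b') X" "\<Phi> b' X m' = m"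
    using A.transpose_surj[OF o(3) im(3)] by blast
  have d\<epsilon>: "ident C d \<odot> \<epsilon> \<in> hom C (d \<otimes> b) (d \<otimes> b')" using tensM_hom[OF ident_hom[OF o(1)] im(1)] .
  \<comment> \<open>Transposed back, the factorization through \<open>b'\<close> becomes a
    factorization of the epi \<open>e\<close> through \<open>m'\<close>, so \<open>m'\<close> is epi
    as well.\<close>
  have "\<Phi> b X (m' \<cdot> (ident C d \<odot> \<epsilon>)) = \<Phi> b X e"
    using A.transpose_left[OF im(1) m'(1)] m'(2) im(5) by simp
  then have "m' \<cdot> (ident C d \<odot> \<epsilon>) = e"
    using A.transpose_inj[OF o(2) cmp_hom[OF d\<epsilon> m'(1)] e(1)] by blast
  then have m'_epi: "is_epi C m'" using epi_cancel[OF _ d\<epsilon> m'(1)] e(2) by simp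
  show "X \<in> D\<^sub>1 \<^bold>\<or> (E \<^bold>\<and> D\<^sub>2)"
    unfolding tsub_join_def
  proof (rule InterI)
    fix H assume "H \<in> {H. tensor_subcategory C H \<and> D\<^sub>1 \<subseteq> H \<and> E \<^bold>\<and> D\<^sub>2 \<subseteq> H}"
    then have H: "tensor_subcategory C H" and dH: "d \<in> H" and bH: "b' \<in> H"
      using d b' by (auto simp: tsub_meet_def)
    interpret H: tensor_subcategory_of C H
      by (intro tensor_subcategory_of.intro finite_tensor_category_axioms H)
    show "X \<in> H" using H.quot_hom[OF m'(1) m'_epi H.sub.tensor[OF dH bH]] .
  qed
qed

end

section \<open>The essential image of a fully faithful tensor functor\<close>

locale fully_faithful_tensor_functor = C: finite_tensor_category C + B: finite_tensor_category B
  for C :: "('o, 'm, 'k::field, 'z) lin_mon_cat_scheme"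
    and B :: "('p, 'n, 'k, 'y) lin_mon_cat_scheme" +
  fixes F :: "('p, 'n, 'o, 'm) mon_functor"
  assumes tensor_functor: "tensor_functor B C F"
    and fully_faithful: "fully_faithful B C F"
begin

lemma is_functor: "is_functor B C F"
  and exact: "\<And>f g. short_exact B f g \<Longrightarrow> short_exact C (fmor F f) (fmor F g)"
  and linear: "linear_functor B C F"
  and strong: "strong_monoidal_functor B C F"
  using tensor_functor by (auto simp: tensor_functor_def exact_functor_def)

lemma F_obj [simp]: "b \<in> obj B \<Longrightarrow> fobj F b \<in> obj C"
  using is_functor by (simp add: is_functor_def)

lemma F_hom: "f \<in> hom B b b' \<Longrightarrow> fmor F f \<in> hom C (fobj F b) (fobj F b')"
  using is_functor by (simp add: is_functor_def)

lemma F_mor [simp]: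
  assumes "f \<in> mor B"
  shows "fmor F f \<in> mor C" "src C (fmor F f) = fobj F (src B f)" "tgt C (fmor F f) = fobj F (tgt B f)"
  using F_hom[of f "src B f" "tgt B f"] assms by (auto simp: hom_def)

lemma F_ident: "b \<in> obj B \<Longrightarrow> fmor F (ident B b) = ident C (fobj F b)"
  using is_functor by (simp add: is_functor_def)

lemma F_cmp:
  "f \<in> mor B \<Longrightarrow> g \<in> mor B \<Longrightarrow> tgt B f = src B g \<Longrightarrow> fmor F (g \<cdot>\<^bsub>B\<^esub> f) = fmor F g \<cdot>\<^bsub>C\<^esub> fmor F f"
  using is_functor unfolding is_functor_def by (auto simp: hom_def)

lemma F_zero:
  assumes "b \<in> obj B" "b' \<in> obj B"
  shows "fmor F (zero_mor B b b') = zero_mor C (fobj F b) (fobj F b')"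
proof -
  note z = B.zero_hom[OF assms]
  have "fmor F (0 \<star>\<^bsub>B\<^esub> zero_mor B b b') = 0 \<star>\<^bsub>C\<^esub> fmor F (zero_mor B b b')"
    using linear assms unfolding linear_functor_def by simp
  then show ?thesis unfolding B.scale_zero[OF z] C.scale_zero[OF F_hom[OF z]] .
qed

lemma F_iso:
  assumes "is_iso B f"
  shows "is_iso C (fmor F f)"
proof -
  note f = B.is_iso_mor[OF assms]
  show ?thesis
    using assms f F_cmp[of f "inverse_mor B f"] F_cmp[of "inverse_mor B f" f]
    by (intro C.is_isoI[of _ "fobj F (src B f)" "fobj F (tgt B f)" "fmor F (inverse_mor B f)"])
      (auto simp: hom_def F_ident)
qed

lemma F_full:
  assumes "g \<in> hom C (fobj F b) (fobj F b')" "b \<in> obj B" "b' \<in> obj B"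
  obtains f where "f \<in> hom B b b'" "fmor F f = g"
proof -
  have "g \<in> fmor F ` hom B b b'"
    using fully_faithful assms unfolding fully_faithful_def bij_betw_def by blast
  then show thesis using that by blast
qed

lemma fmult [simp]:
  assumes "b \<in> obj B" "b' \<in> obj B"
  shows "fmult F b b' \<in> mor C" "src C (fmult F b b') = fobj F b \<otimes>\<^bsub>C\<^esub> fobj F b'"
    "tgt C (fmult F b b') = fobj F (b \<otimes>\<^bsub>B\<^esub> b')" "is_iso C (fmult F b b')"
  using strong assms by (auto simp: strong_monoidal_functor_def hom_def)

lemma funit [simp]:
  "funit F \<in> mor C" "src C (funit F) = \<one>\<^bsub>C\<^esub>" "tgt C (funit F) = fobj F \<one>\<^bsub>B\<^esub>" "is_iso C (funit F)"
  using strong by (auto simp: strong_monoidal_functor_def hom_def)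

lemma fmult_natural:
  "f \<in> mor B \<Longrightarrow> g \<in> mor B \<Longrightarrow> fmult F (tgt B f) (tgt B g) \<cdot>\<^bsub>C\<^esub> (fmor F f \<odot>\<^bsub>C\<^esub> fmor F g) =
    fmor F (f \<odot>\<^bsub>B\<^esub> g) \<cdot>\<^bsub>C\<^esub> fmult F (src B f) (src B g)"
  using strong unfolding strong_monoidal_functor_def by (auto simp: hom_def)

lemma fmult_assoc:
  assumes "X \<in> obj B" "Y \<in> obj B" "Z \<in> obj B"
  shows "fmor F (assoc B X Y Z) \<cdot>\<^bsub>C\<^esub> (fmult F (X \<otimes>\<^bsub>B\<^esub> Y) Z \<cdot>\<^bsub>C\<^esub> (fmult F X Y \<odot>\<^bsub>C\<^esub> ident C (fobj F Z))) =
    fmult F X (Y \<otimes>\<^bsub>B\<^esub> Z) \<cdot>\<^bsub>C\<^esub> ((ident C (fobj F X) \<odot>\<^bsub>C\<^esub> fmult F Y Z) \<cdot>\<^bsub>C\<^esub>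
      assoc C (fobj F X) (fobj F Y) (fobj F Z))"
  using strong assms unfolding strong_monoidal_functor_def by simp

text \<open>\<open>ev'\<close> and \<open>coev'\<close> are the images under \<open>F\<close>,
  adjusted by \<open>fmult\<close> and \<open>funit\<close>. Each of their zigzags is
  \<open>F\<close> of a zigzag in \<open>B\<close> between isomorphisms \<open>l\<close> and
  \<open>r\<close>, so its invertibility is inherited.\<close>

lemma weakly_dual_F:
  assumes "B.left.weakly_dual y x ev coev"
  shows "\<exists>ev' coev'. C.left.weakly_dual (fobj F y) (fobj F x) ev' coev'"
proof -
  have o [simp]: "x \<in> obj B" "y \<in> obj B"
    and ev [simp]: "ev \<in> mor B" "src B ev = y \<otimes>\<^bsub>B\<^esub> x" "tgt B ev = \<one>\<^bsub>B\<^esub>"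
    and coev [simp]: "coev \<in> mor B" "src B coev = \<one>\<^bsub>B\<^esub>" "tgt B coev = x \<otimes>\<^bsub>B\<^esub> y"
    and z: "is_iso B ((ident B x \<odot>\<^bsub>B\<^esub> ev) \<cdot>\<^bsub>B\<^esub> (assoc B x y x \<cdot>\<^bsub>B\<^esub> (coev \<odot>\<^bsub>B\<^esub> ident B x)))"
      "is_iso B ((ev \<odot>\<^bsub>B\<^esub> ident B y) \<cdot>\<^bsub>B\<^esub> (inverse_mor B (assoc B y x y) \<cdot>\<^bsub>B\<^esub> (ident B y \<odot>\<^bsub>B\<^esub> coev)))"
    using assms by (auto simp: B.left.weakly_dual_def hom_def)
  define X Y u where "X = fobj F x" and "Y = fobj F y" and "u = funit F"
  have XY [simp]: "X \<in> obj C" "Y \<in> obj C" and u [simp]: "u \<in> mor C" "src C u = \<one>\<^bsub>C\<^esub>"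
    "tgt C u = fobj F \<one>\<^bsub>B\<^esub>" "is_iso C u" by (simp_all add: X_def Y_def u_def)
  have Xx: "fobj F x = X" "fobj F y = Y" by (simp_all add: X_def Y_def)
  define ev' coev' where "ev' = inverse_mor C u \<cdot>\<^bsub>C\<^esub> (fmor F ev \<cdot>\<^bsub>C\<^esub> fmult F y x)"
    and "coev' = inverse_mor C (fmult F x y) \<cdot>\<^bsub>C\<^esub> (fmor F coev \<cdot>\<^bsub>C\<^esub> u)"
  have ev' [simp]: "ev' \<in> mor C" "src C ev' = Y \<otimes>\<^bsub>C\<^esub> X" "tgt C ev' = \<one>\<^bsub>C\<^esub>"
    and coev' [simp]: "coev' \<in> mor C" "src C coev' = \<one>\<^bsub>C\<^esub>" "tgt C coev' = X \<otimes>\<^bsub>C\<^esub> Y"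
    by (simp_all add: ev'_def coev'_def Xx)
  define \<mu> where "\<mu> = fmult F"
  have \<mu> [simp]: "\<mu> b b' \<in> mor C" "src C (\<mu> b b') = fobj F b \<otimes>\<^bsub>C\<^esub> fobj F b'"
    "tgt C (\<mu> b b') = fobj F (b \<otimes>\<^bsub>B\<^esub> b')" "is_iso C (\<mu> b b')" if "b \<in> obj B" "b' \<in> obj B" for b b'
    using that by (simp_all add: \<mu>_def)
  \<comment> \<open>Naturality solved for \<open>F\<close> of a tensor product, so that
    \<open>F\<close> can be pushed inwards through the zigzags; \<open>assoc_F\<close> does the same
    for associators.\<close>
  have shift: "fmor F (f \<odot>\<^bsub>B\<^esub> g) = \<mu> (tgt B f) (tgt B g) \<cdot>\<^bsub>C\<^esub> ((fmor F f \<odot>\<^bsub>C\<^esub> fmor F g) \<cdot>\<^bsub>C\<^esub>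
      inverse_mor C (\<mu> (src B f) (src B g)))" if "f \<in> mor B" "g \<in> mor B" for f g
  proof -
    have "(fmor F (f \<odot>\<^bsub>B\<^esub> g) \<cdot>\<^bsub>C\<^esub> \<mu> (src B f) (src B g)) \<cdot>\<^bsub>C\<^esub> inverse_mor C (\<mu> (src B f) (src B g)) =
        fmor F (f \<odot>\<^bsub>B\<^esub> g)" using that by simp
    then show ?thesis
      using that unfolding \<mu>_def fmult_natural[OF that, symmetric] by simp
  qed
  have assoc_F: "fmor F (assoc B a b c) = \<mu> a (b \<otimes>\<^bsub>B\<^esub> c) \<cdot>\<^bsub>C\<^esub> ((ident C (fobj F a) \<odot>\<^bsub>C\<^esub> \<mu> b c) \<cdot>\<^bsub>C\<^esub>
      (assoc C (fobj F a) (fobj F b) (fobj F c) \<cdot>\<^bsub>C\<^esub>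
      ((inverse_mor C (\<mu> a b) \<odot>\<^bsub>C\<^esub> ident C (fobj F c)) \<cdot>\<^bsub>C\<^esub> inverse_mor C (\<mu> (a \<otimes>\<^bsub>B\<^esub> b) c))))"
    if "a \<in> obj B" "b \<in> obj B" "c \<in> obj B" for a b c
  proof -
    let ?r = "(inverse_mor C (\<mu> a b) \<odot>\<^bsub>C\<^esub> ident C (fobj F c)) \<cdot>\<^bsub>C\<^esub> inverse_mor C (\<mu> (a \<otimes>\<^bsub>B\<^esub> b) c)"
    have "(fmor F (assoc B a b c) \<cdot>\<^bsub>C\<^esub> (\<mu> (a \<otimes>\<^bsub>B\<^esub> b) c \<cdot>\<^bsub>C\<^esub> (\<mu> a b \<odot>\<^bsub>C\<^esub> ident C (fobj F c)))) \<cdot>\<^bsub>C\<^esub> ?r =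
        fmor F (assoc B a b c)" using that by (simp add: C.left.M_cmp_mor')
    then show ?thesis
      using that fmult_assoc[OF that] unfolding \<mu>_def[symmetric] by simp
  qed
  have assoc_F_inv: "fmor F (inverse_mor B (assoc B a b c)) = \<mu> (a \<otimes>\<^bsub>B\<^esub> b) c \<cdot>\<^bsub>C\<^esub>
      ((\<mu> a b \<odot>\<^bsub>C\<^esub> ident C (fobj F c)) \<cdot>\<^bsub>C\<^esub> (inverse_mor C (assoc C (fobj F a) (fobj F b) (fobj F c)) \<cdot>\<^bsub>C\<^esub>
      ((ident C (fobj F a) \<odot>\<^bsub>C\<^esub> inverse_mor C (\<mu> b c)) \<cdot>\<^bsub>C\<^esub> inverse_mor C (\<mu> a (b \<otimes>\<^bsub>B\<^esub> c)))))"
    (is "_ = ?rhs") if o: "a \<in> obj B" "b \<in> obj B" "c \<in> obj B" for a b c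
  proof -
    have 1: "inverse_of C (fmor F (assoc B a b c)) (fmor F (inverse_mor B (assoc B a b c)))"
      using o F_cmp[of "assoc B a b c" "inverse_mor B (assoc B a b c)"]
        F_cmp[of "inverse_mor B (assoc B a b c)" "assoc B a b c"]
      by (simp add: inverse_of_def hom_def F_ident)
    have 2: "inverse_of C (fmor F (assoc B a b c)) ?rhs"
      using o unfolding inverse_of_def assoc_F[OF o]
      by (auto simp: hom_def C.left.M_cmp_mor C.left.M_cmp_mor')
    show ?thesis using C.inverse_of_unique[OF 1 2] .
  qed
  have iso1: "is_iso C ((ident C X \<odot>\<^bsub>C\<^esub> ev') \<cdot>\<^bsub>C\<^esub> (assoc C X Y X \<cdot>\<^bsub>C\<^esub> (coev' \<odot>\<^bsub>C\<^esub> ident C X)))"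
  proof -
    define l r where "l = (ident C X \<odot>\<^bsub>C\<^esub> inverse_mor C u) \<cdot>\<^bsub>C\<^esub> inverse_mor C (\<mu> x \<one>\<^bsub>B\<^esub>)"
      and "r = \<mu> \<one>\<^bsub>B\<^esub> x \<cdot>\<^bsub>C\<^esub> (u \<odot>\<^bsub>C\<^esub> ident C X)"
    have lr: "is_iso C l" "is_iso C r" "l \<in> mor C" "r \<in> mor C" "src C l = fobj F (x \<otimes>\<^bsub>B\<^esub> \<one>\<^bsub>B\<^esub>)"
      "tgt C r = fobj F (\<one>\<^bsub>B\<^esub> \<otimes>\<^bsub>B\<^esub> x)" by (simp_all add: l_def r_def Xx)
    have "l \<cdot>\<^bsub>C\<^esub> (fmor F ((ident B x \<odot>\<^bsub>B\<^esub> ev) \<cdot>\<^bsub>B\<^esub> (assoc B x y x \<cdot>\<^bsub>B\<^esub> (coev \<odot>\<^bsub>B\<^esub> ident B x))) \<cdot>\<^bsub>C\<^esub> r) =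
        (ident C X \<odot>\<^bsub>C\<^esub> ev') \<cdot>\<^bsub>C\<^esub> (assoc C X Y X \<cdot>\<^bsub>C\<^esub> (coev' \<odot>\<^bsub>C\<^esub> ident C X))"
      unfolding l_def r_def ev'_def coev'_def \<mu>_def[symmetric]
      by (simp add: F_cmp shift assoc_F F_ident Xx C.left.M_cmp_mor C.left.M_cmp_mor')
    moreover have "is_iso C (l \<cdot>\<^bsub>C\<^esub> (fmor F ((ident B x \<odot>\<^bsub>B\<^esub> ev) \<cdot>\<^bsub>B\<^esub> (assoc B x y x \<cdot>\<^bsub>B\<^esub> (coev \<odot>\<^bsub>B\<^esub> ident B x))) \<cdot>\<^bsub>C\<^esub> r))"
      using F_iso[OF z(1)] lr by simp
    ultimately show ?thesis by simp
  qed
  have iso2: "is_iso C ((ev' \<odot>\<^bsub>C\<^esub> ident C Y) \<cdot>\<^bsub>C\<^esub> (inverse_mor C (assoc C Y X Y) \<cdot>\<^bsub>C\<^esub> (ident C Y \<odot>\<^bsub>C\<^esub> coev')))"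
  proof -
    define l r where "l = (inverse_mor C u \<odot>\<^bsub>C\<^esub> ident C Y) \<cdot>\<^bsub>C\<^esub> inverse_mor C (\<mu> \<one>\<^bsub>B\<^esub> y)"
      and "r = \<mu> y \<one>\<^bsub>B\<^esub> \<cdot>\<^bsub>C\<^esub> (ident C Y \<odot>\<^bsub>C\<^esub> u)"
    have lr: "is_iso C l" "is_iso C r" "l \<in> mor C" "r \<in> mor C" "src C l = fobj F (\<one>\<^bsub>B\<^esub> \<otimes>\<^bsub>B\<^esub> y)"
      "tgt C r = fobj F (y \<otimes>\<^bsub>B\<^esub> \<one>\<^bsub>B\<^esub>)" by (simp_all add: l_def r_def Xx)
    have "l \<cdot>\<^bsub>C\<^esub> (fmor F ((ev \<odot>\<^bsub>B\<^esub> ident B y) \<cdot>\<^bsub>B\<^esub> (inverse_mor B (assoc B y x y) \<cdot>\<^bsub>B\<^esub> (ident B y \<odot>\<^bsub>B\<^esub> coev))) \<cdot>\<^bsub>C\<^esub> r) =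
        (ev' \<odot>\<^bsub>C\<^esub> ident C Y) \<cdot>\<^bsub>C\<^esub> (inverse_mor C (assoc C Y X Y) \<cdot>\<^bsub>C\<^esub> (ident C Y \<odot>\<^bsub>C\<^esub> coev'))"
      unfolding l_def r_def ev'_def coev'_def \<mu>_def[symmetric]
      by (simp add: F_cmp shift assoc_F_inv F_ident Xx C.left.M_cmp_mor C.left.M_cmp_mor')
    moreover have "is_iso C (l \<cdot>\<^bsub>C\<^esub> (fmor F ((ev \<odot>\<^bsub>B\<^esub> ident B y) \<cdot>\<^bsub>B\<^esub> (inverse_mor B (assoc B y x y) \<cdot>\<^bsub>B\<^esub> (ident B y \<odot>\<^bsub>B\<^esub> coev))) \<cdot>\<^bsub>C\<^esub> r))"
      using F_iso[OF z(2)] lr by simp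
    ultimately show ?thesis by simp
  qed
  have "C.left.weakly_dual Y X ev' coev'"
    unfolding C.left.weakly_dual_def using iso1 iso2 by (simp add: hom_def)
  then show ?thesis unfolding X_def Y_def by blast
qed

sublocale image: tensor_generators C "fobj F ` obj B"
proof
  let ?S = "subquotients C (fobj F ` obj B)"
  have gen: "X \<in> ?S" if "b \<in> obj B" "isomorphic C (fobj F b) X" for b X
    using that by (intro C.subquotients_isomorphic[OF C.subquotients_gen that(2)]) auto
  show "fobj F ` obj B \<subseteq> obj C" by auto
  show "\<one>\<^bsub>C\<^esub> \<in> ?S"
    by (rule gen[OF B.unit_obj C.isomorphic_sym[OF C.isomorphicI[of "funit F"]]]) (auto simp: hom_def)
  fix g assume "g \<in> fobj F ` obj B"
  then obtain b where b: "b \<in> obj B" "g = fobj F b" by blast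
  show "Y \<in> ?S" if Y: "dual_pair C Y g" for Y
  proof -
    obtain ev co where w: "C.left.weakly_dual Y (fobj F b) ev co"
      using C.dual_pair_weakly_dual[OF Y] b by blast
    obtain b' ev1 co1 where b': "dual_pair B b' b" "B.left.weakly_dual b' b ev1 co1"
      using b(1) by (rule B.dualsE)
    have o: "b' \<in> obj B" "Y \<in> obj C" using b' Y by (auto simp: dual_pair_def)
    obtain ev2 co2 where w2: "C.left.weakly_dual (fobj F b') (fobj F b) ev2 co2"
      using weakly_dual_F[OF b'(2)] by blast
    \<comment> \<open>\<open>Y\<close> and \<open>fobj F b'\<close> are both left duals of
      \<open>fobj F b\<close>. The comparison along the identity embeds \<open>Y\<close> into
      \<open>fobj F b'\<close>, up to unit factors.\<close>
    have "\<one>\<^bsub>C\<^esub> \<otimes>\<^bsub>C\<^esub> fobj F b' \<in> ?S"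
      using gen[OF o(1)] C.isomorphic_sym[OF C.isomorphic_lunit] o by simp
    then have "\<one>\<^bsub>C\<^esub> \<otimes>\<^bsub>C\<^esub> Y \<in> ?S"
      using C.left_dual_mono[OF C.ident_hom C.iso_epi w2 w] b C.subquotients_sub by auto
    then show ?thesis using C.subquotients_isomorphic C.isomorphic_lunit[OF o(2)] by blast
  qed
  show "Y \<in> ?S" if Y: "dual_pair C g Y" for Y
  proof -
    obtain ev co where w: "C.left.weakly_dual (fobj F b) Y ev co"
      using C.dual_pair_weakly_dual[OF Y] b by blast
    obtain b' ev1 co1 where b': "dual_pair B b b'" "B.left.weakly_dual b b' ev1 co1"
      using b(1) by (rule B.dualsE)
    have o: "b' \<in> obj B" "Y \<in> obj C" using b' Y by (auto simp: dual_pair_def)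
    obtain ev2 co2 where w2: "C.left.weakly_dual (fobj F b) (fobj F b') ev2 co2"
      using weakly_dual_F[OF b'(2)] by blast
    have "fobj F b' \<otimes>\<^bsub>C\<^esub> \<one>\<^bsub>C\<^esub> \<in> ?S"
      using gen[OF o(1)] C.isomorphic_sym[OF C.isomorphic_runit] o by simp
    then have "Y \<otimes>\<^bsub>C\<^esub> \<one>\<^bsub>C\<^esub> \<in> ?S"
      using C.right_dual_mono[OF C.ident_hom C.iso_epi w2 w] b C.subquotients_sub by auto
    then show ?thesis using C.subquotients_isomorphic C.isomorphic_runit[OF o(2)] by blast
  qed
  fix h assume "h \<in> fobj F ` obj B"
  then obtain b' where b': "b' \<in> obj B" "h = fobj F b'" by blast
  have "isomorphic C (fobj F b \<otimes>\<^bsub>C\<^esub> fobj F b') (fobj F (b \<otimes>\<^bsub>B\<^esub> b'))"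
    using b b' by (intro C.isomorphicI[of "fmult F b b'"]) (auto simp: hom_def)
  then show "g \<otimes>\<^bsub>C\<^esub> h \<in> ?S"
    using gen[OF B.tensO_obj[OF b(1) b'(1)] C.isomorphic_sym] b b' by blast
  fix S assume S: "is_direct_sum C g h S"
  \<comment> \<open>The direct sum is formed in \<open>B\<close>; the images of its structure
    morphisms embed \<open>S\<close> into \<open>fobj F T\<close>.\<close>
  obtain T where T: "is_direct_sum B b b' T" using B.direct_sum b b' by blast
  obtain i j p q where s: "i \<in> hom B b T" "j \<in> hom B b' T" "p \<in> hom B T b" "q \<in> hom B T b'"
    "p \<cdot>\<^bsub>B\<^esub> i = ident B b" "q \<cdot>\<^bsub>B\<^esub> j = ident B b'" "p \<cdot>\<^bsub>B\<^esub> j = zero_mor B b' b" "q \<cdot>\<^bsub>B\<^esub> i = zero_mor B b b'"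
    using T by (rule B.direct_sumE)
  have "fmor F p \<cdot>\<^bsub>C\<^esub> fmor F i = ident C g" "fmor F q \<cdot>\<^bsub>C\<^esub> fmor F j = ident C h"
    "fmor F p \<cdot>\<^bsub>C\<^esub> fmor F j = zero_mor C h g" "fmor F q \<cdot>\<^bsub>C\<^esub> fmor F i = zero_mor C g h"
    using F_cmp[of i p] F_cmp[of j q] F_cmp[of j p] F_cmp[of i q] s b b'
    by (auto simp: hom_def F_ident F_zero)
  moreover have "g \<in> obj C" "h \<in> obj C" using b b' by auto
  ultimately obtain f where f: "f \<in> hom C S (fobj F T)" "is_mono C f"
    using C.direct_sum_embed[OF S F_hom[OF s(1), folded b(2)] F_hom[OF s(2), folded b'(2)]
        F_hom[OF s(3), folded b(2)] F_hom[OF s(4), folded b'(2)]]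
      C.iso_mono[OF C.is_iso_ident] by auto
  have "fobj F T \<in> ?S" using B.hom_obj(2)[OF s(1)] C.isomorphic_refl by (intro gen[of T]) auto
  then show "S \<in> ?S" using f C.subquotients_sub by blast
qed

text \<open>
  By \<open>subquotient_is_quotient\<close>, a subquotient of \<open>F b\<close> has a presentation by objects of the image,
  which by fullness is the image of a presentation in \<open>B\<close>.
\<close>

lemma essential_image_subquotients: "essential_image B C F = subquotients C (fobj F ` obj B)"
proof (intro equalityI subsetI)
  fix X assume "X \<in> essential_image B C F"
  then obtain b where b: "b \<in> obj B" "isomorphic C (fobj F b) X" unfolding essential_image_def by blast
  then show "X \<in> subquotients C (fobj F ` obj B)"
    by (intro C.subquotients_isomorphic[OF C.subquotients_gen b(2)]) auto
next
  fix X assume X: "X \<in> subquotients C (fobj F ` obj B)"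
  obtain b e where b: "b \<in> obj B" and e: "e \<in> hom C (fobj F b) X" "is_epi C e"
    using image.subquotient_is_quotient[OF X] by blast
  obtain k where "short_exact C k e" using e(2) by (rule C.short_exact_epi)
  then have ker: "is_kernel C e k" and cok: "is_cokernel C k e" by (auto simp: short_exact_def)
  note k' = C.kernelD[OF ker] and ee = C.homD[OF e(1)]
  define K where "K = src C k"
  have kh: "k \<in> hom C K (fobj F b)" using k' ee by (simp add: hom_def K_def)
  have "fobj F b \<in> subquotients C (fobj F ` obj B)" using b by (intro C.subquotients_gen) auto
  then have "K \<in> subquotients C (fobj F ` obj B)"
    using C.subquotients_sub kh C.kernel_mono[OF ker] by blast
  then obtain b' e' where b': "b' \<in> obj B" and e': "e' \<in> hom C (fobj F b') K" "is_epi C e'"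
    using image.subquotient_is_quotient by blast
  obtain \<phi> where \<phi>: "\<phi> \<in> hom B b' b" "fmor F \<phi> = k \<cdot>\<^bsub>C\<^esub> e'"
    using F_full[OF C.cmp_hom[OF e'(1) kh] b' b] .
  \<comment> \<open>Exactness of \<open>F\<close> speaks of short exact sequences, so
    \<open>\<phi>\<close> is split into an epi and a mono; the cokernel \<open>q\<close> of
    \<open>m\<close> is then preserved by \<open>F\<close>.\<close>
  obtain I \<epsilon> m where im: "\<epsilon> \<in> hom B b' I" "is_epi B \<epsilon>" "m \<in> hom B I b" "is_mono B m" "m \<cdot>\<^bsub>B\<^esub> \<epsilon> = \<phi>"
    using \<phi>(1) by (rule B.image_factorization)
  obtain q where q: "short_exact B m q" using im(4) by (rule B.short_exact_mono)
  obtain k0 where k0: "short_exact B k0 \<epsilon>" using im(2) by (rule B.short_exact_epi)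
  have qB: "is_cokernel B m q" using q by (simp add: short_exact_def)
  note q' = B.cokernelD[OF qB]
  define Q where "Q = tgt B q"
  have qh: "q \<in> hom B b Q" using q' im by (simp add: hom_def Q_def)
  have Q: "Q \<in> obj B" using B.hom_obj qh by blast
  have Fcok: "is_cokernel C (fmor F m) (fmor F q)" using exact[OF q] by (simp add: short_exact_def)
  have F\<epsilon>: "is_epi C (fmor F \<epsilon>)"
    using exact[OF k0] C.cokernel_epi by (auto simp: short_exact_def)
  have Fq: "is_epi C (fmor F q)" by (rule C.cokernel_epi[OF Fcok])
  note hh = F_hom[OF im(1), THEN C.homD(1)] F_hom[OF im(1), THEN C.homD(2)] F_hom[OF im(1), THEN C.homD(3)]
    F_hom[OF im(3), THEN C.homD(1)] F_hom[OF im(3), THEN C.homD(2)] F_hom[OF im(3), THEN C.homD(3)]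
    F_hom[OF qh, THEN C.homD(1)] F_hom[OF qh, THEN C.homD(2)] F_hom[OF qh, THEN C.homD(3)]
    C.homD[OF kh] C.homD[OF e'(1)] ee
  note Xo = C.hom_obj(2)[OF e(1)]
  have I: "I \<in> obj B" using B.hom_obj im by blast
  have F\<phi>: "fmor F m \<cdot>\<^bsub>C\<^esub> fmor F \<epsilon> = k \<cdot>\<^bsub>C\<^esub> e'"
    using F_cmp[of \<epsilon> m] im \<phi>(2) by (simp add: hom_def)
  have ek: "e \<cdot>\<^bsub>C\<^esub> k = zero_mor C K X" using k'(4) ee by (simp add: K_def)
  \<comment> \<open>\<open>e\<close> is the cokernel of \<open>k\<close>, \<open>fmor F q\<close>
    that of \<open>fmor F m\<close>, and \<open>k\<close> and \<open>fmor F m\<close> agree after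
    precomposition with epis. So each cokernel factors through the other, by \<open>t\<close> and
    \<open>t'\<close>.\<close>
  have "(e \<cdot>\<^bsub>C\<^esub> fmor F m) \<cdot>\<^bsub>C\<^esub> fmor F \<epsilon> = (e \<cdot>\<^bsub>C\<^esub> k) \<cdot>\<^bsub>C\<^esub> e'" using hh F\<phi> by simp
  also have "\<dots> = zero_mor C (src C (fmor F \<epsilon>)) X" unfolding ek using hh Xo by simp
  finally have "e \<cdot>\<^bsub>C\<^esub> fmor F m = zero_mor C (src C (fmor F m)) X"
    using C.epi_zero[OF F\<epsilon>, of "e \<cdot>\<^bsub>C\<^esub> fmor F m" X] C.cmp_hom[OF F_hom[OF im(3)] e(1)] hh by simp
  then obtain t where t: "t \<in> hom C (fobj F Q) X" "t \<cdot>\<^bsub>C\<^esub> fmor F q = e"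
    using C.cokernel_factor[OF Fcok, of e X] e(1) hh by auto
  have Fqm: "fmor F q \<cdot>\<^bsub>C\<^esub> fmor F m = zero_mor C (fobj F I) (fobj F Q)"
    using C.cokernelD(4)[OF Fcok] hh by simp
  have "(fmor F q \<cdot>\<^bsub>C\<^esub> k) \<cdot>\<^bsub>C\<^esub> e' = (fmor F q \<cdot>\<^bsub>C\<^esub> fmor F m) \<cdot>\<^bsub>C\<^esub> fmor F \<epsilon>"
    using hh F\<phi> by simp
  also have "\<dots> = zero_mor C (src C e') (fobj F Q)" unfolding Fqm using hh Q by simp
  finally have "fmor F q \<cdot>\<^bsub>C\<^esub> k = zero_mor C (src C k) (fobj F Q)"
    using C.epi_zero[OF e'(2), of "fmor F q \<cdot>\<^bsub>C\<^esub> k" "fobj F Q"] C.cmp_hom[OF kh F_hom[OF qh]] hh by simp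
  then obtain t' where t': "t' \<in> hom C X (fobj F Q)" "t' \<cdot>\<^bsub>C\<^esub> e = fmor F q"
    using C.cokernel_factor[OF cok, of "fmor F q" "fobj F Q"] F_hom[OF qh] hh by auto
  note tt = C.homD[OF t(1)] C.homD[OF t'(1)]
  have "(t \<cdot>\<^bsub>C\<^esub> t') \<cdot>\<^bsub>C\<^esub> e = t \<cdot>\<^bsub>C\<^esub> (t' \<cdot>\<^bsub>C\<^esub> e)" using tt hh by simp
  also have "\<dots> = ident C X \<cdot>\<^bsub>C\<^esub> e" unfolding t'(2) t(2) using hh by simp
  finally have 1: "t \<cdot>\<^bsub>C\<^esub> t' = ident C X"
    using C.is_epiD[OF e(2)] C.cmp_hom[OF t'(1) t(1)] C.ident_hom[OF Xo] ee by metis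
  have "(t' \<cdot>\<^bsub>C\<^esub> t) \<cdot>\<^bsub>C\<^esub> fmor F q = t' \<cdot>\<^bsub>C\<^esub> (t \<cdot>\<^bsub>C\<^esub> fmor F q)" using tt hh by simp
  also have "\<dots> = ident C (fobj F Q) \<cdot>\<^bsub>C\<^esub> fmor F q" unfolding t(2) t'(2) using hh by simp
  finally have 2: "t' \<cdot>\<^bsub>C\<^esub> t = ident C (fobj F Q)"
    using C.is_epiD[OF Fq] C.cmp_hom[OF t(1) t'(1)] C.ident_hom[OF F_obj[OF Q]] hh by metis
  have "isomorphic C (fobj F Q) X"
    using C.isomorphicI[OF C.is_isoI[OF t(1) t'(1) 2 1] t(1)] .
  then show "X \<in> essential_image B C F" using Q Xo unfolding essential_image_def by blast
qed

lemma essential_image_tensor_subcategory: "tensor_subcategory C (essential_image B C F)"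
  unfolding essential_image_subquotients ..

end

text \<open>The half-braiding carried by \<open>fobj F' b\<close> gives the isomorphism for
  \<open>fobj F b\<close>, and tensoring with isomorphisms extends it to the essential image. This
  is the point where centrality enters.\<close>

lemma (in finite_tensor_category) central_functor_commute:
  fixes B :: "('p, 'n, 'y) mon_cat_scheme" and F :: "('p, 'n, 'o, 'm) mon_functor"
  assumes "central_functor B \<beta> C F" "X \<in> obj C" "Y \<in> essential_image B C F"
  shows "isomorphic C (X \<otimes> Y) (Y \<otimes> X)"
proof -
  obtain b where b: "b \<in> obj B" "isomorphic C (fobj F b) Y"
    using assms(3) unfolding essential_image_def by blast
  obtain F' :: "('p, 'n, ('o, 'm) center_obj, ('o, 'm) center_mor) mon_functor"
    where F': "braided_monoidal_functor B \<beta> (drinfeld_center C) (center_braiding C) F'"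
      "mon_functor_eq B (mon_functor_comp C (center_forget C) F') F"
    using assms(1) unfolding central_functor_def by blast
  have "fobj F' b \<in> obj (drinfeld_center C)"
    using F'(1) b(1) by (simp add: braided_monoidal_functor_def strong_monoidal_functor_def is_functor_def)
  moreover have "fst (fobj F' b) = fobj F b"
    using F'(2) b(1) by (simp add: mon_functor_eq_def mon_functor_comp_def center_forget_def)
  ultimately obtain \<gamma> where "half_braiding C (fobj F b) \<gamma>"
    by (auto simp: drinfeld_center_def)
  then have "\<forall>X \<in> obj C. \<gamma> X \<in> hom C (X \<otimes> fobj F b) (fobj F b \<otimes> X) \<and> is_iso C (\<gamma> X)"
    unfolding half_braiding_def by (elim conjE)
  then have iso: "isomorphic C (X \<otimes> fobj F b) (fobj F b \<otimes> X)" using assms(2) isomorphicI by blast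
  have "isomorphic C (X \<otimes> Y) (X \<otimes> fobj F b)"
    by (rule isomorphic_tensor[OF isomorphic_refl[OF assms(2)] isomorphic_sym[OF b(2)]])
  also note iso
  also have "isomorphic C (fobj F b \<otimes> X) (Y \<otimes> X)"
    by (rule isomorphic_tensor[OF b(2) isomorphic_refl[OF assms(2)]])
  finally show ?thesis .
qed

theorem theorem3p2:
  fixes C :: "('o, 'm, 'k::alg_closed_field) lin_mon_cat"
    and B :: "('p, 'n, 'k) lin_mon_cat"
    and \<beta> :: "'p \<Rightarrow> 'p \<Rightarrow> 'n"
    and F :: "('p, 'n, 'o, 'm) mon_functor"
    and D\<^sub>1 D\<^sub>2 :: "'o set"
  assumes "finite_tensor_category C"
    and "central_tensor_subcategory C B \<beta> F"
    and "tensor_subcategory C D\<^sub>1" and "tensor_subcategory C D\<^sub>2"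
    and "D\<^sub>1 \<subseteq> D\<^sub>2"
  shows "D\<^sub>1 \<^bold>\<or>\<^bsub>C\<^esub> (essential_image B C F \<^bold>\<and> D\<^sub>2) = (D\<^sub>1 \<^bold>\<or>\<^bsub>C\<^esub> essential_image B C F) \<^bold>\<and> D\<^sub>2"
proof -
  interpret C: finite_tensor_category C by fact
  have B: "finite_tensor_category B" "tensor_functor B C F" "fully_faithful B C F" "central_functor B \<beta> C F"
    using assms(2) by (auto simp: central_tensor_subcategory_def)
  interpret F: fully_faithful_tensor_functor C B F
    by (intro fully_faithful_tensor_functor.intro fully_faithful_tensor_functor_axioms.intro assms(1) B)
  show ?thesis
    using C.modular_law[OF assms(3,4) F.essential_image_tensor_subcategory
        C.central_functor_commute[OF B(4)] assms(5)] .
qed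

end
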